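(* As $n\to\infty$, $$\mathbf M\log O_n(\alpha)=\frac12\log^2n-\log n(\log\log n-1)+\sum_\rho(\log n)^\rho\Gamma(-\rho)+O\big((\log\log n)^2\big),$$ where $\sum_\rho$ is the sum over all nontrivial zeros $\rho$ of the Riemann zeta-function.
   Context: $\mathbf M$ denotes expectation with respect to the uniform probability measure on the symmetric group $S_n$. For $\sigma\in S_n$, $\alpha_j(\sigma)$ is the number of cycles of length $j$ and $\alpha=(\alpha_1(\sigma),\dots,\alpha_n(\sigma))$; $O_n(a)=\mathrm{lcm}\{i\leqslant n: a_i>0\}$, so $O_n(\alpha(\sigma))$ is the order of $\sigma$. $\Gamma$ is Euler's Gamma function. *)

theory Defs
  imports
    "HOL-Complex_Analysis.Complex_Analysis"
    "HOL-Probability.Probability"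
    "HOL-Combinatorics.Combinatorics"
    "HOL-Library.Landau_Symbols"
begin

text \<open>
  The cycles of a permutation of \<open>{1..n}\<close> are its orbits; a fixed point is a cycle of length 1.
\<close>
definition cycle_count :: "nat \<Rightarrow> (nat \<Rightarrow> nat) \<Rightarrow> nat \<Rightarrow> nat" where
  "cycle_count n \<sigma> j = card {C \<in> orbit \<sigma> ` {1..n}. card C = j}"

definition O_lcm :: "nat \<Rightarrow> (nat \<Rightarrow> nat) \<Rightarrow> nat" where
  "O_lcm n a = Lcm {i \<in> {1..n}. a i > 0}"

definition sym_group_pmf :: "nat \<Rightarrow> (nat \<Rightarrow> nat) pmf" where
  "sym_group_pmf n = pmf_of_set {\<sigma>. \<sigma> permutes {1..n}}"

text \<open>
  The conditions below have exactly one solution (lemma \<open>zeta_unique_existence\<close>). The first two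
  determine the analytic continuation; the last one only fixes an arbitrary value at the pole.
\<close>
definition is_zeta :: "(complex \<Rightarrow> complex) \<Rightarrow> bool" where
  "is_zeta f \<longleftrightarrow> f holomorphic_on (-{1}) \<and>
     (\<forall>s. Re s > 1 \<longrightarrow> f s = (\<Sum>n. 1 / of_nat (Suc n) powr s)) \<and> f 1 = 0"

definition zeta :: "complex \<Rightarrow> complex" where
  "zeta = (THE f. is_zeta f)"

definition nontrivial_zeta_zeros :: "complex set" where
  "nontrivial_zeta_zeros = {\<rho>. 0 < Re \<rho> \<and> Re \<rho> < 1 \<and> zeta \<rho> = 0}"

text \<open>
  A zero is counted with its multiplicity, as the sum over zeros arises from the residues of
  \<open>zeta'/zeta\<close>.
\<close>
definition zero_term :: "real \<Rightarrow> complex \<Rightarrow> complex" where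
  "zero_term x \<rho> = of_int (zorder zeta \<rho>) * (of_real x powr \<rho> * Gamma (-\<rho>))"

text \<open>
  The continuation of \<open>(s - 1) zeta(s)\<close> is pushed one half-plane further to the left at a time:
  for \<open>Re s > 1\<close>, sum the expansion of \<open>(n + 1)\<^sup>1\<^sup>-\<^sup>s\<close> in powers of \<open>1/n\<close> up to order \<open>K\<close>
  over all \<open>n\<close>; the sum of the remainders converges for \<open>Re s > 1 - K\<close>.
\<close>

abbreviation npow :: "nat \<Rightarrow> complex \<Rightarrow> complex" where
  "npow n s \<equiv> of_nat (Suc n) powr s"

lemma norm_npow: "norm (npow n s) = real (Suc n) powr Re s"
proof -
  have "norm ((of_real (real (Suc n)) :: complex) powr s) = real (Suc n) powr Re s"
    by (subst norm_powr_real_powr) auto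
  thus ?thesis by (simp del: of_nat_Suc)
qed

lemma npow_hol: "g holomorphic_on A \<Longrightarrow> (\<lambda>s. npow n (g s)) holomorphic_on A"
proof -
  assume "g holomorphic_on A"
  hence "(\<lambda>s. exp (g s * Ln (of_nat (Suc n)))) holomorphic_on A"
    by (intro holomorphic_intros)
  moreover have "npow n (g s) = exp (g s * Ln (of_nat (Suc n)))" for s
    by (simp add: powr_def del: of_nat_Suc)
  ultimately show ?thesis by (simp del: of_nat_Suc)
qed

lemma summable_Suc_powr: "x < -1 \<Longrightarrow> summable (\<lambda>n. real (Suc n) powr x)"
  using summable_Suc_iff[of "\<lambda>n. real n powr x"] summable_real_powr_iff[of x] by simp

lemma suminf_holomorphic_halfplane:
  fixes g :: "nat \<Rightarrow> complex \<Rightarrow> complex"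
  assumes hol: "\<And>n. g n holomorphic_on {s. Re s > c}"
    and bound: "\<And>R. R > 0 \<Longrightarrow> \<exists>B. \<forall>n s. norm s \<le> R \<longrightarrow>
                   norm (g n s) \<le> B * real (Suc n) powr (c - 1 - Re s)"
  shows "(\<lambda>s. \<Sum>n. g n s) holomorphic_on {s. Re s > c}"
proof (rule holomorphic_uniform_sequence)
  show "open {s. Re s > c}" by (rule open_halfspace_Re_gt)
  show "(\<lambda>s. \<Sum>i<n. g i s) holomorphic_on {s. Re s > c}" for n
    by (intro holomorphic_intros hol)
  fix x assume "x \<in> {s. Re s > c}"
  define d where "d = (Re x - c) / 2"
  have d: "d > 0" using \<open>x \<in> _\<close> by (simp add: d_def)
  have Re: "Re s \<ge> c + d" if "s \<in> cball x d" for s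
  proof -
    have "Re (x - s) \<le> d"
      using that complex_Re_le_cmod[of "x - s"] by (simp add: dist_norm)
    thus ?thesis by (simp add: d_def field_simps)
  qed
  obtain B where B: "\<And>n s. norm s \<le> norm x + d \<Longrightarrow>
      norm (g n s) \<le> B * real (Suc n) powr (c - 1 - Re s)"
    using bound[of "norm x + d"] d by (metis add_nonneg_pos norm_ge_zero)
  have "uniform_limit (cball x d) (\<lambda>n s. \<Sum>i<n. g i s) (\<lambda>s. \<Sum>i. g i s) sequentially"
  proof (rule Weierstrass_m_test)
    show "summable (\<lambda>n. \<bar>B\<bar> * real (Suc n) powr (-1 - d))"
      using d by (intro summable_mult summable_Suc_powr) auto
    fix n s assume s: "s \<in> cball x d"
    have "norm s \<le> norm x + d"
      using s norm_triangle_ineq2[of s x] by (simp add: dist_norm norm_minus_commute)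
    from B[OF this, of n] have "norm (g n s) \<le> \<bar>B\<bar> * real (Suc n) powr (c - 1 - Re s)"
      by (meson abs_ge_self mult_right_mono order_trans powr_ge_zero)
    also have "\<dots> \<le> \<bar>B\<bar> * real (Suc n) powr (-1 - d)"
      using Re[OF s] by (intro mult_left_mono powr_mono) auto
    finally show "norm (g n s) \<le> \<bar>B\<bar> * real (Suc n) powr (-1 - d)" .
  qed
  thus "\<exists>d. 0 < d \<and> cball x d \<subseteq> {s. Re s > c} \<and>
          uniform_limit (cball x d) (\<lambda>n s. \<Sum>i<n. g i s) (\<lambda>s. \<Sum>i. g i s) sequentially"
    using d Re by (intro exI[of _ d]) (auto, fastforce)
qed

definition dseries :: "complex \<Rightarrow> complex" where
  "dseries s = (\<Sum>n. npow n (-s))"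

lemma dseries_sums: "Re s > 1 \<Longrightarrow> (\<lambda>n. npow n (-s)) sums dseries s"
  unfolding dseries_def
  by (rule summable_sums, rule summable_norm_cancel) (simp add: norm_npow summable_Suc_powr del: of_nat_Suc)

lemma dseries_hol: "dseries holomorphic_on {s. Re s > 1}"
  unfolding dseries_def [abs_def]
proof (rule suminf_holomorphic_halfplane)
  show "(\<lambda>s. npow n (-s)) holomorphic_on {s. Re s > 1}" for n
    by (intro npow_hol holomorphic_intros)
  show "\<exists>B. \<forall>n s. norm s \<le> R \<longrightarrow> norm (npow n (-s)) \<le> B * real (Suc n) powr (1 - 1 - Re s)"
    for R :: real
    by (rule exI[of _ 1]) (simp add: norm_npow del: of_nat_Suc)
qed

lemma binomial_remainder:
  fixes u R :: real and s :: complex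
  assumes u: "0 \<le> u" "u \<le> 1" and s: "norm s \<le> R"
  shows "norm ((1 + of_real u) powr (1 - s) - (\<Sum>k\<le>K. ((1 - s) gchoose k) * of_real u ^ k))
         \<le> ((\<Prod>j\<le>K. 1 + R + real j) * 2 powr (R + real K)) * u ^ Suc K"
proof -
  define S where "S = (of_real ` {0..1} :: complex set)"
  define f where "f = (\<lambda>i (z::complex). (\<Prod>j<i. 1 - s - of_nat j) * (1 + z) powr (1 - s - of_nat i))"
  define B where "B = (\<Prod>j\<le>K. 1 + R + real j) * 2 powr (R + real K)"
  have R: "R \<ge> 0" using s norm_ge_zero[of s] by linarith
  have "norm (f 0 (of_real u) - (\<Sum>i\<le>K. f i 0 * (of_real u - 0) ^ i / fact i))
          \<le> B * norm (of_real u - 0 :: complex) ^ Suc K / fact K"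
  proof (rule complex_Taylor)
    show "convex S" unfolding S_def
      by (intro convex_linear_image bounded_linear.linear bounded_linear_of_real) auto
    show "0 \<in> S" "of_real u \<in> S" using u by (auto simp: S_def image_iff intro: bexI[of _ 0])
    show "(f i has_field_derivative f (Suc i) x) (at x within S)" if "x \<in> S" for i x
    proof -
      have "1 + x \<notin> \<real>\<^sub>\<le>\<^sub>0" using that by (auto simp: S_def complex_nonpos_Reals_iff)
      hence "((\<lambda>z. z powr (1 - s - of_nat i)) has_field_derivative
                (1 - s - of_nat i) * (1 + x) powr (1 - s - of_nat i - 1)) (at (1 + x))"
        by (rule has_field_derivative_powr)
      hence "((\<lambda>z. (1 + z) powr (1 - s - of_nat i)) has_field_derivative
                (1 - s - of_nat i) * (1 + x) powr (1 - s - of_nat i - 1)) (at x)"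
        using DERIV_shift[of "\<lambda>z. z powr (1 - s - of_nat i)" _ x 1] by (simp only: add.commute)
      hence "((\<lambda>z. (1 + z) powr (1 - s - of_nat i)) has_field_derivative
                (1 - s - of_nat i) * (1 + x) powr (1 - s - of_nat i - 1)) (at x within S)"
        by (rule has_field_derivative_at_within)
      moreover have "1 - s - of_nat (Suc i) = 1 - s - of_nat i - 1" by simp
      ultimately show ?thesis
        unfolding f_def prod.lessThan_Suc
        by (simp only: mult.assoc) (rule DERIV_cmult)
    qed
    show "norm (f (Suc K) x) \<le> B" if x: "x \<in> S" for x
    proof -
      obtain t where t: "x = of_real t" "0 \<le> t" "t \<le> 1" using x unfolding S_def by (elim imageE) simp
      have "norm (\<Prod>j<Suc K. 1 - s - of_nat j) \<le> (\<Prod>j\<le>K. 1 + R + real j)"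
        unfolding lessThan_Suc_atMost prod_norm[symmetric]
      proof (intro prod_mono conjI norm_ge_zero)
        fix j
        have "norm (1 - s - of_nat j) \<le> norm (1 - s) + norm (of_nat j :: complex)"
          by (rule norm_triangle_ineq4)
        also have "norm (1 - s) \<le> 1 + norm s" using norm_triangle_ineq4[of 1 s] by simp
        finally show "norm (1 - s - of_nat j) \<le> 1 + R + real j" using s by simp
      qed
      moreover have "norm ((1 + x) powr (1 - s - of_nat (Suc K))) \<le> 2 powr (R + real K)"
      proof -
        have "norm ((of_real (1 + t) :: complex) powr (1 - s - of_nat (Suc K)))
                = (1 + t) powr Re (1 - s - of_nat (Suc K))"
          using t by (subst norm_powr_real_powr) auto
        also have "\<dots> \<le> (1 + t) powr (R + real K)"
          using t s abs_Re_le_cmod[of s] by (intro powr_mono) auto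
        also have "\<dots> \<le> 2 powr (R + real K)"
          using t R by (intro powr_mono2) auto
        finally show ?thesis by (simp add: t)
      qed
      ultimately show ?thesis unfolding f_def B_def norm_mult
        using R by (intro mult_mono prod_nonneg) auto
    qed
  qed
  moreover have "f 0 (of_real u) = (1 + of_real u) powr (1 - s)" by (simp add: f_def)
  moreover have "f i 0 * (of_real u - 0) ^ i / fact i = ((1 - s) gchoose i) * of_real u ^ i" for i
    by (simp add: f_def gbinomial_prod_rev atLeast0LessThan)
  moreover have "B * norm (of_real u - 0 :: complex) ^ Suc K / fact K \<le> B * u ^ Suc K"
  proof -
    have "B \<ge> 0" unfolding B_def using R by (intro mult_nonneg_nonneg prod_nonneg) auto
    hence "B * u ^ Suc K \<ge> 0" using u by auto
    moreover have "fact K \<ge> (1::real)" by (rule fact_ge_1)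
    ultimately have "B * u ^ Suc K / fact K \<le> B * u ^ Suc K / 1"
      by (intro divide_left_mono) auto
    thus ?thesis using u by simp
  qed
  ultimately show ?thesis unfolding B_def[symmetric] by simp
qed

definition zeta_rem :: "nat \<Rightarrow> nat \<Rightarrow> complex \<Rightarrow> complex" where
  "zeta_rem K n s = npow (Suc n) (1 - s) - (\<Sum>k\<le>K. ((1 - s) gchoose k) * npow n (1 - s - of_nat k))"

lemma zeta_rem_bound:
  assumes "norm s \<le> R"
  shows "norm (zeta_rem K n s) \<le> ((\<Prod>j\<le>K. 1 + R + real j) * 2 powr (R + real K)) *
           real (Suc n) powr ((1 - real K) - 1 - Re s)"
proof -
  define u where "u = 1 / real (Suc n)"
  define B where "B = (\<Prod>j\<le>K. 1 + R + real j) * 2 powr (R + real K)"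
  have u: "0 \<le> u" "u \<le> 1" by (auto simp: u_def)
  have 1: "npow (Suc n) (1 - s) = npow n (1 - s) * (1 + of_real u) powr (1 - s)"
  proof -
    have "(of_real (real (Suc n)) * of_real (1 + u) :: complex) powr (1 - s)
            = of_real (real (Suc n)) powr (1 - s) * of_real (1 + u) powr (1 - s)"
      using u by (intro powr_times_real) auto
    moreover have "(of_real (real (Suc n)) * of_real (1 + u) :: complex) = of_nat (Suc (Suc n))"
    proof -
      have "real (Suc n) * (1 + u) = real (Suc (Suc n))" by (simp add: u_def field_simps)
      thus ?thesis by (metis of_real_mult of_real_of_nat_eq)
    qed
    ultimately show ?thesis by (simp del: of_nat_Suc)
  qed
  have 2: "npow n (1 - s - of_nat k) = npow n (1 - s) * of_real u ^ k" for k
  proof -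
    have "npow n (1 - s - of_nat k) = npow n (1 - s) / npow n (of_nat k)"
      by (rule powr_diff)
    also have "npow n (of_nat k) = of_nat (Suc n) ^ k"
      by (rule powr_complexpow) (simp del: of_nat_Suc)
    finally show ?thesis by (simp add: u_def power_divide field_simps del: of_nat_Suc)
  qed
  have "zeta_rem K n s = npow n (1 - s) *
      ((1 + of_real u) powr (1 - s) - (\<Sum>k\<le>K. ((1 - s) gchoose k) * of_real u ^ k))"
    unfolding zeta_rem_def 1 2 by (simp add: right_diff_distrib sum_distrib_left mult_ac del: of_nat_Suc)
  hence "norm (zeta_rem K n s) \<le> real (Suc n) powr (1 - Re s) * (B * u ^ Suc K)"
    using binomial_remainder[OF u assms, of K]
    by (simp add: norm_mult norm_npow B_def mult_left_mono del: of_nat_Suc power_Suc)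
  also have "u ^ Suc K = real (Suc n) powr (- real (Suc K))"
    by (subst powr_minus, subst powr_realpow)
       (auto simp: u_def power_divide field_simps simp del: of_nat_Suc power_Suc)
  also have "real (Suc n) powr (1 - Re s) * (B * real (Suc n) powr (- real (Suc K)))
      = B * (real (Suc n) powr (1 - Re s) * real (Suc n) powr (- real (Suc K)))"
    by (simp only: mult_ac)
  also have "\<dots> = B * real (Suc n) powr ((1 - real K) - 1 - Re s)"
  proof -
    have "(1 - Re s) + (- real (Suc K)) = (1 - real K) - 1 - Re s" by simp
    thus ?thesis by (metis powr_add)
  qed
  finally show ?thesis by (simp add: B_def)
qed

lemma gchoose_hol: "(\<lambda>s. (1 - s) gchoose k) holomorphic_on (A :: complex set)"
  unfolding gbinomial_prod_rev by (intro holomorphic_intros) auto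

lemma zeta_rem_suminf_hol:
  "(\<lambda>s. \<Sum>n. zeta_rem K n s) holomorphic_on {s. Re s > 1 - real K}"
proof (rule suminf_holomorphic_halfplane)
  show "zeta_rem K n holomorphic_on {s. Re s > 1 - real K}" for n
    unfolding zeta_rem_def[abs_def]
    by (intro holomorphic_intros npow_hol gchoose_hol)
qed (use zeta_rem_bound in blast)

lemma zeta_rem_sums:
  assumes s: "Re s > 1"
  shows "(\<lambda>n. zeta_rem (Suc K) n s) sums
           (-1 - (\<Sum>k\<in>{1..Suc K}. ((1 - s) gchoose k) * dseries (s + of_nat k - 1)))"
proof -
  have "(\<lambda>n. npow n (1 - s)) \<longlonglongrightarrow> 0"
  proof (rule tendsto_norm_zero_cancel)
    have "(\<lambda>n. real (Suc n) powr (1 - Re s)) \<longlonglongrightarrow> 0"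
      using s by (intro tendsto_neg_powr filterlim_compose[OF filterlim_real_sequentially filterlim_Suc]) auto
    thus "(\<lambda>n. norm (npow n (1 - s))) \<longlonglongrightarrow> 0" by (simp add: norm_npow del: of_nat_Suc)
  qed
  from telescope_sums[OF this]
  have A: "(\<lambda>n. npow (Suc n) (1 - s) - npow n (1 - s)) sums (-1)" by simp
  have "(\<lambda>n. \<Sum>k\<in>{1..Suc K}. ((1 - s) gchoose k) * npow n (-(s + of_nat k - 1))) sums
          (\<Sum>k\<in>{1..Suc K}. ((1 - s) gchoose k) * dseries (s + of_nat k - 1))"
    using s by (intro sums_sum sums_mult dseries_sums) auto
  from sums_diff[OF A this] show "(\<lambda>n. zeta_rem (Suc K) n s) sums
           (-1 - (\<Sum>k\<in>{1..Suc K}. ((1 - s) gchoose k) * dseries (s + of_nat k - 1)))"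
  proof (rule sums_cong[THEN iffD1, rotated])
    fix n
    have "{..Suc K} = insert 0 {1..Suc K}" by auto
    hence "(\<Sum>k\<le>Suc K. ((1 - s) gchoose k) * npow n (1 - s - of_nat k)) =
        npow n (1 - s) + (\<Sum>k\<in>{1..Suc K}. ((1 - s) gchoose k) * npow n (1 - s - of_nat k))"
      by (simp del: of_nat_Suc)
    thus "npow (Suc n) (1 - s) - npow n (1 - s) -
      (\<Sum>k\<in>{1..Suc K}. ((1 - s) gchoose k) * npow n (-(s + of_nat k - 1))) = zeta_rem (Suc K) n s"
      unfolding zeta_rem_def by (simp add: algebra_simps del: of_nat_Suc)
  qed
qed

lemma dseries_recurrence:
  assumes s: "Re s > 1"
  shows "(s - 1) * dseries s = 1 + (\<Sum>n. zeta_rem (Suc m) n s) -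
     (\<Sum>k\<in>{1..m}. ((1 - s) gchoose k) / of_nat (Suc k) * ((s + of_nat k - 1) * dseries (s + of_nat k)))"
proof -
  define S where "S = (\<Sum>k\<in>{1..m}. ((1 - s) gchoose k) / of_nat (Suc k) *
                             ((s + of_nat k - 1) * dseries (s + of_nat k)))"
  define F where "F = (\<lambda>k. ((1 - s) gchoose k) * dseries (s + of_nat k - 1))"
  have "sum F {1..Suc m} = F 1 + sum F {Suc 1..Suc m}"
    by (rule sum.atLeast_Suc_atMost) simp
  also have "sum F {Suc 1..Suc m} = (\<Sum>k\<in>{1..m}. F (Suc k))"
    by (rule sum.shift_bounds_cl_Suc_ivl)
  finally have "(\<Sum>k\<in>{1..Suc m}. ((1 - s) gchoose k) * dseries (s + of_nat k - 1)) =
      (1 - s) * dseries s + (\<Sum>k\<in>{1..m}. ((1 - s) gchoose Suc k) * dseries (s + of_nat k))"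
    by (simp add: F_def)
  also have "(\<Sum>k\<in>{1..m}. ((1 - s) gchoose Suc k) * dseries (s + of_nat k)) =
      - (\<Sum>k\<in>{1..m}. ((1 - s) gchoose k) / of_nat (Suc k) * ((s + of_nat k - 1) * dseries (s + of_nat k)))"
    unfolding sum_negf[symmetric]
  proof (intro sum.cong refl)
    fix k
    have "of_nat (Suc k) * ((1 - s) gchoose Suc k) = (1 - s - of_nat k) * ((1 - s) gchoose k)"
      using gbinomial_mult_1'[of "1 - s" k] by (simp add: algebra_simps)
    hence "((1 - s) gchoose Suc k) = (1 - s - of_nat k) * ((1 - s) gchoose k) / of_nat (Suc k)"
      by (metis nonzero_mult_div_cancel_left of_nat_neq_0)
    moreover have "1 - s - of_nat k = - (s + of_nat k - 1)" by simp
    ultimately show "((1 - s) gchoose Suc k) * dseries (s + of_nat k) =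
        - (((1 - s) gchoose k) / of_nat (Suc k) * ((s + of_nat k - 1) * dseries (s + of_nat k)))"
      by (simp only: mult_minus_left minus_divide_left [symmetric] times_divide_eq_left times_divide_eq_right mult_ac mult_minus_right)
  qed
  finally have "(\<Sum>n. zeta_rem (Suc m) n s) = -1 - ((1 - s) * dseries s - S)"
    using sums_unique[OF zeta_rem_sums[OF s, of m]] by (simp add: S_def)
  thus ?thesis unfolding S_def [symmetric] by (simp add: algebra_simps)
qed

lemma zeta_continuation_halfplane:
  "\<exists>f. f holomorphic_on {s. Re s > 1 - real m} \<and> (\<forall>s. Re s > 1 \<longrightarrow> f s = (s - 1) * dseries s)"
proof (induction m)
  case 0
  show ?case by (rule exI[of _ "\<lambda>s. (s - 1) * dseries s"]) (auto intro!: holomorphic_intros dseries_hol)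
next
  case (Suc m)
  then obtain f where f: "f holomorphic_on {s. Re s > 1 - real m}"
    and eq: "\<And>s. Re s > 1 \<Longrightarrow> f s = (s - 1) * dseries s" by blast
  define h where "h = (\<lambda>s. 1 + (\<Sum>n. zeta_rem (Suc m) n s) -
     (\<Sum>k\<in>{1..m}. ((1 - s) gchoose k) / of_nat (Suc k) * f (s + of_nat k)))"
  have "(f \<circ> (\<lambda>s. s + of_nat k)) holomorphic_on {s. Re s > 1 - real (Suc m)}" if "k \<in> {1..m}" for k
    using that by (intro holomorphic_on_compose_gen[OF _ f] holomorphic_intros) auto
  hence "h holomorphic_on {s. Re s > 1 - real (Suc m)}"
    unfolding h_def o_def
    by (intro holomorphic_intros gchoose_hol zeta_rem_suminf_hol) (auto simp del: of_nat_Suc)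
  moreover have "h s = (s - 1) * dseries s" if "Re s > 1" for s
    unfolding h_def dseries_recurrence[OF that, of m]
    using that by (auto intro!: sum.cong simp: eq)
  ultimately show ?case by blast
qed

lemma zeta_continuation:
  "\<exists>Z. Z holomorphic_on UNIV \<and> (\<forall>s. Re s > 1 \<longrightarrow> Z s = (s - 1) * dseries s)"
proof -
  obtain f where f: "\<And>m. f m holomorphic_on {s. Re s > 1 - real m}"
    and eq: "\<And>m s. Re s > 1 \<Longrightarrow> f m s = (s - 1) * dseries s"
    using zeta_continuation_halfplane by metis
  have agree: "f m s = f n s" if "m \<le> n" "Re s > 1 - real m" for m n s
  proof (rule analytic_continuation_open[where s = "{s. Re s > 1}" and s' = "{s. Re s > 1 - real m}"
          and f = "f m" and g = "f n"])
    show "{s::complex. Re s > 1} \<noteq> {}" by (auto intro: exI[of _ 2])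
    show "connected {s. Re s > 1 - real m}"
      by (intro convex_connected convex_halfspace_Re_gt)
    show "f n holomorphic_on {s. Re s > 1 - real m}"
      using that by (intro holomorphic_on_subset[OF f]) auto
  qed (use that f eq in \<open>auto simp: open_halfspace_Re_gt\<close>)
  define N where "N = (\<lambda>s. nat \<lceil>2 - Re s\<rceil>)"
  define Z where "Z = (\<lambda>s. f (N s) s)"
  have N: "Re s > 1 - real (N s)" for s unfolding N_def by linarith
  have Z: "Z s = f m s" if "Re s > 1 - real m" for m s
    using agree[of m "N s" s] agree[of "N s" m s] N[of s] that unfolding Z_def by (metis nle_le)
  have "Z holomorphic_on (\<Union>m. {s. Re s > 1 - real m})"
  proof (rule holomorphic_on_UN_open)
    show "Z holomorphic_on {s. Re s > 1 - real m}" for m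
      using f[of m] by (rule holomorphic_transform) (simp add: Z)
  qed (auto simp: open_halfspace_Re_gt)
  moreover have "(\<Union>m. {s. Re s > 1 - real m}) = UNIV" using N by auto
  ultimately show ?thesis by (intro exI[of _ Z]) (auto simp: eq Z_def)
qed

lemma zeta_unique_existence: "\<exists>!f. is_zeta f"
proof (rule ex_ex1I)
  obtain Z where Z: "Z holomorphic_on UNIV" "\<And>s. Re s > 1 \<Longrightarrow> Z s = (s - 1) * dseries s"
    using zeta_continuation by blast
  define f where "f = (\<lambda>s. if s = 1 then 0 else Z s / (s - 1))"
  have "(\<lambda>s. Z s / (s - 1)) holomorphic_on (-{1})"
    by (intro holomorphic_intros holomorphic_on_subset[OF Z(1)]) auto
  hence "f holomorphic_on (-{1})"
    by (rule holomorphic_transform) (auto simp: f_def)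
  moreover have "f s = (\<Sum>n. 1 / npow n s)" if "Re s > 1" for s
  proof -
    have "s \<noteq> 1" using that by auto
    thus ?thesis using that
      by (simp add: f_def Z(2) dseries_def powr_minus divide_inverse del: of_nat_Suc)
  qed
  ultimately show "\<exists>f. is_zeta f" by (intro exI[of _ f]) (auto simp: is_zeta_def f_def)
next
  fix f g assume "is_zeta f" "is_zeta g"
  show "f = g"
  proof
    fix s
    show "f s = g s"
    proof (cases "s = 1")
      case False
      show ?thesis
      proof (rule analytic_continuation_open[where s = "{s. Re s > 1}" and s' = "-{1}"
            and f = f and g = g])
        show "{s::complex. Re s > 1} \<noteq> {}" by (auto intro: exI[of _ 2])
        show "connected (-{1::complex})"
          by (rule connected_punctured_universe) simp
      qed (use \<open>is_zeta f\<close> \<open>is_zeta g\<close> False in \<open>auto simp: is_zeta_def open_halfspace_Re_gt\<close>)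
    qed (use \<open>is_zeta f\<close> \<open>is_zeta g\<close> in \<open>auto simp: is_zeta_def\<close>)
  qed
qed

lemma is_zeta_zeta: "is_zeta zeta"
  unfolding zeta_def by (rule theI'[OF zeta_unique_existence])

end

theory Submission
  imports Defs "HOL-Number_Theory.Prime_Powers" "HOL-Real_Asymp.Real_Asymp"
begin

text \<open>
  A prime power \<open>d\<close> divides the order of \<open>\<sigma>\<close> iff it divides the length of some cycle, and no cycle
  length is divisible by \<open>d\<close> with probability \<open>\<Prod>i\<le>n/d. (1 - 1/(i d))\<close>. Hence the expectation is
  \<open>\<Sum>d\<le>n. \<Lambda>(d) (1 - \<Prod>i\<le>n/d. (1 - 1/(i d)))\<close>. The product is close to \<open>exp (- H(n/d) / d)\<close>, where \<open>H\<close> are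
  the harmonic numbers. The linear term \<open>\<Sum>d\<le>n. \<Lambda>(d) H(n/d) / d\<close> equals \<open>\<Sum>m\<le>n. ln m / m\<close>, which gives
  \<open>(ln n)\<^sup>2 / 2\<close>; in the remaining part \<open>H(n/d)\<close> may be replaced by \<open>x = ln n\<close> at the cost of
  \<open>O((ln x)\<^sup>2)\<close>, so that the expectation is \<open>(ln n)\<^sup>2 / 2 - F(x) + O((ln x)\<^sup>2)\<close> with
  \<open>F(x) = \<Sum>d. \<Lambda>(d) (exp (- x/d) - 1 + x/d) = \<Sum>k\<ge>2. (- x)\<^sup>k / k! * (- \<zeta>'/\<zeta>)(k)\<close>.

  The terms of the last series are, up to sign, the residues at \<open>k = 2, 3, \<dots>\<close> of
  \<open>\<Gamma>(-s) x\<^sup>s (- \<zeta>'/\<zeta>)(s)\<close>. The remaining residues to the right of a line \<open>Re s = a\<close> with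
  \<open>-1/2 \<le> a \<le> -1/4\<close> are \<open>x (ln x - 1)\<close> at the double pole \<open>1\<close>, a constant at \<open>0\<close>, and
  \<open>- x\<^sup>\<rho> \<Gamma>(-\<rho>)\<close> at the zeros; zeros with \<open>Re \<rho> \<le> 0\<close> contribute \<open>O(1)\<close>. Neither the functional equation nor
  the location of the zeros to the left of the critical strip is needed: a line \<open>Re s = a\<close> and horizontal lines
  that avoid all zeros by a polynomially small distance exist for reasons of measure, \<open>\<zeta>'/\<zeta>\<close> grows
  polynomially on them, and \<open>\<Gamma>\<close> decays exponentially.
\<close>

section \<open>The entire function \<open>(s - 1) \<zeta>(s)\<close>\<close>

text \<open>The obstacle is the region to the left of Re s = 1, where \<open>zeta\<close> is known
  only through the binomial recurrence behind its continuation. That recurrence gives the crude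
  growth bound exp (C (1 + |s|)) in every right half-plane. Fed into a local factorisation on discs
  of fixed size, it yields O(1 + |t|) zeros near height t instead of the true O(log |t|), and a
  polynomial bound for the logarithmic derivative away from the zeros. Both are dominated by the
  decay exp (-|t|) of \<open>Gamma\<close>, which also makes the sum over zeros converge absolutely.
  The constants of the contour argument depend neither on x >= 1 nor on the abscissa N + 1/2 of the
  right edge: on the left edge |x^s| <= 1, and on the right edge \<open>Gamma\<close> supplies 1 /
  N!. The height tends to infinity first, with N fixed, and then N. On the elementary side (ln x)^2
  is the size of the sum of mangoldt(d) (ln d + 1) / d over d up to about x. It is bounded through
  the simple pole of zeta'/zeta at 1 instead of through prime counting.\<close>

text \<open>The value 1 is the residue of \<open>zeta\<close> at its pole. The arbitrary
  \<open>zeta 1 = 0\<close> is discarded, so that the zeros are exactly those of the true zeta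
  function.\<close>

definition zeta_reg :: "complex \<Rightarrow> complex" where
  "zeta_reg s = (if s = 1 then 1 else (s - 1) * zeta s)"

lemma zeta_eq_dseries: "Re s > 1 \<Longrightarrow> zeta s = dseries s"
  using is_zeta_zeta
  by (auto simp: is_zeta_def dseries_def powr_minus divide_inverse simp del: of_nat_Suc)

text \<open>At s = 1 the expanded power is constant, so every binomial term but the first
  vanishes.\<close>

lemma zeta_rem_at_1 [simp]: "zeta_rem (Suc K) n 1 = 0"
proof -
  have "(\<Sum>k\<le>Suc K. ((1 - 1 :: complex) gchoose k) * npow n (1 - 1 - of_nat k))
          = (\<Sum>k\<in>{0}. ((1 - 1 :: complex) gchoose k) * npow n (1 - 1 - of_nat k))"
  proof (rule sum.mono_neutral_right)
    show "\<forall>i\<in>{..Suc K} - {0}. ((1 - 1 :: complex) gchoose i) * npow n (1 - 1 - of_nat i) = 0"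
    proof
      fix i assume "i \<in> {..Suc K} - {0}"
      then obtain j where "i = Suc j" by (cases i) auto
      thus "((1 - 1 :: complex) gchoose i) * npow n (1 - 1 - of_nat i) = 0" by simp
    qed
  qed auto
  thus ?thesis by (simp add: zeta_rem_def del: of_nat_Suc)
qed

text \<open>\<open>dseries_recurrence\<close> continued from Re s > 1. It is stated for an arbitrary
  continuation Z because it supplies the value Z 1 that identifies Z with \<open>zeta_reg\<close>,
  which is not known to be entire before that.\<close>

lemma zeta_reg_recurrence_aux:
  assumes Z: "Z holomorphic_on UNIV" "\<And>s. Re s > 1 \<Longrightarrow> Z s = (s - 1) * dseries s"
    and s: "Re s > - real m"
  shows "Z s = 1 + (\<Sum>n. zeta_rem (Suc m) n s) -
           (\<Sum>k\<in>{1..m}. ((1 - s) gchoose k) / of_nat (Suc k) * Z (s + of_nat k))"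
proof (rule analytic_continuation_open[where s = "{s. Re s > 1}" and s' = "{s. Re s > - real m}"
      and f = Z])
  show "{s::complex. Re s > 1} \<noteq> {}" by (auto intro: exI[of _ 2])
  show "connected {s. Re s > - real m}"
    by (intro convex_connected convex_halfspace_Re_gt)
  have "(Z \<circ> (\<lambda>s. s + of_nat k)) holomorphic_on {s. Re s > - real m}" for k
    by (intro holomorphic_on_compose_gen[OF _ Z(1)] holomorphic_intros) auto
  hence "(\<lambda>s. Z (s + of_nat k)) holomorphic_on {s. Re s > - real m}" for k
    by (simp add: o_def)
  moreover have "(\<lambda>s. \<Sum>n. zeta_rem (Suc m) n s) holomorphic_on {s. Re s > - real m}"
    using zeta_rem_suminf_hol[of "Suc m"] by simp
  ultimately show "(\<lambda>s. 1 + (\<Sum>n. zeta_rem (Suc m) n s) -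
      (\<Sum>k\<in>{1..m}. ((1 - s) gchoose k) / of_nat (Suc k) * Z (s + of_nat k)))
        holomorphic_on {s. Re s > - real m}"
    by (intro holomorphic_intros gchoose_hol) (auto simp del: of_nat_Suc)
  show "Z s = 1 + (\<Sum>n. zeta_rem (Suc m) n s) -
      (\<Sum>k\<in>{1..m}. ((1 - s) gchoose k) / of_nat (Suc k) * Z (s + of_nat k))"
    if "s \<in> {s. Re s > 1}" for s
    using that unfolding Z(2)[of s, simplified] dseries_recurrence[of s m, simplified]
    by (auto simp: Z(2) dseries_recurrence[of s m] intro!: sum.cong)
qed (use s Z in \<open>auto simp: open_halfspace_Re_gt intro: holomorphic_on_subset\<close>)

lemma zeta_reg_unique:
  assumes Z: "Z holomorphic_on UNIV" "\<And>s. Re s > 1 \<Longrightarrow> Z s = (s - 1) * dseries s"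
  shows "zeta_reg = Z"
proof
  fix s
  have "Z 1 = 1" using zeta_reg_recurrence_aux[OF Z, of 0 1] by simp
  show "zeta_reg s = Z s"
  proof (cases "s = 1")
    case False
    have "(s - 1) * zeta s = Z s"
    proof (rule analytic_continuation_open[where s = "{s. Re s > 1}" and s' = "-{1}"
          and f = "\<lambda>s. (s - 1) * zeta s" and g = Z])
      show "{s::complex. Re s > 1} \<noteq> {}" by (auto intro: exI[of _ 2])
      show "connected (-{1::complex})"
        by (rule connected_punctured_universe) simp
      show "(\<lambda>s. (s - 1) * zeta s) holomorphic_on - {1}"
        using is_zeta_zeta by (intro holomorphic_intros) (auto simp: is_zeta_def)
    qed (use False Z in \<open>auto simp: open_halfspace_Re_gt zeta_eq_dseries intro: holomorphic_on_subset\<close>)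
    thus ?thesis using False by (simp add: zeta_reg_def)
  qed (simp add: \<open>Z 1 = 1\<close> zeta_reg_def)
qed

lemma zeta_reg_entire: "zeta_reg holomorphic_on UNIV"
  using zeta_continuation zeta_reg_unique by metis

lemma zeta_reg_1 [simp]: "zeta_reg 1 = 1"
  by (simp add: zeta_reg_def)

lemma zeta_reg_dseries: "Re s > 1 \<Longrightarrow> zeta_reg s = (s - 1) * dseries s"
  by (auto simp: zeta_reg_def zeta_eq_dseries)

lemma zeta_reg_recurrence:
  assumes "Re s > - real m"
  shows "zeta_reg s = 1 + (\<Sum>n. zeta_rem (Suc m) n s) -
           (\<Sum>k\<in>{1..m}. ((1 - s) gchoose k) / of_nat (Suc k) * zeta_reg (s + of_nat k))"
  by (rule zeta_reg_recurrence_aux[OF zeta_reg_entire zeta_reg_dseries assms])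

text \<open>At s = 0 the power being expanded is linear, so its remainders vanish and the recurrence
  with m = 1 leaves 1 - 1/2. Since this is nonzero, the pole of the later integrand at 0 is
  simple.\<close>

lemma zeta_reg_0: "zeta_reg 0 = 1 / 2"
proof -
  have "zeta_rem (Suc 1) n 0 = 0" for n
    using of_nat_neq_0[of n, where ?'a = complex]
    by (simp add: zeta_rem_def numeral_2_eq_2 gbinomial_prod_rev)
  thus ?thesis using zeta_reg_recurrence[of 1 0] by simp
qed

text \<open>Termwise differentiation of the recurrence with m = 0 gives at s = 1 the classical
  series for Euler's constant. The exact value matters because it cancels the same constant coming
  from \<open>Gamma\<close> in the residue at the double pole.\<close>

lemma deriv_zeta_reg_1: "deriv zeta_reg 1 = euler_mascheroni"
proof -
  define S where "S = {s::complex. Re s > 0}"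
  have opS: "open S" unfolding S_def by (rule open_halfspace_Re_gt)
  define f' where "f' = (\<lambda>n s. - Ln (of_nat (Suc (Suc n))) * npow (Suc n) (1 - s)
     - (- Ln (of_nat (Suc n)) * npow n (1 - s) + (- npow n (- s) + (1 - s) * (- Ln (of_nat (Suc n)) * npow n (- s)))))"
  have der: "(zeta_rem 1 n has_field_derivative f' n s) (at s)" for n s
  proof -
    have eq: "zeta_rem 1 n = (\<lambda>s. exp ((1 - s) * Ln (of_nat (Suc (Suc n)))) -
       (exp ((1 - s) * Ln (of_nat (Suc n))) + (1 - s) * exp ((-s) * Ln (of_nat (Suc n)))))"
    proof
      fix s :: complex
      have eqs: "of_nat (Suc 0) = (1::complex)" "1 - s - 1 = - s" by (simp_all add: algebra_simps)
      show "zeta_rem 1 n s = exp ((1 - s) * Ln (of_nat (Suc (Suc n)))) -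
         (exp ((1 - s) * Ln (of_nat (Suc n))) + (1 - s) * exp ((-s) * Ln (of_nat (Suc n))))"
        by (simp add: zeta_rem_def powr_def eqs del: of_nat_Suc)
    qed
    show ?thesis unfolding eq
      by (rule derivative_eq_intros refl)+ (simp add: f'_def powr_def algebra_simps del: of_nat_Suc)
  qed
  \<comment> \<open>On the ball of radius d = Re x / 2 all real parts stay above d, which gives one
    convergent majorant of order n^(-1 - d).\<close>
  have bd: "\<exists>d h. 0 < d \<and> summable h \<and> range h \<subseteq> \<real>\<^sub>\<ge>\<^sub>0 \<and>
      (\<forall>\<^sub>F n in sequentially. \<forall>y\<in>ball x d \<inter> S. cmod (zeta_rem 1 n y) \<le> cmod (h n))" if "x \<in> S" for x
  proof -
    define d where "d = Re x / 2"
    have d: "d > 0" using that by (simp add: d_def S_def)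
    define B where "B = ((\<Prod>j\<le>1. 1 + (norm x + d) + real j) * 2 powr ((norm x + d) + real 1))"
    have B: "B \<ge> 0" unfolding B_def using d by (intro mult_nonneg_nonneg prod_nonneg) auto
    define h where "h = (\<lambda>n. complex_of_real (B * real (Suc n) powr (-1 - d)))"
    have sm: "summable h" unfolding h_def using d
      by (intro summable_of_real summable_mult summable_Suc_powr) auto
    have "cmod (zeta_rem 1 n y) \<le> cmod (h n)" if "y \<in> ball x d" for n y
    proof -
      have "norm y \<le> norm x + d"
        using that norm_triangle_ineq2[of y x] by (simp add: dist_norm norm_minus_commute)
      from zeta_rem_bound[OF this, of 1 n]
      have "norm (zeta_rem 1 n y) \<le> B * real (Suc n) powr (- 1 - Re y)" by (simp add: B_def)
      also have "\<dots> \<le> B * real (Suc n) powr (- 1 - d)"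
      proof -
        have "Re (x - y) \<le> d" using that complex_Re_le_cmod[of "x - y"] by (simp add: dist_norm)
        hence "Re y \<ge> d" by (simp add: d_def)
        thus ?thesis using B by (intro mult_left_mono powr_mono) auto
      qed
      also have "\<dots> = norm (h n)" using B by (simp add: h_def norm_mult del: of_nat_Suc)
      finally show ?thesis .
    qed
    moreover have "range h \<subseteq> \<real>\<^sub>\<ge>\<^sub>0" using B by (auto simp: h_def)
    ultimately show ?thesis using d sm by (intro exI[of _ d] exI[of _ h]) auto
  qed
  obtain g g' where g: "\<And>x. x \<in> S \<Longrightarrow> ((\<lambda>n. zeta_rem 1 n x) sums g x) \<and> ((\<lambda>n. f' n x) sums g' x) \<and>
       (g has_field_derivative g' x) (at x)"
    using series_and_derivative_comparison_complex[OF opS der bd] by blast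
  have "1 \<in> S" by (simp add: S_def)
  have "(\<lambda>n. f' n 1) sums g' 1" using g[OF \<open>1 \<in> S\<close>] by simp
  moreover have "f' n 1 = inverse (of_nat (n+1)) + of_real (ln (of_nat (n+1))) - of_real (ln (of_nat (n+2)))" for n
  proof -
    have "Ln (of_nat (Suc k)) = of_real (ln (of_nat (Suc k)))" for k
      by (metis Ln_of_real of_nat_0_less_iff of_real_of_nat_eq zero_less_Suc)
    thus ?thesis by (simp add: f'_def powr_minus del: of_nat_Suc)
  qed
  ultimately have g'1: "g' 1 = euler_mascheroni"
    using sums_unique2 euler_mascheroni_sum[where ?'a=complex] by simp
  have "((\<lambda>s. 1 + g s) has_field_derivative g' 1) (at 1)"
    using g[OF \<open>1 \<in> S\<close>] by (auto intro!: derivative_eq_intros)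
  from this opS \<open>1 \<in> S\<close> have "(zeta_reg has_field_derivative g' 1) (at 1)"
  proof (rule has_field_derivative_transform_within_open)
    show "1 + g s = zeta_reg s" if "s \<in> S" for s
  proof -
    have "g s = (\<Sum>n. zeta_rem 1 n s)" using g[OF that] by (simp add: sums_unique)
    thus ?thesis using zeta_reg_recurrence[of 0 s] that by (simp add: S_def)
  qed
  qed
  thus ?thesis using g'1 by (simp add: DERIV_imp_deriv)
qed

section \<open>Growth in right half-planes\<close>

text \<open>The exponent contains 1 + |s| instead of |s| so that constants and sums stay inside the
  class even where |s| is small.\<close>

definition exp_bounded :: "complex set \<Rightarrow> (complex \<Rightarrow> 'a::real_normed_vector) \<Rightarrow> bool" where
  "exp_bounded D f \<longleftrightarrow> (\<exists>C\<ge>0. \<forall>s\<in>D. norm (f s) \<le> exp (C * (1 + norm s)))"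

lemma exp_boundedI: "C \<ge> 0 \<Longrightarrow> (\<And>s. s \<in> D \<Longrightarrow> norm (f s) \<le> exp (C * (1 + norm s))) \<Longrightarrow> exp_bounded D f"
  by (auto simp: exp_bounded_def)

lemma exp_bounded_const: "exp_bounded D (\<lambda>_. c)"
proof (rule exp_boundedI)
  fix s :: complex
  have "norm c \<le> exp (norm c)" using exp_ge_add_one_self[of "norm c"] by linarith
  also have "\<dots> \<le> exp (norm c * (1 + norm s))" by (simp add: algebra_simps)
  finally show "norm c \<le> exp (norm c * (1 + norm s))" .
qed auto

lemma exp_bounded_norm: "exp_bounded D (\<lambda>s. norm s)"
proof (rule exp_boundedI[of 1])
  fix s :: complex
  show "norm (norm s) \<le> exp (1 * (1 + norm s))" using exp_ge_add_one_self[of "1 + norm s"] by simp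
qed auto

lemma exp_bounded_add:
  assumes "exp_bounded D f" "exp_bounded D g"
  shows "exp_bounded D (\<lambda>s. f s + g s)"
proof -
  obtain C1 C2 where C: "C1 \<ge> 0" "\<And>s. s \<in> D \<Longrightarrow> norm (f s) \<le> exp (C1 * (1 + norm s))"
    "C2 \<ge> 0" "\<And>s. s \<in> D \<Longrightarrow> norm (g s) \<le> exp (C2 * (1 + norm s))"
    using assms unfolding exp_bounded_def by blast
  show ?thesis
  \<comment> \<open>The additional 1 absorbs the factor 2 of the triangle inequality, as 2 <= exp (1
    + |s|).\<close>
  proof (rule exp_boundedI[of "max C1 C2 + 1"])
    fix s assume s: "s \<in> D"
    let ?u = "1 + norm s"
    have "norm (f s) \<le> exp (max C1 C2 * ?u)"
      by (rule order.trans[OF C(2)[OF s]]) (auto intro!: mult_right_mono)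
    moreover have "norm (g s) \<le> exp (max C1 C2 * ?u)"
      by (rule order.trans[OF C(4)[OF s]]) (auto intro!: mult_right_mono)
    moreover have "norm (f s + g s) \<le> norm (f s) + norm (g s)" by (rule norm_triangle_ineq)
    ultimately have "norm (f s + g s) \<le> 2 * exp (max C1 C2 * ?u)" by linarith
    also have "2 \<le> exp ?u" using exp_ge_add_one_self[of ?u] norm_ge_zero[of s] by linarith
    hence "2 * exp (max C1 C2 * ?u) \<le> exp ?u * exp (max C1 C2 * ?u)"
      by (intro mult_right_mono) auto
    also have "\<dots> = exp ((max C1 C2 + 1) * ?u)"
      unfolding exp_add[symmetric] by (simp add: algebra_simps)
    finally show "norm (f s + g s) \<le> exp ((max C1 C2 + 1) * ?u)" .
  qed (use C in auto)
qed

lemma exp_bounded_mult: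
  fixes f g :: "complex \<Rightarrow> 'a::real_normed_algebra"
  assumes "exp_bounded D f" "exp_bounded D g"
  shows "exp_bounded D (\<lambda>s. f s * g s)"
proof -
  obtain C1 C2 where C: "C1 \<ge> 0" "\<And>s. s \<in> D \<Longrightarrow> norm (f s) \<le> exp (C1 * (1 + norm s))"
    "C2 \<ge> 0" "\<And>s. s \<in> D \<Longrightarrow> norm (g s) \<le> exp (C2 * (1 + norm s))"
    using assms unfolding exp_bounded_def by blast
  show ?thesis
  proof (rule exp_boundedI[of "C1 + C2"])
    fix s assume s: "s \<in> D"
    have "norm (f s * g s) \<le> norm (f s) * norm (g s)" by (rule norm_mult_ineq)
    also have "\<dots> \<le> exp (C1 * (1 + norm s)) * exp (C2 * (1 + norm s))"
      using C s by (intro mult_mono) auto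
    also have "\<dots> = exp ((C1 + C2) * (1 + norm s))"
      unfolding exp_add[symmetric] by (simp add: algebra_simps)
    finally show "norm (f s * g s) \<le> exp ((C1 + C2) * (1 + norm s))" .
  qed (use C in auto)
qed

lemma exp_bounded_sum:
  assumes "\<And>i. i \<in> A \<Longrightarrow> exp_bounded D (f i)"
  shows "exp_bounded D (\<lambda>s. \<Sum>i\<in>A. f i s)"
  using assms
  by (induction A rule: infinite_finite_induct) (auto intro: exp_bounded_const exp_bounded_add)

lemma exp_bounded_prod:
  fixes f :: "'b \<Rightarrow> complex \<Rightarrow> 'a::{real_normed_algebra, comm_ring_1}"
  assumes "\<And>i. i \<in> A \<Longrightarrow> exp_bounded D (f i)"
  shows "exp_bounded D (\<lambda>s. \<Prod>i\<in>A. f i s)"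
  using assms
  by (induction A rule: infinite_finite_induct) (auto intro: exp_bounded_const exp_bounded_mult)

lemma exp_bounded_le:
  assumes "exp_bounded D g" "\<And>s. s \<in> D \<Longrightarrow> norm (f s) \<le> norm (g s)"
  shows "exp_bounded D f"
  using assms unfolding exp_bounded_def by (meson order_trans)

lemma exp_bounded_shift:
  assumes "exp_bounded D' f" "\<And>s. s \<in> D \<Longrightarrow> s + c \<in> D'"
  shows "exp_bounded D (\<lambda>s. f (s + c))"
proof -
  obtain C where C: "C \<ge> 0" "\<And>s. s \<in> D' \<Longrightarrow> norm (f s) \<le> exp (C * (1 + norm s))"
    using assms unfolding exp_bounded_def by blast
  show ?thesis
  proof (rule exp_boundedI[of "C * (1 + norm c)"])
    fix s assume s: "s \<in> D"
    have "norm (f (s + c)) \<le> exp (C * (1 + norm (s + c)))" using C assms(2)[OF s] by auto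
    also have "norm (s + c) \<le> norm s + norm c" by (rule norm_triangle_ineq)
    also have "1 + (norm s + norm c) \<le> (1 + norm c) * (1 + norm s)" by (simp add: algebra_simps)
    finally show "norm (f (s + c)) \<le> exp (C * (1 + norm c) * (1 + norm s))"
      using C(1) by (simp add: mult_left_mono mult.assoc)
  qed (use C in auto)
qed

lemma exp_bounded_powr: "exp_bounded D (\<lambda>s. 2 powr (norm s + c) :: real)"
proof -
  have "exp_bounded D (\<lambda>s. 2 powr norm s :: real)"
  proof (rule exp_boundedI[of "ln 2"])
    fix s :: complex
    show "norm (2 powr norm s :: real) \<le> exp (ln 2 * (1 + norm s))"
      by (simp add: powr_def)
  qed auto
  thus ?thesis unfolding powr_add by (intro exp_bounded_mult exp_bounded_const)
qed

text \<open>The series converges for Re s > -m. Staying 1/2 away from that boundary makes n^(-3/2) a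
  majorant, and the remaining factor is the constant of \<open>zeta_rem_bound\<close> with R =
  |s|.\<close>

lemma zeta_rem_suminf_exp_bounded:
  "exp_bounded {s. Re s \<ge> 1/2 - real m} (\<lambda>s. \<Sum>n. zeta_rem (Suc m) n s)"
proof -
  define D where "D = {s. Re s \<ge> 1/2 - real m}"
  define S where "S = (\<Sum>n. real (Suc n) powr (-3/2))"
  have sm: "summable (\<lambda>n. real (Suc n) powr (-3/2))" by (rule summable_Suc_powr) simp
  define B where "B = (\<lambda>s::complex. (\<Prod>j\<le>Suc m. 1 + norm s + real j) * 2 powr (norm s + real (Suc m)))"
  have "exp_bounded D (\<lambda>s. B s * S)"
    unfolding B_def
    by (intro exp_bounded_mult exp_bounded_prod exp_bounded_add exp_bounded_const exp_bounded_norm exp_bounded_powr)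
  thus ?thesis unfolding D_def[symmetric]
  proof (rule exp_bounded_le)
    fix s assume s: "s \<in> D"
    have B: "B s \<ge> 0" unfolding B_def by (intro mult_nonneg_nonneg prod_nonneg) auto
    have S: "S \<ge> 0" unfolding S_def by (intro suminf_nonneg sm) auto
    have "norm (zeta_rem (Suc m) n s) \<le> B s * real (Suc n) powr (-3/2)" for n
    proof -
      have "norm (zeta_rem (Suc m) n s) \<le> B s * real (Suc n) powr ((1 - real (Suc m)) - 1 - Re s)"
        unfolding B_def by (rule zeta_rem_bound) auto
      also have "\<dots> \<le> B s * real (Suc n) powr (-3/2)"
        using s B by (intro mult_left_mono powr_mono) (auto simp: D_def)
      finally show ?thesis .
    qed
    hence "norm (\<Sum>n. zeta_rem (Suc m) n s) \<le> (\<Sum>n. B s * real (Suc n) powr (-3/2))"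
      by (intro norm_suminf_le summable_mult sm)
    also have "\<dots> = B s * S" unfolding S_def by (rule suminf_mult[OF sm])
    finally show "norm (\<Sum>n. zeta_rem (Suc m) n s) \<le> norm (B s * S)" using B S by simp
  qed
qed

lemma gbinomial_exp_bounded: "exp_bounded D (\<lambda>s::complex. (1 - s) gchoose k)"
proof -
  have "exp_bounded D (\<lambda>s::complex. \<Prod>i=0..<k. 1 - s - of_nat i)"
  proof (rule exp_bounded_prod, goal_cases)
    case (1 i)
    have "exp_bounded D (\<lambda>s::complex. norm s + (1 + real i))"
      by (intro exp_bounded_add exp_bounded_norm exp_bounded_const)
    thus ?case
    proof (rule exp_bounded_le)
      fix s :: complex
      have "norm (1 - s - of_nat i) \<le> norm (1 - s) + norm (of_nat i :: complex)" by (rule norm_triangle_ineq4)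
      also have "norm (1 - s) \<le> 1 + norm s" using norm_triangle_ineq4[of 1 s] by simp
      finally show "norm (1 - s - of_nat i) \<le> norm (norm s + (1 + real i))" by simp
    qed
  qed
  hence "exp_bounded D (\<lambda>s::complex. (\<Prod>i=0..<k. 1 - s - of_nat i) * (1 / fact k))"
    by (intro exp_bounded_mult exp_bounded_const)
  thus ?thesis by (simp add: gbinomial_prod_rev)
qed

text \<open>Each s + k in the recurrence lies in the half-plane belonging to m - k, so strong
  induction applies.\<close>

lemma zeta_reg_exp_bounded: "exp_bounded {s. Re s \<ge> 1/2 - real m} zeta_reg"
proof (induction m rule: less_induct)
  case (less m)
  define D where "D = {s. Re s \<ge> 1/2 - real m}"
  have "exp_bounded D (\<lambda>s. 1 + (\<Sum>n. zeta_rem (Suc m) n s) + (-1) *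
           (\<Sum>k\<in>{1..m}. ((1 - s) gchoose k) * (1 / of_nat (Suc k)) * zeta_reg (s + of_nat k)))"
  proof (intro exp_bounded_add exp_bounded_mult exp_bounded_sum exp_bounded_const gbinomial_exp_bounded)
    show "exp_bounded D (\<lambda>s. \<Sum>n. zeta_rem (Suc m) n s)"
      unfolding D_def by (rule zeta_rem_suminf_exp_bounded)
    show "exp_bounded D (\<lambda>s. zeta_reg (s + of_nat k))" if "k \<in> {1..m}" for k
      by (rule exp_bounded_shift[OF less.IH[of "m - k"]]) (use that in \<open>auto simp: D_def\<close>)
  qed
  thus ?case unfolding D_def[symmetric]
    by (rule exp_bounded_le) (subst zeta_reg_recurrence[of m], auto simp: D_def simp del: of_nat_Suc)
qed

section \<open>The Dirichlet series of \<open>-\<zeta>'/\<zeta>\<close>\<close>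

definition mseries :: "complex \<Rightarrow> complex" where
  "mseries s = (\<Sum>n. mangoldt (Suc n) * npow n (-s))"

lemma ln_le_powr:
  fixes x e :: real assumes "x \<ge> 1" "e > 0"
  shows "ln x \<le> x powr e / e"
proof -
  have "e * ln x \<le> exp (e * ln x)" using exp_ge_add_one_self[of "e * ln x"] by linarith
  thus ?thesis using assms by (simp add: powr_def field_simps)
qed

lemma summable_ln_powr:
  assumes "x < -1"
  shows "summable (\<lambda>n. ln (real (Suc n)) * real (Suc n) powr x)"
proof (rule summable_comparison_test')
  define e where "e = (-1 - x) / 2"
  have e: "e > 0" using assms by (simp add: e_def)
  have "x + e < -1" using assms by (simp add: e_def field_simps)
  thus "summable (\<lambda>n. real (Suc n) powr (x + e) * (1 / e))"
    by (intro summable_mult2 summable_Suc_powr)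
  fix n
  have "ln (real (Suc n)) * real (Suc n) powr x \<le> (real (Suc n) powr e / e) * real (Suc n) powr x"
    by (intro mult_right_mono ln_le_powr e) auto
  thus "norm (ln (real (Suc n)) * real (Suc n) powr x) \<le> real (Suc n) powr (x + e) * (1 / e)"
    by (simp add: powr_add mult_ac del: of_nat_Suc)
qed

lemma summable_mangoldt_powr:
  assumes "x < -1"
  shows "summable (\<lambda>n. mangoldt (Suc n) * real (Suc n) powr x)"
  by (rule summable_comparison_test'[OF summable_ln_powr[OF assms], of 0])
     (auto simp: mangoldt_nonneg abs_mult intro!: mult_right_mono mangoldt_le simp del: of_nat_Suc)

lemma mseries_summable:
  assumes "Re s > 1"
  shows "summable (\<lambda>n. norm (mangoldt (Suc n) * npow n (-s)))"
  using summable_mangoldt_powr[of "- Re s"] assms by (simp add: norm_mult norm_npow del: of_nat_Suc)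

lemma mseries_sums: "Re s > 1 \<Longrightarrow> (\<lambda>n. mangoldt (Suc n) * npow n (-s)) sums mseries s"
  unfolding mseries_def by (rule summable_sums[OF summable_norm_cancel[OF mseries_summable]])

text \<open>The coefficients are nonnegative, so the series is largest on the real axis; this bounds
  the logarithmic derivative uniformly far to the right.\<close>

lemma norm_mseries_le:
  assumes "1 < c" "c \<le> Re s"
  shows "norm (mseries s) \<le> Re (mseries (of_real c))"
proof -
  have "norm (mseries s) \<le> (\<Sum>n. mangoldt (Suc n) * real (Suc n) powr (-c))"
    unfolding mseries_def
  proof (rule norm_suminf_le)
    show "summable (\<lambda>n. mangoldt (Suc n) * real (Suc n) powr (-c))"
      by (rule summable_mangoldt_powr) (use assms in auto)
    show "norm (mangoldt (Suc n) * npow n (-s)) \<le> mangoldt (Suc n) * real (Suc n) powr (-c)" for n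
      using assms by (simp add: norm_mult norm_npow mangoldt_nonneg mult_left_mono powr_mono del: of_nat_Suc)
  qed
  moreover have "complex_of_real (\<Sum>n. mangoldt (Suc n) * real (Suc n) powr (-c)) = mseries (of_real c)"
  proof -
    have "complex_of_real (mangoldt (Suc n) * real (Suc n) powr (-c)) = mangoldt (Suc n) * npow n (- of_real c)" for n
      using powr_of_real[of "real (Suc n)" "-c"] by (simp del: of_nat_Suc)
    moreover have "summable (\<lambda>n. mangoldt (Suc n) * real (Suc n) powr (-c))"
      by (rule summable_mangoldt_powr) (use assms in auto)
    ultimately show ?thesis
      unfolding mseries_def by (simp only: suminf_of_real)
  qed
  hence "(\<Sum>n. mangoldt (Suc n) * real (Suc n) powr (-c)) = Re (mseries (of_real c))"
    by (metis Re_complex_of_real)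
  ultimately show ?thesis by simp
qed

section \<open>The convolution identity behind the logarithmic derivative\<close>

text \<open>The sum of \<open>mangoldt\<close> over the divisors of m is ln m. This is read as a
  product of absolutely convergent Dirichlet series: the double sum over factor pairs is regrouped
  by their product.\<close>

lemma dseries_times_mseries:
  assumes s: "Re s > 1"
  shows "(\<lambda>n. of_real (ln (real (Suc n))) * npow n (-s)) sums (dseries s * mseries s)"
proof -
  define N where "N = {1::nat..}"
  define f where "f = (\<lambda>n::nat. (of_nat n :: complex) powr (-s))"
  define g where "g = (\<lambda>n::nat. mangoldt n * (of_nat n :: complex) powr (-s))"
  have conv: "(h has_sum l) N" if "(\<lambda>n. h (Suc n)) sums l" "summable (\<lambda>n. norm (h (Suc n)))"
    for h :: "nat \<Rightarrow> complex" and l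
  proof -
    have "((\<lambda>n. h (Suc n)) has_sum l) UNIV"
      by (rule norm_summable_imp_has_sum[OF that(2,1)])
    moreover have "N = range Suc" by (auto simp: N_def image_def) (metis Suc_pred' Suc_le_eq One_nat_def)
    ultimately show ?thesis by (simp add: has_sum_reindex o_def)
  qed
  have f: "(f has_sum dseries s) N"
    by (rule conv) (use dseries_sums[OF s] s in \<open>simp_all add: f_def norm_npow summable_Suc_powr del: of_nat_Suc\<close>)
  have g: "(g has_sum mseries s) N"
    by (rule conv) (use mseries_sums[OF s] mseries_summable[OF s] in \<open>simp_all add: g_def del: of_nat_Suc\<close>)
  have absconv: "(\<lambda>n. norm (h n)) summable_on N" if "summable (\<lambda>n. norm (h (Suc n)))" for h :: "nat \<Rightarrow> complex"
  proof -
    have "(\<lambda>n. norm (h (Suc n))) summable_on UNIV"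
      by (rule norm_summable_imp_summable_on) (use that in auto)
    moreover have "N = range Suc" by (auto simp: N_def image_def) (metis Suc_pred' Suc_le_eq One_nat_def)
    ultimately show ?thesis by (simp add: summable_on_reindex o_def)
  qed
  have af: "(\<lambda>n. norm (f n)) summable_on N"
    by (rule absconv) (use s in \<open>simp add: f_def norm_npow summable_Suc_powr del: of_nat_Suc\<close>)
  have ag: "(\<lambda>n. norm (g n)) summable_on N"
    by (rule absconv) (use mseries_summable[OF s] in \<open>simp add: g_def del: of_nat_Suc\<close>)
  have "(\<lambda>x. norm (case x of (a, b) \<Rightarrow> f a * g b)) summable_on N \<times> N"
  proof (rule summable_on_SigmaI)
    show "((\<lambda>b. norm (case (a, b) of (a, b) \<Rightarrow> f a * g b)) has_sum (norm (f a) * (\<Sum>\<^sub>\<infinity>b\<in>N. norm (g b)))) N" for a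
      using has_sum_cmult_right[OF has_sum_infsum[OF ag], of "norm (f a)"] by (simp add: norm_mult)
    show "(\<lambda>a. norm (f a) * (\<Sum>\<^sub>\<infinity>b\<in>N. norm (g b))) summable_on N"
      by (rule summable_on_cmult_left[OF af])
  qed auto
  hence sm: "(\<lambda>(a, b). f a * g b) summable_on N \<times> N" by (rule abs_summable_summable)
  have prod: "((\<lambda>(a, b). f a * g b) has_sum (dseries s * mseries s)) (N \<times> N)"
  proof (rule has_sum_SigmaI)
    show "((\<lambda>b. case (a, b) of (a, b) \<Rightarrow> f a * g b) has_sum f a * mseries s) N" for a
      using has_sum_cmult_right[OF g, of "f a"] by simp
    show "((\<lambda>a. f a * mseries s) has_sum dseries s * mseries s) N"
      by (rule has_sum_cmult_left[OF f])
  qed (use sm in auto)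
  define D where "D = (SIGMA m:N. {d. d dvd m})"
  have bij: "bij_betw (\<lambda>(m, d). (m div d, d)) D (N \<times> N)"
    by (rule bij_betwI[of _ _ _ "\<lambda>(a, b). (a * b, b)"])
       (auto simp: D_def N_def Suc_le_eq elim!: dvdE)
  have "((\<lambda>(m, d). f (m div d) * g d) has_sum (dseries s * mseries s)) D"
    using prod has_sum_reindex_bij_betw[OF bij, of "\<lambda>(a, b). f a * g b"] by (simp add: case_prod_unfold)
  hence "((\<lambda>(m, d). mangoldt d * (of_nat m :: complex) powr (-s)) has_sum (dseries s * mseries s)) D"
  proof (rule has_sum_cong[THEN iffD1, rotated])
    fix x assume "x \<in> D"
    then obtain m d where x: "x = (m, d)" "m \<ge> 1" "d dvd m" by (auto simp: D_def N_def)
    then obtain k where k: "m = d * k" by (elim dvdE)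
    have pos: "d > 0" "k > 0" using x k by (auto intro!: Nat.gr0I)
    have "(of_real (real k) * of_real (real d) :: complex) powr (-s) = of_real (real k) powr (-s) * of_real (real d) powr (-s)"
      by (rule powr_times_real) auto
    thus "(case x of (m, d) \<Rightarrow> f (m div d) * g d) = (case x of (m, d) \<Rightarrow> mangoldt d * of_nat m powr (-s))"
      using pos by (simp add: x k f_def g_def mult_ac)
  qed
  hence "((\<lambda>m. of_real (ln (real m)) * (of_nat m :: complex) powr (-s)) has_sum (dseries s * mseries s)) N"
    unfolding D_def
  proof (rule has_sum_SigmaD)
    fix m assume m: "m \<in> N"
    hence fin: "finite {d. d dvd m}" by (auto simp: N_def)
    have "(\<Sum>d | d dvd m. (mangoldt d :: complex) * of_nat m powr (-s)) = of_real (ln (real m)) * of_nat m powr (-s)"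
      using m by (simp add: sum_distrib_right[symmetric] mangoldt_sum N_def)
    thus "((\<lambda>d. case (m, d) of (m, d) \<Rightarrow> mangoldt d * (of_nat m :: complex) powr (-s)) has_sum
        (of_real (ln (real m)) * of_nat m powr (-s))) {d. d dvd m}"
      using has_sum_finite[OF fin, of "\<lambda>d. mangoldt d * (of_nat m :: complex) powr (-s)"] by simp
  qed
  moreover have "N = range Suc" by (auto simp: N_def image_def) (metis Suc_pred' Suc_le_eq One_nat_def)
  ultimately have "((\<lambda>n. of_real (ln (real (Suc n))) * npow n (-s)) has_sum (dseries s * mseries s)) UNIV"
    by (simp add: has_sum_reindex o_def del: of_nat_Suc)
  thus ?thesis by (rule has_sum_imp_sums)
qed

text \<open>Termwise differentiation produces the series of -ln n * n^(-s), which the convolution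
  identity factors. The product form matters: nonvanishing of \<open>dseries\<close> is deduced from
  it, so dividing by \<open>dseries\<close> is not yet possible.\<close>

lemma dseries_has_field_derivative:
  assumes s: "Re s > 1"
  shows "(dseries has_field_derivative (- dseries s * mseries s)) (at s)"
proof -
  define S where "S = {s::complex. Re s > 1}"
  have opS: "open S" unfolding S_def by (rule open_halfspace_Re_gt)
  define f' where "f' = (\<lambda>n s. - Ln (of_nat (Suc n)) * npow n (- s))"
  have der: "((\<lambda>s. npow n (-s)) has_field_derivative f' n s) (at s)" for n s
  proof -
    have eq: "(\<lambda>s. npow n (-s)) = (\<lambda>s. exp ((-s) * Ln (of_nat (Suc n))))"
      by (rule ext) (simp add: powr_def del: of_nat_Suc)
    show ?thesis unfolding eq
      by (rule derivative_eq_intros refl)+ (simp add: f'_def powr_def algebra_simps del: of_nat_Suc)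
  qed
  have bd: "\<exists>d h. 0 < d \<and> summable h \<and> range h \<subseteq> \<real>\<^sub>\<ge>\<^sub>0 \<and>
      (\<forall>\<^sub>F n in sequentially. \<forall>y\<in>ball x d \<inter> S. cmod (npow n (-y)) \<le> cmod (h n))" if "x \<in> S" for x
  proof -
    define d where "d = (Re x - 1) / 2"
    have d: "d > 0" using that by (simp add: d_def S_def)
    define h where "h = (\<lambda>n. complex_of_real (real (Suc n) powr (-1 - d)))"
    have sm: "summable h" unfolding h_def using d
      by (intro summable_of_real summable_Suc_powr) auto
    have "cmod (npow n (-y)) \<le> cmod (h n)" if "y \<in> ball x d" for n y
    proof -
      have "Re (x - y) \<le> d" using that complex_Re_le_cmod[of "x - y"] by (simp add: dist_norm)
      hence "Re y \<ge> 1 + d" by (simp add: d_def field_simps)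
      hence "real (Suc n) powr (- Re y) \<le> real (Suc n) powr (- 1 - d)" by (intro powr_mono) auto
      thus ?thesis by (simp add: h_def norm_npow del: of_nat_Suc)
    qed
    moreover have "range h \<subseteq> \<real>\<^sub>\<ge>\<^sub>0" by (auto simp: h_def)
    ultimately show ?thesis using d sm by (intro exI[of _ d] exI[of _ h]) auto
  qed
  obtain g g' where g: "\<And>x. x \<in> S \<Longrightarrow> ((\<lambda>n. npow n (-x)) sums g x) \<and> ((\<lambda>n. f' n x) sums g' x) \<and>
       (g has_field_derivative g' x) (at x)"
    using series_and_derivative_comparison_complex[OF opS der bd] by blast
  have sS: "s \<in> S" using s by (simp add: S_def)
  have gd: "g x = dseries x" if "x \<in> S" for x
    using g[OF that] dseries_sums[of x] that sums_unique2 by (auto simp: S_def simp del: of_nat_Suc)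
  have "(\<lambda>n. - (of_real (ln (real (Suc n))) * npow n (-s))) sums (- (dseries s * mseries s))"
    by (intro sums_minus dseries_times_mseries s)
  moreover have "- (of_real (ln (real (Suc n))) * npow n (-s)) = f' n s" for n
  proof -
    have "Ln (of_nat (Suc n)) = of_real (ln (of_nat (Suc n)))"
      by (metis Ln_of_real of_nat_0_less_iff of_real_of_nat_eq zero_less_Suc)
    thus ?thesis by (simp add: f'_def del: of_nat_Suc)
  qed
  ultimately have "g' s = - (dseries s * mseries s)"
    using g[OF sS] sums_unique2 by (metis (no_types, lifting) sums_cong)
  hence "(g has_field_derivative (- dseries s * mseries s)) (at s)" using g[OF sS] by simp
  thus ?thesis by (rule has_field_derivative_transform_within_open[OF _ opS sS gd])
qed

text \<open>\<open>mangoldt\<close> is bounded only by a logarithm, so the half-plane criterion is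
  applied with an arbitrarily small loss e and the smaller half-planes are united.\<close>

lemma mseries_hol: "mseries holomorphic_on {s. Re s > 1}"
  unfolding mseries_def [abs_def]
proof -
  have "(\<lambda>s. \<Sum>n. mangoldt (Suc n) * npow n (-s)) holomorphic_on {s. Re s > 1 + e}" if "e > 0" for e
  proof (rule suminf_holomorphic_halfplane)
    show "(\<lambda>s. mangoldt (Suc n) * npow n (-s)) holomorphic_on {s. Re s > 1 + e}" for n
      by (intro holomorphic_intros npow_hol)
    show "\<exists>B. \<forall>n s. norm s \<le> R \<longrightarrow> norm (mangoldt (Suc n) * npow n (-s)) \<le> B * real (Suc n) powr (1 + e - 1 - Re s)"
      for R :: real
    proof (intro exI[of _ "1/e"] allI impI)
      fix n s
      have "mangoldt (Suc n) \<le> real (Suc n) powr e / e"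
        using mangoldt_le[of "Suc n"] ln_le_powr[of "real (Suc n)" e] that by auto
      hence "mangoldt (Suc n) * real (Suc n) powr (- Re s) \<le> (real (Suc n) powr e / e) * real (Suc n) powr (- Re s)"
        by (rule mult_right_mono) auto
      also have "\<dots> = 1/e * real (Suc n) powr (1 + e - 1 - Re s)"
        by (simp add: powr_diff powr_minus field_simps del: of_nat_Suc)
      finally show "norm (mangoldt (Suc n) * npow n (-s)) \<le> 1/e * real (Suc n) powr (1 + e - 1 - Re s)"
        by (simp add: norm_mult norm_npow del: of_nat_Suc)
    qed
  qed
  hence "(\<lambda>s. \<Sum>n. mangoldt (Suc n) * npow n (-s)) holomorphic_on (\<Union>e\<in>{0<..}. {s. Re s > 1 + e})"
    by (intro holomorphic_on_UN_open) (auto simp: open_halfspace_Re_gt)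
  moreover have "(\<Union>e\<in>{0<..}. {s. Re s > 1 + e}) = {s. Re s > 1}"
  proof safe
    fix s :: complex assume "Re s > 1"
    thus "s \<in> (\<Union>e\<in>{0<..}. {s. Re s > 1 + e})"
      by (intro UN_I[of "(Re s - 1) / 2"]) (auto simp: field_simps)
  qed auto
  ultimately show "(\<lambda>s. \<Sum>n. mangoldt (Suc n) * npow n (-s)) holomorphic_on {s. Re s > 1}" by simp
qed

lemma dseries_of_real:
  assumes "1 < c"
  shows "dseries (of_real c) = of_real (\<Sum>n. real (Suc n) powr (-c))"
proof -
  have "npow n (- of_real c) = of_real (real (Suc n) powr (-c))" for n
    using powr_of_real[of "real (Suc n)" "-c"] by (simp del: of_nat_Suc)
  thus ?thesis
    unfolding dseries_def using assms by (simp add: suminf_of_real summable_Suc_powr del: of_nat_Suc)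
qed

text \<open>If P is a primitive of \<open>mseries\<close>, then \<open>dseries\<close> times exp P
  has derivative 0 on the half-plane. Its constant value is nonzero because \<open>dseries 2\<close>
  is a sum of positive terms. This replaces the Euler product.\<close>

lemma dseries_nonzero:
  assumes s: "Re s > 1"
  shows "dseries s \<noteq> 0"
proof -
  define S where "S = {s::complex. Re s > 1}"
  have opS: "open S" unfolding S_def by (rule open_halfspace_Re_gt)
  have cvx: "convex S" unfolding S_def by (rule convex_halfspace_Re_gt)
  obtain P where P: "\<And>x. x \<in> S \<Longrightarrow> (P has_field_derivative mseries x) (at x within S)"
    using holomorphic_convex_primitive'[OF cvx opS, of mseries] mseries_hol
    by (metis S_def)
  have P': "(P has_field_derivative mseries x) (at x)" if "x \<in> S" for x
    using P[OF that] at_within_open[OF that opS] by simp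
  have "\<exists>c. \<forall>x\<in>S. dseries x * exp (P x) = c"
  proof (rule has_field_derivative_zero_constant[OF cvx])
    fix x assume x: "x \<in> S"
    have "((\<lambda>x. dseries x * exp (P x)) has_field_derivative 0) (at x)"
      using x by (auto intro!: derivative_eq_intros dseries_has_field_derivative P' simp: S_def)
    thus "((\<lambda>x. dseries x * exp (P x)) has_field_derivative 0) (at x within S)"
      by (rule has_field_derivative_at_within)
  qed
  then obtain c where c: "\<And>x. x \<in> S \<Longrightarrow> dseries x * exp (P x) = c" by auto
  have "dseries 2 \<noteq> 0"
  proof -
    have "(\<Sum>n. real (Suc n) powr (-2)) > 0"
      by (rule suminf_pos[OF summable_Suc_powr]) auto
    thus ?thesis using dseries_of_real[of 2] by simp
  qed
  hence "c \<noteq> 0" using c[of 2] by (auto simp: S_def)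
  thus ?thesis using c[of s] s by (auto simp: S_def)
qed

lemma zeta_reg_nonzero_right: "Re s > 1 \<Longrightarrow> zeta_reg s \<noteq> 0"
  by (auto simp: zeta_reg_dseries dseries_nonzero)

lemma mseries_eq:
  assumes s: "Re s > 1"
  shows "mseries s = 1 / (s - 1) - deriv zeta_reg s / zeta_reg s"
proof -
  have ne: "s \<noteq> 1" using s by auto
  have "((\<lambda>s. (s - 1) * dseries s) has_field_derivative dseries s + (s - 1) * (- dseries s * mseries s)) (at s)"
    by (auto intro!: derivative_eq_intros dseries_has_field_derivative s)
  hence "(zeta_reg has_field_derivative dseries s + (s - 1) * (- dseries s * mseries s)) (at s)"
    by (rule has_field_derivative_transform_within_open[where S = "{s. Re s > 1}"])
       (use s in \<open>auto simp: zeta_reg_dseries open_halfspace_Re_gt\<close>)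
  hence "deriv zeta_reg s = dseries s + (s - 1) * (- dseries s * mseries s)"
    by (rule DERIV_imp_deriv)
  moreover have "(d + (s - 1) * (- d * m)) / ((s - 1) * d) = 1 / (s - 1) - m" if "d \<noteq> 0" for d m
  proof -
    have "s - 1 \<noteq> 0" using ne by simp
    thus ?thesis using that
      by (simp add: divide_simps del: right_minus_eq) (simp add: algebra_simps)
  qed
  ultimately show ?thesis using dseries_nonzero[OF s] by (simp add: zeta_reg_dseries s)
qed

section \<open>Local partial fractions of a logarithmic derivative\<close>

text \<open>Borel-Caratheodory. The map w |-> P w / (4 B - P w) sends the disc into itself; with 2 B
  in place of 4 B the inequality |k| < 1 required by Schwarz's lemma could fail to be strict. Then
  |P w| is recovered from |k w| <= |w|.\<close>

lemma schwarz_Re_bound: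
  assumes P: "P holomorphic_on ball 0 1" "P 0 = 0" and B: "B > 0"
    and le: "\<And>w. norm w < 1 \<Longrightarrow> Re (P w) \<le> B" and w: "norm w < 1"
  shows "norm (P w) \<le> 4 * B * norm w / (1 - norm w)"
proof -
  define k where "k = (\<lambda>w. P w / (of_real (4 * B) - P w))"
  have nz: "of_real (4 * B) - P w \<noteq> 0" if "norm w < 1" for w
  proof
    assume "of_real (4 * B) - P w = 0"
    hence "Re (P w) = 4 * B" by (simp add: complex_eq_iff)
    thus False using le[OF that] B by simp
  qed
  have hol: "k holomorphic_on ball 0 1"
    unfolding k_def using nz by (intro holomorphic_intros P) auto
  have lt: "norm (k w) < 1" if "norm w < 1" for w
  proof -
    have "(norm (of_real (4 * B) - P w))\<^sup>2 - (norm (P w))\<^sup>2 = 16 * B\<^sup>2 - 8 * B * Re (P w)"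
      unfolding cmod_power2 by (simp add: power2_eq_square algebra_simps)
    also have "8 * B * Re (P w) \<le> 8 * B * B" using le[OF that] B by (intro mult_left_mono) auto
    hence "16 * B\<^sup>2 - 8 * B * Re (P w) > 0"
      using B zero_less_power[OF B, of 2] by (simp add: power2_eq_square)
    finally have "(norm (P w))\<^sup>2 < (norm (of_real (4 * B) - P w))\<^sup>2" by simp
    hence "norm (P w) < norm (of_real (4 * B) - P w)" by (rule power2_less_imp_less) simp
    thus ?thesis using nz[OF that] by (simp add: k_def norm_divide)
  qed
  have kw: "norm (k w) \<le> norm w"
    using Schwarz_Lemma(1)[OF hol _ lt w] P by (simp add: k_def)
  have eq: "P w * (1 + k w) = of_real (4 * B) * k w"
    using nz[OF w] by (simp add: k_def field_simps)
  have "norm (P w) * (1 - norm w) \<le> norm (P w) * norm (1 + k w)"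
  proof (rule mult_left_mono)
    show "1 - norm w \<le> norm (1 + k w)"
      using kw norm_triangle_ineq4[of "1 + k w" "k w"] by simp
  qed auto
  also have "\<dots> = 4 * B * norm (k w)" unfolding norm_mult[symmetric] eq using B by (simp add: norm_mult)
  also have "\<dots> \<le> 4 * B * norm w" using kw B by simp
  finally show ?thesis using w by (simp add: field_simps)
qed

text \<open>A disc of radius 1/2 about s stays within 7/2 of \<open>z0\<close>. At relative radius
  7/8 the previous bound is 4 B (7/8) / (1/8) = 28 B, and Cauchy's inequality on radius 1/2 doubles
  it.\<close>

lemma deriv_bound_of_Re_bound:
  assumes P: "P holomorphic_on ball z0 4" "P z0 = 0" and B: "B > 0"
    and le: "\<And>s. s \<in> ball z0 4 \<Longrightarrow> Re (P s) \<le> B" and s: "s \<in> cball z0 3"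
  shows "norm (deriv P s) \<le> 56 * B"
proof -
  have bd: "norm (P z) \<le> 28 * B" if "dist z0 z \<le> 7/2" for z
  proof -
    define w where "w = (z - z0) / 4"
    have w: "norm w \<le> 7/8" using that by (simp add: w_def dist_norm norm_minus_commute norm_divide)
    have sub: "z0 + 4 * w \<in> ball z0 4" if "norm w < 1" for w :: complex
      using that by (simp add: dist_norm norm_mult)
    have "norm ((P \<circ> (\<lambda>w. z0 + 4 * w)) w) \<le> 4 * B * norm w / (1 - norm w)"
    proof (rule schwarz_Re_bound)
      show "P \<circ> (\<lambda>w. z0 + 4 * w) holomorphic_on ball 0 1"
        by (intro holomorphic_on_compose_gen[OF _ P(1)] holomorphic_intros) (use sub in auto)
    qed (use P B le sub w in auto)
    also have "\<dots> \<le> 4 * B * (7/8) / (1/8)"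
      using w B by (intro frac_le mult_left_mono) auto
    finally have "norm ((P \<circ> (\<lambda>w. z0 + 4 * w)) w) \<le> 28 * B" by simp
    moreover have "4 * w = z - z0" by (simp add: w_def field_simps)
    hence "(P \<circ> (\<lambda>w. z0 + 4 * w)) w = P z" by simp
    ultimately show ?thesis by simp
  qed
  have sub: "dist z0 z \<le> 7/2" if "z \<in> cball s (1/2)" for z
    using that s dist_triangle[of z0 z s] by auto
  have "cball s (1/2) \<subseteq> ball z0 4" using sub by fastforce
  hence hol: "P holomorphic_on cball s (1/2)" using P(1) holomorphic_on_subset by blast
  have "norm ((deriv ^^ 1) P s) \<le> fact 1 * (28 * B) / (1/2) ^ 1"
  proof (rule Cauchy_inequality)
    show "norm (P x) \<le> 28 * B" if "norm (s - x) = 1/2" for x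
      by (rule bd, rule sub) (use that in \<open>simp add: dist_norm\<close>)
  qed (use hol in \<open>auto intro: holomorphic_on_subset holomorphic_on_imp_continuous_on\<close>)
  thus ?thesis by simp
qed

abbreviation zero_mult :: "(complex \<Rightarrow> complex) \<Rightarrow> complex \<Rightarrow> nat" where
  "zero_mult f a \<equiv> nat (zorder f a)"

lemma zero_factor:
  assumes f: "f holomorphic_on UNIV" and b: "f b \<noteq> 0"
  obtains g where "g holomorphic_on UNIV" "\<And>s. f s = g s * (s - a) ^ zero_mult f a" "g a \<noteq> 0"
    "f a = 0 \<longrightarrow> zorder f a > 0" "f a \<noteq> 0 \<longrightarrow> zorder f a = 0"
proof -
  define n where "n = zorder f a"
  obtain r where r: "r > 0" "zor_poly f a holomorphic_on cball a r"
     "\<And>w. w \<in> cball a r \<Longrightarrow> f w = zor_poly f a w * (w - a) ^ nat n \<and> zor_poly f a w \<noteq> 0"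
    and sgn: "if f a = 0 then n > 0 else n = 0"
  proof -
    have "\<exists>w\<in>UNIV. f w \<noteq> 0" using b by blast
    from zorder_exist_zero[OF f open_UNIV connected_UNIV UNIV_I this, of a, folded n_def] that
    show ?thesis by blast
  qed
  \<comment> \<open>The quotient receives its removable value at a; holomorphy is checked on a ball
    about a and on the complement of a.\<close>
  define g where "g = (\<lambda>s. if s = a then zor_poly f a a else f s / (s - a) ^ nat n)"
  have eq: "f s = g s * (s - a) ^ nat n" for s
    using r(3)[of a] r(1) by (auto simp: g_def)
  have "g holomorphic_on (ball a r \<union> -{a})"
  proof (rule holomorphic_on_Un)
    show "g holomorphic_on ball a r"
    proof (rule holomorphic_transform)
      show "zor_poly f a holomorphic_on ball a r" by (rule holomorphic_on_subset[OF r(2)]) auto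
      show "zor_poly f a x = g x" if "x \<in> ball a r" for x
        using r(3)[of x] that by (auto simp: g_def)
    qed
    have "(\<lambda>s. f s / (s - a) ^ nat n) holomorphic_on -{a}"
      by (intro holomorphic_intros holomorphic_on_subset[OF f]) auto
    thus "g holomorphic_on -{a}" by (rule holomorphic_transform) (auto simp: g_def)
  qed auto
  moreover have "ball a r \<union> -{a} = UNIV" using r(1) by auto
  ultimately have hol: "g holomorphic_on UNIV" by simp
  show ?thesis
  proof (rule that[OF hol])
    show "f s = g s * (s - a) ^ zero_mult f a" for s using eq by (simp add: n_def)
    show "g a \<noteq> 0" using r(3)[of a] r(1) by (simp add: g_def)
  qed (use sgn in \<open>auto simp: n_def split: if_splits\<close>)
qed

text \<open>Points of A that are not zeros are harmless, since \<open>zero_mult\<close> is 0 there.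
  The induction works because dividing out other points does not change the order at a.\<close>

lemma zeros_factorization:
  assumes f: "f holomorphic_on UNIV" and b: "f b \<noteq> 0" and "finite A"
  shows "\<exists>g. g holomorphic_on UNIV \<and> (\<forall>s. f s = g s * (\<Prod>a\<in>A. (s - a) ^ zero_mult f a)) \<and> (\<forall>a\<in>A. g a \<noteq> 0)"
  using \<open>finite A\<close>
proof induction
  case empty
  show ?case using f by auto
next
  case (insert a A)
  then obtain g where g: "g holomorphic_on UNIV" "\<And>s. f s = g s * (\<Prod>a\<in>A. (s - a) ^ zero_mult f a)"
    "\<And>a. a \<in> A \<Longrightarrow> g a \<noteq> 0" by blast
  define Q where "Q = (\<lambda>s. \<Prod>a\<in>A. (s - a) ^ zero_mult f a)"
  have "g b \<noteq> 0" using b g(2)[of b] by auto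
  from zero_factor[OF g(1) this, of a] obtain h where h: "h holomorphic_on UNIV"
    "\<And>s. g s = h s * (s - a) ^ zero_mult g a" "h a \<noteq> 0" "g a = 0 \<longrightarrow> zorder g a > 0" "g a \<noteq> 0 \<longrightarrow> zorder g a = 0"
    by metis
  have "zorder f a = int (zero_mult g a)"
  proof (rule zorder_eqI[of UNIV _ "\<lambda>s. h s * Q s"])
    show "(\<lambda>s. h s * Q s) holomorphic_on UNIV"
      unfolding Q_def by (intro holomorphic_intros h(1))
    show "h a * Q a \<noteq> 0" using h(3) insert by (auto simp: Q_def)
    show "f w = h w * Q w * (w - a) powi int (zero_mult g a)" for w
      unfolding g(2)[of w] h(2)[of w] Q_def power_int_of_nat by (simp only: mult_ac)
  qed auto
  hence "zero_mult f a = zero_mult g a" by simp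
  hence "f s = h s * (\<Prod>a\<in>insert a A. (s - a) ^ zero_mult f a)" for s
    using insert g(2)[of s] h(2)[of s] by (simp add: mult_ac)
  moreover have "h a' \<noteq> 0" if "a' \<in> insert a A" for a'
    using that h(3) g(3)[of a'] h(2)[of a'] by auto
  ultimately show ?case using h(1) by blast
qed

lemma deriv_factorization:
  assumes g: "g holomorphic_on UNIV" and eq: "\<And>s. f s = g s * (\<Prod>a\<in>A. (s - a) ^ m a)"
    and "finite A" and s: "f s \<noteq> 0" and A: "s \<notin> A"
  shows "deriv f s / f s = deriv g s / g s + (\<Sum>a\<in>A. of_nat (m a) / (s - a))"
proof -
  define Q where "Q = (\<lambda>s. \<Prod>a\<in>A. (s - a) ^ m a)"
  have Q: "(Q has_field_derivative Q s * (\<Sum>a\<in>A. of_nat (m a) / (s - a))) (at s)"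
    unfolding Q_def using \<open>finite A\<close> A
  proof induction
    case (insert a A)
    have 1: "((\<lambda>s. (s - a) ^ m a) has_field_derivative (s - a) ^ m a * (of_nat (m a) / (s - a))) (at s)"
    proof (cases "m a")
      case (Suc k)
      have "((\<lambda>s. (s - a) ^ m a) has_field_derivative of_nat (m a) * (s - a) ^ k) (at s)"
        unfolding Suc by (rule derivative_eq_intros refl)+ simp
      also have "of_nat (m a) * (s - a) ^ k = (s - a) ^ m a * (of_nat (m a) / (s - a))"
        using insert Suc by simp
      finally show ?thesis .
    qed auto
    have "((\<lambda>s. (s - a) ^ m a * (\<Prod>a\<in>A. (s - a) ^ m a)) has_field_derivative
         ((s - a) ^ m a * (of_nat (m a) / (s - a)) * (\<Prod>a\<in>A. (s - a) ^ m a) +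
           (\<Prod>a\<in>A. (s - a) ^ m a) * (\<Sum>a\<in>A. of_nat (m a) / (s - a)) * (s - a) ^ m a)) (at s)"
      by (rule DERIV_mult[OF 1]) (use insert in auto)
    moreover have "((s - a) ^ m a * (of_nat (m a) / (s - a)) * (\<Prod>a\<in>A. (s - a) ^ m a) +
           (\<Prod>a\<in>A. (s - a) ^ m a) * (\<Sum>a\<in>A. of_nat (m a) / (s - a)) * (s - a) ^ m a)
        = ((s - a) ^ m a * (\<Prod>a\<in>A. (s - a) ^ m a)) * (of_nat (m a) / (s - a) + (\<Sum>a\<in>A. of_nat (m a) / (s - a)))"
      by (simp only: ring_distribs mult_ac)
    ultimately show ?case using insert by simp
  qed auto
  have g': "(g has_field_derivative deriv g s) (at s)"
    using g by (simp add: holomorphic_derivI)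
  have "((\<lambda>s. g s * Q s) has_field_derivative deriv g s * Q s + Q s * (\<Sum>a\<in>A. of_nat (m a) / (s - a)) * g s) (at s)"
    by (rule DERIV_mult[OF g' Q])
  moreover have "(\<lambda>s. g s * Q s) = f" by (simp add: fun_eq_iff eq Q_def)
  ultimately have "deriv f s = deriv g s * Q s + Q s * (\<Sum>a\<in>A. of_nat (m a) / (s - a)) * g s"
    by (simp add: DERIV_imp_deriv)
  moreover have "f s = g s * Q s" by (simp add: eq Q_def)
  ultimately show ?thesis using s by (simp add: add_divide_distrib)
qed

text \<open>At a point that is not a zero the multiplicity and the limit are 0; the argument on the
  line Re s = 1 relies on this case too.\<close>

lemma tendsto_log_deriv:
  assumes f: "f holomorphic_on UNIV" and b: "f b \<noteq> 0"
  shows "((\<lambda>s. (s - a) * (deriv f s / f s)) \<longlongrightarrow> of_nat (zero_mult f a)) (at a)"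
proof -
  obtain g where g: "g holomorphic_on UNIV" "\<And>s. f s = g s * (\<Prod>a\<in>{a}. (s - a) ^ zero_mult f a)" "g a \<noteq> 0"
    using zeros_factorization[OF f b, of "{a}"] by auto
  have cont: "isCont g a" "isCont (deriv g) a"
    using g(1) holomorphic_deriv[OF g(1)]
    by (auto intro!: continuous_on_interior[of UNIV] holomorphic_on_imp_continuous_on)
  have "((\<lambda>s. (s - a) * (deriv g s / g s) + of_nat (zero_mult f a)) \<longlongrightarrow> (a - a) * (deriv g a / g a) + of_nat (zero_mult f a)) (at a)"
    using cont g(3) by (intro tendsto_intros) (auto simp: isCont_def)
  moreover have "\<forall>\<^sub>F s in at a. g s \<noteq> 0"
    using cont(1) g(3) by (auto simp: isCont_def intro: tendsto_imp_eventually_ne)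
  hence "\<forall>\<^sub>F s in at a. (s - a) * (deriv g s / g s) + of_nat (zero_mult f a) = (s - a) * (deriv f s / f s)"
    using eventually_neq_at_within[of a a UNIV]
  proof eventually_elim
    case (elim s)
    have "f s \<noteq> 0" using g(2)[of s] elim by auto
    from deriv_factorization[OF g(1,2) _ this] elim
    have "deriv f s / f s = deriv g s / g s + of_nat (zero_mult f a) / (s - a)" by simp
    thus ?case using elim by (simp add: distrib_left)
  qed
  ultimately show ?thesis by (auto intro: Lim_transform_eventually)
qed

lemma zeros_finite:
  assumes f: "f holomorphic_on UNIV" and b: "f b \<noteq> 0" and "bounded K"
  shows "finite {a\<in>K. f a = 0}"
proof (cases "\<exists>a. f a = 0")
  case True
  have "finite {a\<in>closure K. f a = 0}"
    by (rule holomorphic_compact_finite_zeros[OF f])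
       (use True b assms(3) in \<open>auto simp: constant_on_def compact_closure, metis\<close>)
  thus ?thesis by (rule finite_subset[rotated]) (use closure_subset in auto)
qed auto

text \<open>
  Dividing \<open>f\<close> by its zeros in \<open>ball z0 4\<close> decreases \<open>f s / f z0\<close> for \<open>s\<close> on \<open>sphere z0 12\<close>, where
  \<open>|s - a| \<ge> 8 > |z0 - a|\<close>. The quotient has a logarithm on \<open>ball z0 4\<close> with real part at most \<open>B\<close>,
  and Schwarz's lemma bounds the derivative of that logarithm.
\<close>
lemma landau_local:
  assumes f: "f holomorphic_on UNIV" and z0: "f z0 \<noteq> 0" and B: "B > 0"
    and le: "\<And>s. s \<in> sphere z0 12 \<Longrightarrow> norm (f s) \<le> exp B * norm (f z0)"
  defines "A \<equiv> {a \<in> ball z0 4. f a = 0}"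
  shows "(\<Sum>a\<in>A. real (zero_mult f a)) \<le> 2 * B"
    and "\<And>s. s \<in> cball z0 3 \<Longrightarrow> f s \<noteq> 0 \<Longrightarrow>
           norm (deriv f s / f s - (\<Sum>a\<in>A. of_nat (zero_mult f a) / (s - a))) \<le> 56 * B"
proof -
  have fin: "finite A" unfolding A_def by (rule zeros_finite[OF f z0]) auto
  obtain g where g: "g holomorphic_on UNIV" "\<And>s. f s = g s * (\<Prod>a\<in>A. (s - a) ^ zero_mult f a)"
    "\<And>a. a \<in> A \<Longrightarrow> g a \<noteq> 0"
    using zeros_factorization[OF f z0 fin] by blast
  define m where "m = (\<lambda>a. zero_mult f a)"
  define N where "N = (\<Sum>a\<in>A. m a)"
  have gnz: "g s \<noteq> 0" if "s \<in> ball z0 4" for s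
    using that g(2)[of s] g(3)[of s] by (auto simp: A_def)
  \<comment> \<open>On the sphere every |s - a| is at least 8, at the centre every |z0 - a| is at
    most 4. The maximum principle for g then compares 8^N with 4^N and leaves 2^N <= exp B, which
    bounds the number of zeros.\<close>
  define c where "c = exp B * norm (f z0) / 8 ^ N"
  have gs: "norm (g s) \<le> c" if "s \<in> sphere z0 12" for s
  proof -
    have "norm (g s) * 8 ^ N \<le> norm (g s) * (\<Prod>a\<in>A. norm (s - a) ^ m a)"
    proof (rule mult_left_mono)
      show "8 ^ N \<le> (\<Prod>a\<in>A. norm (s - a) ^ m a)"
        unfolding N_def power_sum
      proof (intro prod_mono conjI power_mono)
        fix a assume "a \<in> A"
        hence "dist z0 a < 4" by (simp add: A_def)
        moreover have "dist z0 s = 12" using that by simp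
        ultimately show "8 \<le> norm (s - a)"
          using dist_triangle[of z0 s a] by (simp add: dist_norm norm_minus_commute)
      qed auto
    qed auto
    also have "\<dots> = norm (f s)" unfolding g(2)[of s] m_def by (simp add: norm_mult prod_norm[symmetric] norm_power)
    also have "\<dots> \<le> exp B * norm (f z0)" by (rule le[OF that])
    finally show ?thesis by (simp add: c_def field_simps)
  qed
  have gb: "norm (g s) \<le> c" if "s \<in> ball z0 12" for s
  proof (rule maximum_modulus_frontier[of g "ball z0 12"])
    show "g holomorphic_on interior (ball z0 12)" "continuous_on (closure (ball z0 12)) g"
      using g(1) by (auto intro: holomorphic_on_subset holomorphic_on_imp_continuous_on)
  qed (use gs that in auto)
  have gz: "norm (f z0) \<le> norm (g z0) * 4 ^ N"
  proof -
    have "norm (f z0) = norm (g z0) * (\<Prod>a\<in>A. norm (z0 - a) ^ m a)"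
      unfolding g(2)[of z0] m_def by (simp add: norm_mult prod_norm[symmetric] norm_power)
    also have "(\<Prod>a\<in>A. norm (z0 - a) ^ m a) \<le> 4 ^ N"
      unfolding N_def power_sum
      by (intro prod_mono conjI power_mono) (auto simp: A_def dist_norm)
    finally show ?thesis by (simp add: mult_left_mono)
  qed
  have fz: "norm (f z0) > 0" using z0 by simp
  have "norm (f z0) \<le> c * 4 ^ N" using gz gb[of z0] 
    by (meson centre_in_ball mult_right_mono order_trans zero_le_numeral zero_le_power zero_less_numeral)
  hence "norm (f z0) * 8 ^ N \<le> exp B * norm (f z0) * 4 ^ N" by (simp add: c_def field_simps)
  hence "(8::real) ^ N \<le> exp B * 4 ^ N" using fz by simp
  moreover have "(8::real) ^ N = 2 ^ N * 4 ^ N" unfolding power_mult_distrib[symmetric] by simp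
  ultimately have "2 ^ N \<le> exp B" by simp
  hence "ln (2 ^ N) \<le> ln (exp B)" by (subst ln_le_cancel_iff) auto
  hence "ln (2 ^ N) \<le> B" by simp
  hence "real N * ln 2 \<le> B" by (simp add: ln_realpow)
  moreover have "real N * (1/2) \<le> real N * ln 2"
    using ln2_ge_two_thirds by (intro mult_left_mono) auto
  ultimately have "real N \<le> 2 * B" by linarith
  thus "(\<Sum>a\<in>A. real (zero_mult f a)) \<le> 2 * B" by (simp add: N_def m_def)
  fix s assume s: "s \<in> cball z0 3" "f s \<noteq> 0"
  define Q where "Q = (\<lambda>s. \<Prod>a\<in>A. (s - a) ^ zero_mult f a)"
  have Qz: "Q z0 \<noteq> 0" using z0 g(2)[of z0] by (auto simp: Q_def)
  \<comment> \<open>The same comparison with the exact product at \<open>z0\<close> in place of 4^N: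
    it gives |g| <= exp B * |g z0|, hence the bound B for the real part of the logarithm normalised
    to 0 at \<open>z0\<close>.\<close>
  define c2 where "c2 = exp B * norm (g z0)"
  have gs2: "norm (g s) \<le> c2" if "s \<in> sphere z0 12" for s
  proof -
    have "norm (g s) * norm (Q z0) \<le> norm (g s) * norm (Q s)"
      unfolding Q_def prod_norm[symmetric] norm_power
    proof (intro mult_left_mono prod_mono conjI power_mono)
      fix a assume "a \<in> A"
      hence "dist z0 a < 4" by (simp add: A_def)
      moreover have "dist z0 s = 12" using that by simp
      ultimately show "norm (z0 - a) \<le> norm (s - a)"
        using dist_triangle[of z0 s a] by (simp add: dist_norm norm_minus_commute)
    qed auto
    also have "\<dots> = norm (f s)" by (simp add: g(2)[of s] Q_def norm_mult)
    also have "\<dots> \<le> exp B * norm (f z0)" by (rule le[OF that])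
    also have "norm (f z0) = norm (g z0) * norm (Q z0)" by (simp add: g(2)[of z0] Q_def norm_mult)
    finally show ?thesis using Qz by (simp add: c2_def mult.assoc[symmetric])
  qed
  have gb2: "norm (g s) \<le> c2" if "s \<in> ball z0 12" for s
  proof (rule maximum_modulus_frontier[of g "ball z0 12"])
    show "g holomorphic_on interior (ball z0 12)" "continuous_on (closure (ball z0 12)) g"
      using g(1) by (auto intro: holomorphic_on_subset holomorphic_on_imp_continuous_on)
  qed (use gs2 that in auto)
  have "(\<lambda>s. deriv g s / g s) holomorphic_on ball z0 4"
    using gnz by (intro holomorphic_intros holomorphic_on_subset[OF holomorphic_deriv[OF g(1)]]
                        holomorphic_on_subset[OF g(1)]) auto
  from holomorphic_convex_primitive'[OF _ _ this] obtain P0 where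
    P0: "\<And>x. x \<in> ball z0 4 \<Longrightarrow> (P0 has_field_derivative (deriv g x / g x)) (at x within ball z0 4)"
    by auto
  define P where "P = (\<lambda>x. P0 x - P0 z0)"
  have P: "(P has_field_derivative (deriv g x / g x)) (at x)" if "x \<in> ball z0 4" for x
    using P0[OF that] at_within_open[OF that] unfolding P_def by (auto intro!: derivative_eq_intros)
  have "\<exists>k. \<forall>x\<in>ball z0 4. g x * exp (- P x) = k"
  proof (rule has_field_derivative_zero_constant)
    fix x assume x: "x \<in> ball z0 4"
    have "((\<lambda>x. g x * exp (- P x)) has_field_derivative
             deriv g x * exp (- P x) + (exp (- P x) * - (deriv g x / g x)) * g x) (at x)"
      using holomorphic_derivI[OF g(1), of x] P[OF x] by (intro DERIV_mult derivative_intros) auto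
    hence "((\<lambda>x. g x * exp (- P x)) has_field_derivative 0) (at x)" using gnz[OF x] by simp
    thus "((\<lambda>x. g x * exp (- P x)) has_field_derivative 0) (at x within ball z0 4)"
      by (rule has_field_derivative_at_within)
  qed auto
  then obtain k where k: "\<And>x. x \<in> ball z0 4 \<Longrightarrow> g x * exp (- P x) = k" by blast
  have "k = g z0" using k[of z0] by (simp add: P_def)
  have geq: "g x = g z0 * exp (P x)" if "x \<in> ball z0 4" for x
  proof -
    have "g x = (g x * exp (- P x)) * exp (P x)" by (simp add: exp_minus)
    thus ?thesis using k[OF that] \<open>k = g z0\<close> by simp
  qed
  have Re: "Re (P x) \<le> B" if x: "x \<in> ball z0 4" for x
  proof -
    have "norm (g z0) * exp (Re (P x)) \<le> exp B * norm (g z0)"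
      using gb2[of x] geq[OF x] x by (simp add: c2_def norm_mult)
    thus ?thesis using gnz[of z0] by simp
  qed
  have "norm (deriv P s) \<le> 56 * B"
  proof (rule deriv_bound_of_Re_bound[OF _ _ B Re s(1)])
    show "P holomorphic_on ball z0 4"
      unfolding holomorphic_on_open[OF open_ball] using P by blast
  qed (auto simp: P_def)
  also have "deriv P s = deriv g s / g s"
    using s P[of s] by (intro DERIV_imp_deriv) auto
  also have "\<dots> = deriv f s / f s - (\<Sum>a\<in>A. of_nat (zero_mult f a) / (s - a))"
    using deriv_factorization[OF g(1,2) fin s(2)] s by (auto simp: A_def)
  finally show "norm (deriv f s / f s - (\<Sum>a\<in>A. of_nat (zero_mult f a) / (s - a))) \<le> 56 * B" .
qed

section \<open>Nonvanishing on the line Re s = 1\<close>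

text \<open>Every term is nonnegative, by 3 + 4 cos x + cos 2x = 2 (1 + cos x)^2.\<close>

lemma mseries_341:
  assumes "c > 1"
  shows "3 * Re (mseries (of_real c)) + 4 * Re (mseries (Complex c t)) + Re (mseries (Complex c (2 * t))) \<ge> 0"
proof -
  have Ren: "(\<lambda>n. mangoldt (Suc n) * real (Suc n) powr (-c) * cos (u * ln (real (Suc n)))) sums Re (mseries (Complex c u))" for u
  proof -
    have "(\<lambda>n. Re (mangoldt (Suc n) * npow n (- Complex c u))) sums Re (mseries (Complex c u))"
      by (rule sums_Re[OF mseries_sums]) (use assms in auto)
    moreover have "Re (mangoldt (Suc n) * npow n (- Complex c u)) = mangoldt (Suc n) * real (Suc n) powr (-c) * cos (u * ln (real (Suc n)))" for n
    proof -
      have L: "Ln (of_nat (Suc n)) = of_real (ln (of_nat (Suc n)))"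
        by (metis Ln_of_real of_nat_0_less_iff of_real_of_nat_eq zero_less_Suc)
      have "npow n (- Complex c u) = exp (- Complex c u * of_real (ln (real (Suc n))))"
        by (simp add: powr_def L del: of_nat_Suc)
      hence "Re (npow n (- Complex c u)) = real (Suc n) powr (-c) * cos (u * ln (real (Suc n)))"
        by (simp add: Re_exp powr_def del: of_nat_Suc)
      moreover have "Re (mangoldt (Suc n) * npow n (- Complex c u)) = mangoldt (Suc n) * Re (npow n (- Complex c u))"
        by (simp del: of_nat_Suc)
      ultimately show ?thesis by (simp del: of_nat_Suc)
    qed
    ultimately show ?thesis by (simp only:)
  qed
  have sm: "(\<lambda>n. 3 * (mangoldt (Suc n) * real (Suc n) powr (-c) * cos (0 * ln (real (Suc n)))) +
             4 * (mangoldt (Suc n) * real (Suc n) powr (-c) * cos (t * ln (real (Suc n)))) +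
             mangoldt (Suc n) * real (Suc n) powr (-c) * cos (2 * t * ln (real (Suc n))))
     sums (3 * Re (mseries (Complex c 0)) + 4 * Re (mseries (Complex c t)) + Re (mseries (Complex c (2 * t))))"
    by (intro sums_add sums_mult Ren)
  have nn: "0 \<le> 3 * (mangoldt (Suc n) * real (Suc n) powr (-c) * cos (0 * ln (real (Suc n)))) +
             4 * (mangoldt (Suc n) * real (Suc n) powr (-c) * cos (t * ln (real (Suc n)))) +
             mangoldt (Suc n) * real (Suc n) powr (-c) * cos (2 * t * ln (real (Suc n)))" for n
  proof -
    define x where "x = t * ln (real (Suc n))"
    have "cos (2 * t * ln (real (Suc n))) = 2 * (cos x)\<^sup>2 - 1"
      using cos_double_cos[of x] by (simp add: x_def mult.assoc)
    hence "3 * (mangoldt (Suc n) * real (Suc n) powr (-c) * cos (0 * ln (real (Suc n)))) +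
             4 * (mangoldt (Suc n) * real (Suc n) powr (-c) * cos (t * ln (real (Suc n)))) +
             mangoldt (Suc n) * real (Suc n) powr (-c) * cos (2 * t * ln (real (Suc n)))
        = (mangoldt (Suc n) * real (Suc n) powr (-c)) * (2 * (1 + cos x)\<^sup>2)"
      unfolding x_def[symmetric] by (simp only: mult_zero_left cos_zero) (simp add: power2_eq_square algebra_simps del: of_nat_Suc)
    also have "\<dots> \<ge> 0" by (intro mult_nonneg_nonneg mangoldt_nonneg) auto
    finally show ?thesis .
  qed
  have "Complex c 0 = of_real c" by (simp add: complex_of_real_def)
  thus ?thesis using sums_le[OF nn sums_zero sm] by simp
qed

text \<open>Multiplying the 3-4-1 inequality at abscissa 1 + d by d and letting d tend to 0 gives 3
  - 4 m(1 + i t) - m(1 + 2 i t) >= 0 for the multiplicities m, the 3 coming from the pole. A zero at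
  1 + i t would make the left side negative.\<close>

lemma zeta_reg_nonzero_line1:
  assumes "Re s = 1"
  shows "zeta_reg s \<noteq> 0"
proof
  assume zero: "zeta_reg s = 0"
  define t where "t = Im s"
  have t: "t \<noteq> 0" using zero assms zeta_reg_1 by (metis complex_eqI one_complex.sel t_def zero_neq_one)
  have ent: "zeta_reg holomorphic_on UNIV" by (rule zeta_reg_entire)
  have nz1: "zeta_reg 1 \<noteq> 0" by simp
  have lim: "((\<lambda>d. of_real d * mseries (Complex (1 + d) u)) \<longlongrightarrow> (if u = 0 then 1 else 0) - of_nat (zero_mult zeta_reg (Complex 1 u))) (at_right 0)" for u
  proof -
    have C: "Complex (1 + d) u = Complex 1 u + of_real d" for d by (simp add: complex_eq_iff)
    have "filterlim (\<lambda>d. Complex (1 + d) u) (at (Complex 1 u)) (at_right 0)"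
      unfolding filterlim_at
    proof
      have "((\<lambda>d. Complex 1 u + of_real d) \<longlongrightarrow> Complex 1 u + of_real 0) (at_right 0)"
        by (intro tendsto_intros)
      thus "((\<lambda>d. Complex (1 + d) u) \<longlongrightarrow> Complex 1 u) (at_right 0)" by (simp add: C)
      show "\<forall>\<^sub>F d in at_right 0. Complex (1 + d) u \<in> UNIV \<and> Complex (1 + d) u \<noteq> Complex 1 u"
        using eventually_at_right_less[of "0::real"] by eventually_elim auto
    qed
    from filterlim_compose[OF tendsto_log_deriv[OF ent nz1] this]
    have 1: "((\<lambda>d. of_real d * (deriv zeta_reg (Complex (1 + d) u) / zeta_reg (Complex (1 + d) u))) \<longlongrightarrow>
         of_nat (zero_mult zeta_reg (Complex 1 u))) (at_right 0)"
      by (simp add: C)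
    have 2: "((\<lambda>d. of_real d / (Complex (1 + d) u - 1)) \<longlongrightarrow> (if u = 0 then 1 else 0)) (at_right 0)"
    proof (cases "u = 0")
      case True
      have "\<forall>\<^sub>F d in at_right 0. 1 = of_real d / (Complex (1 + d) u - 1)"
        using eventually_at_right_less[of "0::real"] by eventually_elim (auto simp: True complex_eq_iff Re_divide Im_divide power2_eq_square)
      thus ?thesis using True by (auto intro: Lim_transform_eventually)
    next
      case False
      have "((\<lambda>d. of_real d / (Complex 1 u + of_real d - 1)) \<longlongrightarrow> of_real 0 / (Complex 1 u + of_real 0 - 1)) (at_right 0)"
        using False by (intro tendsto_intros) (auto simp: complex_eq_iff)
      thus ?thesis using False by (simp add: C)
    qed
    have "\<forall>\<^sub>F d in at_right 0. of_real d / (Complex (1 + d) u - 1) - of_real d * (deriv zeta_reg (Complex (1 + d) u) / zeta_reg (Complex (1 + d) u))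
       = of_real d * mseries (Complex (1 + d) u)"
      using eventually_at_right_less[of "0::real"] by eventually_elim (simp add: mseries_eq algebra_simps)
    from Lim_transform_eventually[OF tendsto_diff[OF 2 1] this] show ?thesis .
  qed
  have "((\<lambda>d. 3 * Re (of_real d * mseries (Complex (1 + d) 0)) + 4 * Re (of_real d * mseries (Complex (1 + d) t)) +
         Re (of_real d * mseries (Complex (1 + d) (2 * t)))) \<longlongrightarrow>
      3 * Re (1 - of_nat (zero_mult zeta_reg (Complex 1 0))) + 4 * Re (0 - of_nat (zero_mult zeta_reg (Complex 1 t)))
        + Re (0 - of_nat (zero_mult zeta_reg (Complex 1 (2 * t))))) (at_right 0)"
    using lim[of 0] lim[of t] lim[of "2 * t"] t by (intro tendsto_intros) simp_all
  moreover have "\<forall>\<^sub>F d in at_right 0. 0 \<le> 3 * Re (of_real d * mseries (Complex (1 + d) 0)) + 4 * Re (of_real d * mseries (Complex (1 + d) t)) +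
         Re (of_real d * mseries (Complex (1 + d) (2 * t)))"
    using eventually_at_right_less[of "0::real"]
  proof eventually_elim
    case (elim d)
    have "0 \<le> d * (3 * Re (mseries (of_real (1 + d))) + 4 * Re (mseries (Complex (1 + d) t)) + Re (mseries (Complex (1 + d) (2 * t))))"
      using elim by (intro mult_nonneg_nonneg mseries_341) auto
    moreover have "of_real (1 + d) = Complex (1 + d) 0" by (simp add: complex_eq_iff)
    ultimately show ?case by (simp add: algebra_simps)
  qed
  ultimately have "0 \<le> 3 * Re (1 - of_nat (zero_mult zeta_reg (Complex 1 0))) + 4 * Re (0 - of_nat (zero_mult zeta_reg (Complex 1 t)))
        + Re (0 - of_nat (zero_mult zeta_reg (Complex 1 (2 * t))))"
    by (rule tendsto_lowerbound) simp
  moreover have "zorder zeta_reg (Complex 1 t) > 0"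
  proof -
    have "s = Complex 1 t" using assms by (simp add: complex_eq_iff t_def)
    thus ?thesis using zero_factor[OF ent nz1, of s] zero by metis
  qed
  hence "zero_mult zeta_reg (Complex 1 t) \<ge> 1" by linarith
  hence "real (zero_mult zeta_reg (Complex 1 t)) \<ge> 1" by simp
  ultimately show False by simp
qed

section \<open>Counting zeros, and lines that stay away from them\<close>

lemma norm_dseries_ge:
  assumes "Re s \<ge> 2"
  shows "norm (dseries s) \<ge> 1 / 3"
proof -
  have s: "Re s > 1" using assms by simp
  have "(\<lambda>n. npow (Suc n) (-s)) sums (dseries s - npow 0 (-s))"
    using dseries_sums[OF s] sums_Suc_iff[of "\<lambda>n. npow n (-s)" "dseries s - npow 0 (-s)"]
    by (simp only: diff_add_cancel)
  hence sm: "(\<lambda>n. npow (Suc n) (-s)) sums (dseries s - 1)" by simp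
  \<comment> \<open>The majorant 1 / ((n + 3/2) (n + 5/2)) of 1 / (n + 2)^2 telescopes to 2/3, which
    is less than the leading term 1.\<close>
  have T: "(\<lambda>n. 1 / (real n + 3/2) - 1 / (real (Suc n) + 3/2)) sums (1 / (real 0 + 3/2) - 0)"
    by (rule telescope_sums') real_asymp
  have "norm (\<Sum>n. npow (Suc n) (-s)) \<le> (\<Sum>n. 1 / (real n + 3/2) - 1 / (real (Suc n) + 3/2))"
  proof (rule norm_suminf_le[OF _ sums_summable[OF T]])
    fix n
    have "norm (npow (Suc n) (-s)) = real (Suc (Suc n)) powr (- Re s)" by (simp add: norm_npow del: of_nat_Suc)
    also have "\<dots> \<le> real (Suc (Suc n)) powr (-2)" using assms by (intro powr_mono) auto
    also have "\<dots> = 1 / (real n + 2)\<^sup>2" by (simp add: powr_minus_divide powr_numeral add.commute)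
    also have "\<dots> \<le> 1 / ((real n + 3/2) * (real n + 5/2))"
      by (intro divide_left_mono) (auto simp: power2_eq_square algebra_simps add_pos_nonneg)
    also have "\<dots> = 1 / (real n + 3/2) - 1 / (real (Suc n) + 3/2)"
      by (simp add: divide_simps)
    finally show "norm (npow (Suc n) (-s)) \<le> 1 / (real n + 3/2) - 1 / (real (Suc n) + 3/2)" .
  qed
  hence "norm (dseries s - 1) \<le> 2/3"
    using sm T by (simp add: sums_iff)
  thus ?thesis using norm_triangle_ineq2[of 1 "1 - dseries s"] by (simp add: norm_minus_commute)
qed

lemma norm_zeta_reg_ge:
  assumes "Re s \<ge> 2"
  shows "norm (zeta_reg s) \<ge> 1 / 3"
proof -
  have "1 \<le> norm (s - 1)" using assms abs_Re_le_cmod[of "s - 1"] by simp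
  hence "1 * (1/3) \<le> norm (s - 1) * norm (dseries s)"
    using norm_dseries_ge[OF assms] by (intro mult_mono) auto
  thus ?thesis using assms by (simp add: zeta_reg_dseries norm_mult)
qed

lemma zeta_reg_disc_bound:
  obtains K where "K > 0" "\<And>t s. s \<in> sphere (Complex 2 t) 12 \<Longrightarrow>
     norm (zeta_reg s) \<le> exp (K * (1 + \<bar>t\<bar>)) * norm (zeta_reg (Complex 2 t))"
proof -
  \<comment> \<open>The sphere of radius 12 reaches down to Re s = -10, inside the half-plane Re s
    >= 1/2 - 11.\<close>
  obtain C where C: "C \<ge> 0" "\<And>s. Re s \<ge> 1/2 - real 11 \<Longrightarrow> norm (zeta_reg s) \<le> exp (C * (1 + norm s))"
    using zeta_reg_exp_bounded[of 11] by (auto simp: exp_bounded_def)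
  show ?thesis
  \<comment> \<open>15 comes from 1 + |s| <= 1 + 2 + |t| + 12, and 2 pays for the lower bound 1/3 >=
    exp (-2) at the centre.\<close>
  proof (rule that[of "15 * C + 2"])
    fix t s assume s: "s \<in> sphere (Complex 2 t) 12"
    have n: "norm (s - Complex 2 t) = 12" using s by (simp add: dist_norm norm_minus_commute)
    have "\<bar>Re s - 2\<bar> \<le> 12" using abs_Re_le_cmod[of "s - Complex 2 t"] n by simp
    hence Re: "Re s \<ge> 1/2 - real 11" by simp
    have "norm s \<le> norm (Complex 2 t) + 12" using norm_triangle_sub[of s "Complex 2 t"] n by simp
    also have "norm (Complex 2 t) \<le> 2 + \<bar>t\<bar>" using cmod_le[of "Complex 2 t"] by simp
    finally have "1 + norm s \<le> 15 * (1 + \<bar>t\<bar>)" by simp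
    hence "C * (1 + norm s) \<le> C * (15 * (1 + \<bar>t\<bar>))" using C(1) by (rule mult_left_mono)
    hence "exp (C * (1 + norm s)) \<le> exp (15 * C * (1 + \<bar>t\<bar>))" by (simp only: exp_le_cancel_iff mult_ac)
    with C(2)[OF Re] have "norm (zeta_reg s) \<le> exp (15 * C * (1 + \<bar>t\<bar>))" by (rule order_trans)
    also have "\<dots> \<le> exp ((15 * C + 2) * (1 + \<bar>t\<bar>)) * exp (-2)"
      unfolding exp_add[symmetric] by (simp add: algebra_simps)
    also have "\<dots> \<le> exp ((15 * C + 2) * (1 + \<bar>t\<bar>)) * norm (zeta_reg (Complex 2 t))"
    proof (rule mult_left_mono)
      have "exp (-2) \<le> (1/3 :: real)" using exp_ge_add_one_self[of "2::real"] by (simp add: exp_minus field_simps)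
      also have "\<dots> \<le> norm (zeta_reg (Complex 2 t))" by (rule norm_zeta_reg_ge) simp
      finally show "exp (-2) \<le> norm (zeta_reg (Complex 2 t))" .
    qed auto
    finally show "norm (zeta_reg s) \<le> exp ((15 * C + 2) * (1 + \<bar>t\<bar>)) * norm (zeta_reg (Complex 2 t))" .
  qed (use C in auto)
qed

definition near_zeros :: "real \<Rightarrow> complex set" where
  "near_zeros t = {a \<in> ball (Complex 2 t) 4. zeta_reg a = 0}"

abbreviation zmult :: "complex \<Rightarrow> nat" where
  "zmult \<equiv> zero_mult zeta_reg"

lemma zeta_reg_2_nonzero: "zeta_reg (Complex 2 t) \<noteq> 0"
  by (rule zeta_reg_nonzero_right) simp

lemma finite_zeta_reg_zeros: "bounded K \<Longrightarrow> finite {a\<in>K. zeta_reg a = 0}"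
  by (rule zeros_finite[OF zeta_reg_entire zeta_reg_2_nonzero])

lemma finite_near_zeros: "finite (near_zeros t)"
  unfolding near_zeros_def by (rule finite_zeta_reg_zeros) auto

lemma zmult_pos: "zeta_reg a = 0 \<Longrightarrow> zmult a > 0"
  using zero_factor[OF zeta_reg_entire zeta_reg_2_nonzero, of a] by (metis zero_less_nat_eq)

text \<open>\<open>landau_local\<close> at 2 + i t with B proportional to 1 + |t|. Its disc of
  radius 3 contains the segment -1/2 <= Re s <= 2 at height t, and a distance d to the zeros turns
  the partial fractions into the factor 1 / d.\<close>

lemma near_zeros_bounds:
  obtains K where "K > 0" "\<And>t. (\<Sum>a\<in>near_zeros t. real (zmult a)) \<le> K * (1 + \<bar>t\<bar>)"
    "\<And>s d. -1/2 \<le> Re s \<Longrightarrow> Re s \<le> 2 \<Longrightarrow> d > 0 \<Longrightarrow> (\<And>a. a \<in> near_zeros (Im s) \<Longrightarrow> d \<le> norm (s - a)) \<Longrightarrow>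
       zeta_reg s \<noteq> 0 \<and> norm (deriv zeta_reg s / zeta_reg s) \<le> K * (1 + \<bar>Im s\<bar>) * (1 + 1 / d)"
proof -
  obtain K where K: "K > 0" "\<And>t s. s \<in> sphere (Complex 2 t) 12 \<Longrightarrow>
     norm (zeta_reg s) \<le> exp (K * (1 + \<bar>t\<bar>)) * norm (zeta_reg (Complex 2 t))"
    using zeta_reg_disc_bound by blast
  have B: "K * (1 + \<bar>t\<bar>) > 0" for t using K(1) by simp
  have landau1: "(\<Sum>a\<in>near_zeros t. real (zmult a)) \<le> 2 * (K * (1 + \<bar>t\<bar>))" for t
    using landau_local(1)[OF zeta_reg_entire zeta_reg_2_nonzero B K(2)] unfolding near_zeros_def by blast
  have landau2: "norm (deriv zeta_reg s / zeta_reg s - (\<Sum>a\<in>near_zeros t. of_nat (zmult a) / (s - a))) \<le> 56 * (K * (1 + \<bar>t\<bar>))"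
    if "s \<in> cball (Complex 2 t) 3" "zeta_reg s \<noteq> 0" for s t
    using landau_local(2)[OF zeta_reg_entire zeta_reg_2_nonzero B K(2)] that unfolding near_zeros_def by blast
  show ?thesis
  proof (rule that[of "56 * K"])
    fix t
    show "(\<Sum>a\<in>near_zeros t. real (zmult a)) \<le> 56 * K * (1 + \<bar>t\<bar>)"
      using landau1[of t] B[of t] by (simp add: algebra_simps)
  next
    fix s :: complex and d :: real
    assume s: "-1/2 \<le> Re s" "Re s \<le> 2" and d: "d > 0" "\<And>a. a \<in> near_zeros (Im s) \<Longrightarrow> d \<le> norm (s - a)"
    define t where "t = Im s"
    have "norm (Complex 2 t - s) \<le> 3"
      using cmod_le[of "Complex 2 t - s"] s by (simp add: t_def)
    hence s3: "s \<in> cball (Complex 2 t) 3" by (simp add: dist_norm)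
    have nz: "zeta_reg s \<noteq> 0"
    proof
      assume "zeta_reg s = 0"
      hence "s \<in> near_zeros t" using s3 by (simp add: near_zeros_def)
      thus False using d(2)[of s] d(1) by (simp add: t_def)
    qed
    have "norm (\<Sum>a\<in>near_zeros t. of_nat (zmult a) / (s - a)) \<le> (\<Sum>a\<in>near_zeros t. real (zmult a) * (1 / d))"
    proof (rule sum_norm_le)
      fix a assume a: "a \<in> near_zeros t"
      hence "d \<le> norm (s - a)" using d by (simp add: t_def)
      hence "real (zmult a) / norm (s - a) \<le> real (zmult a) / d"
        using d(1) by (intro divide_left_mono mult_pos_pos) auto
      thus "norm (of_nat (zmult a) / (s - a)) \<le> real (zmult a) * (1 / d)" by (simp add: norm_divide)
    qed
    also have "\<dots> = (\<Sum>a\<in>near_zeros t. real (zmult a)) * (1 / d)" by (simp only: sum_distrib_right)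
    also have "\<dots> \<le> 2 * (K * (1 + \<bar>t\<bar>)) * (1 / d)" using landau1[of t] d(1) by (intro mult_right_mono) auto
    also have "\<dots> \<le> 56 * (K * (1 + \<bar>t\<bar>)) * (1 / d)" using B[of t] d(1) by (intro mult_right_mono) auto
    finally have 1: "norm (\<Sum>a\<in>near_zeros t. of_nat (zmult a) / (s - a)) \<le> 56 * (K * (1 + \<bar>t\<bar>)) * (1 / d)" .
    have "norm (deriv zeta_reg s / zeta_reg s) \<le> norm (\<Sum>a\<in>near_zeros t. of_nat (zmult a) / (s - a)) +
        norm (deriv zeta_reg s / zeta_reg s - (\<Sum>a\<in>near_zeros t. of_nat (zmult a) / (s - a)))"
      by (rule norm_triangle_sub)
    also have "\<dots> \<le> 56 * (K * (1 + \<bar>t\<bar>)) * (1 / d) + 56 * (K * (1 + \<bar>t\<bar>))"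
      using 1 landau2[OF s3 nz] by linarith
    also have "\<dots> = 56 * K * (1 + \<bar>Im s\<bar>) * (1 + 1 / d)" by (simp add: t_def algebra_simps)
    finally show "zeta_reg s \<noteq> 0 \<and> norm (deriv zeta_reg s / zeta_reg s) \<le> 56 * K * (1 + \<bar>Im s\<bar>) * (1 + 1 / d)"
      using nz by blast
  qed (use K in auto)
qed

text \<open>Heights n above and below the real axis are taken together. Zeros with Re a < -1 are
  left out, as they stay at least 1/2 away from the contours, which lie in Re s >= -1/2.\<close>

definition zero_box :: "nat \<Rightarrow> complex set" where
  "zero_box n = {a. zeta_reg a = 0 \<and> -1 \<le> Re a \<and> real n \<le> \<bar>Im a\<bar> \<and> \<bar>Im a\<bar> < real n + 1}"

lemma zero_Re_less_1: "zeta_reg a = 0 \<Longrightarrow> Re a < 1"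
  using zeta_reg_nonzero_right[of a] zeta_reg_nonzero_line1[of a] by force

lemma zero_box_subset: "zero_box n \<subseteq> near_zeros (real n) \<union> near_zeros (- real n)"
proof
  fix a assume a: "a \<in> zero_box n"
  have less: "norm z < 4" if "\<bar>Re z\<bar> \<le> 3" "\<bar>Im z\<bar> \<le> 1" for z :: complex
  proof -
    have "(norm z)\<^sup>2 = (Re z)\<^sup>2 + (Im z)\<^sup>2" by (rule cmod_power2)
    also have "\<dots> \<le> 3\<^sup>2 + 1\<^sup>2" using power_mono[OF that(1), of 2] power_mono[OF that(2), of 2] by simp
    also have "\<dots> < 4\<^sup>2" by simp
    finally show ?thesis by (rule power2_less_imp_less) simp
  qed
  show "a \<in> near_zeros (real n) \<union> near_zeros (- real n)"
  proof (cases "Im a \<ge> 0")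
    case True
    have "norm (Complex 2 (real n) - a) < 4"
      by (rule less) (use a True zero_Re_less_1[of a] in \<open>auto simp: zero_box_def\<close>)
    thus ?thesis using a by (simp add: near_zeros_def zero_box_def dist_norm)
  next
    case False
    have "norm (Complex 2 (- real n) - a) < 4"
      by (rule less) (use a False zero_Re_less_1[of a] in \<open>auto simp: zero_box_def\<close>)
    thus ?thesis using a by (simp add: near_zeros_def zero_box_def dist_norm)
  qed
qed

lemma finite_zero_box: "finite (zero_box n)"
  using zero_box_subset finite_near_zeros by (meson finite_Un finite_subset)

lemma zero_box_count:
  obtains C where "C > 0" "\<And>n. (\<Sum>a\<in>zero_box n. real (zmult a)) \<le> C * (real n + 1)"
    "\<And>n. real (card (zero_box n)) \<le> C * (real n + 1)"
proof -
  obtain K where K: "K > 0" "\<And>t. (\<Sum>a\<in>near_zeros t. real (zmult a)) \<le> K * (1 + \<bar>t\<bar>)"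
    using near_zeros_bounds by metis
  have 1: "(\<Sum>a\<in>zero_box n. real (zmult a)) \<le> 2 * K * (real n + 1)" for n
  proof -
    have "(\<Sum>a\<in>zero_box n. real (zmult a)) \<le> (\<Sum>a\<in>near_zeros (real n) \<union> near_zeros (- real n). real (zmult a))"
      using zero_box_subset by (intro sum_mono2) (auto simp: finite_near_zeros)
    also have "\<dots> \<le> (\<Sum>a\<in>near_zeros (real n). real (zmult a)) + (\<Sum>a\<in>near_zeros (- real n). real (zmult a))"
      by (subst sum_Un) (auto simp: finite_near_zeros sum_nonneg)
    also have "\<dots> \<le> 2 * K * (real n + 1)" using K(2)[of "real n"] K(2)[of "- real n"] by (simp add: algebra_simps)
    finally show ?thesis .
  qed
  moreover have "real (card (zero_box n)) \<le> 2 * K * (real n + 1)" for n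
  proof -
    have "real (card (zero_box n)) = (\<Sum>a\<in>zero_box n. 1)" by simp
    also have "\<dots> \<le> (\<Sum>a\<in>zero_box n. real (zmult a))"
      using zmult_pos by (intro sum_mono) (auto simp: zero_box_def Suc_le_eq)
    finally show ?thesis using 1[of n] by simp
  qed
  ultimately show ?thesis using that[of "2 * K"] K(1) by auto
qed

section \<open>Lines at a distance from all zeros\<close>

text \<open>If every a were close to some X n, the intervals of radius d n would cover {u..v},
  although their total length is at most S.\<close>

lemma exists_far_point:
  fixes X :: "nat \<Rightarrow> real set" and d :: "nat \<Rightarrow> real"
  assumes fin: "\<And>n. finite (X n)" and d: "\<And>n. d n \<ge> 0"
    and sm: "(\<lambda>n. 2 * d n * real (card (X n))) sums S" and S: "S < v - u"
  shows "\<exists>a\<in>{u..v}. \<forall>n. \<forall>x\<in>X n. d n \<le> \<bar>a - x\<bar>"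
proof (rule ccontr)
  assume *: "\<not> ?thesis"
  define U where "U = (\<lambda>n. \<Union>x\<in>X n. ball x (d n))"
  have U: "U n \<in> sets lborel" for n using fin unfolding U_def by (intro sets.finite_UN) auto
  have sub: "{u..v} \<subseteq> (\<Union>n. U n)"
  proof
    fix a assume "a \<in> {u..v}"
    then obtain n x where "x \<in> X n" "\<bar>a - x\<bar> < d n" using * by force
    hence "a \<in> ball x (d n)" by (simp add: dist_real_def abs_minus_commute)
    thus "a \<in> (\<Union>n. U n)" using \<open>x \<in> X n\<close> unfolding U_def by blast
  qed
  have Un: "emeasure lborel (U n) \<le> ennreal (2 * d n * real (card (X n)))" for n
  proof -
    have "emeasure lborel (U n) \<le> (\<Sum>x\<in>X n. emeasure lborel (ball x (d n)))"
      unfolding U_def by (rule emeasure_subadditive_finite) (use fin in auto)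
    also have "\<dots> = (\<Sum>x\<in>X n. ennreal (2 * d n))"
    proof (rule sum.cong)
      fix x
      have "ball x (d n) = {x - d n<..<x + d n}" by (auto simp: dist_real_def)
      thus "emeasure lborel (ball x (d n)) = ennreal (2 * d n)" using d[of n] by simp
    qed auto
    also have "\<dots> = ennreal (2 * d n * real (card (X n)))"
      using d[of n] by (simp add: ennreal_mult'' ennreal_of_nat_eq_real_of_nat mult.commute)
    finally show ?thesis .
  qed
  have nn: "2 * d n * real (card (X n)) \<ge> 0" for n using d[of n] by simp
  have "S \<ge> 0" using sums_le[OF _ sums_zero sm] nn by auto
  have "ennreal (v - u) \<le> emeasure lborel {u..v}" by (cases "u \<le> v") (auto simp: ennreal_neg)
  also have "\<dots> \<le> emeasure lborel (\<Union>n. U n)" using sub U by (intro emeasure_mono) auto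
  also have "\<dots> \<le> (\<Sum>n. emeasure lborel (U n))" using U by (intro emeasure_subadditive_countably) auto
  also have "\<dots> \<le> (\<Sum>n. ennreal (2 * d n * real (card (X n))))" by (intro suminf_le Un) auto
  also have "\<dots> = ennreal S" using sm nn by (subst suminf_ennreal_eq[of _ S]) auto
  finally have "v - u \<le> S" using \<open>S \<ge> 0\<close> by (simp add: ennreal_le_iff)
  thus False using S by simp
qed

text \<open>Box n holds O(n + 1) zeros, so intervals of radius c / (n + 1)^3 have summable length.
  The inverse distance is then of order (1 + |t|)^3, and the local partial fractions add one more
  factor.\<close>

lemma exists_left_line:
  obtains a C where "-1/2 \<le> a" "a \<le> -1/4" "C > 0"
    "\<And>t. zeta_reg (Complex a t) \<noteq> 0"
    "\<And>t. norm (deriv zeta_reg (Complex a t) / zeta_reg (Complex a t)) \<le> C * (1 + \<bar>t\<bar>) ^ 4"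
proof -
  obtain C where C: "C > 0" "\<And>n. real (card (zero_box n)) \<le> C * (real n + 1)"
    using zero_box_count by metis
  define S where "S = (\<Sum>n. 1 / real (Suc n) ^ 2)"
  have S: "(\<lambda>n. 1 / real (Suc n) ^ 2) sums S"
    unfolding S_def using inverse_squares_sums by (simp add: sums_iff)
  have S0: "S \<ge> 0" using sums_le[OF _ sums_zero S] by simp
  \<comment> \<open>The second term makes the total length at most 2 c C S < 1/4, the length of the
    interval for a. The bound 1/2 takes care of the zeros with Re r < -1.\<close>
  define c where "c = min (1/2) (1 / (8 * C * S + 8))"
  have c: "c > 0" "c \<le> 1/2" "c \<le> 1 / (8 * C * S + 8)" using C(1) S0 by (auto simp: c_def add_nonneg_pos)
  define X where "X = (\<lambda>n. Re ` zero_box n)"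
  define d where "d = (\<lambda>n. c / (real n + 1) ^ 3)"
  have le: "2 * d n * real (card (X n)) \<le> 2 * c * C * (1 / real (Suc n) ^ 2)" for n
  proof -
    have "real (card (X n)) \<le> C * (real n + 1)"
      unfolding X_def using C(2)[of n] card_image_le[OF finite_zero_box[of n], of Re] by linarith
    hence "2 * d n * real (card (X n)) \<le> 2 * d n * (C * (real n + 1))"
      using c by (intro mult_left_mono) (auto simp: d_def)
    also have "\<dots> = 2 * c * C * (1 / real (Suc n) ^ 2)"
    proof -
      have "2 * (c / m ^ 3) * (C * m) = 2 * c * C * (1 / m ^ 2)" if "m > 0" for m :: real
        using that by (simp add: power2_eq_square power3_eq_cube)
      from this[of "real n + 1"] show ?thesis by (simp add: d_def add.commute)
    qed
    finally show ?thesis .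
  qed
  have sm0: "summable (\<lambda>n. 2 * d n * real (card (X n)))"
  proof (rule summable_comparison_test'[of _ 0])
    show "summable (\<lambda>n. 2 * c * C * (1 / real (Suc n) ^ 2))" using S by (intro summable_mult sums_summable)
    show "norm (2 * d n * real (card (X n))) \<le> 2 * c * C * (1 / real (Suc n) ^ 2)" for n
      using le[of n] c by (simp add: d_def)
  qed
  then obtain S' where S': "(\<lambda>n. 2 * d n * real (card (X n))) sums S'" by (auto simp: summable_def)
  have "S' \<le> 2 * c * C * S" by (rule sums_le[OF le S' sums_mult[OF S]])
  also have "\<dots> \<le> 2 * (1 / (8 * C * S + 8)) * C * S"
    using c C(1) S0 by (intro mult_right_mono mult_left_mono) auto
  also have "\<dots> < -1/4 - (-1/2)"
  proof -
    have "2 * (1 / (8 * q + 8)) * q < 1/4" if "q \<ge> 0" for q :: real using that by (simp add: field_simps)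
    from this[of "C * S"] show ?thesis using C(1) S0 by (simp add: mult.assoc)
  qed
  finally have "\<exists>a\<in>{-1/2..-1/4}. \<forall>n. \<forall>x\<in>X n. d n \<le> \<bar>a - x\<bar>"
    by (intro exists_far_point[OF _ _ S']) (use c in \<open>auto simp: X_def finite_zero_box d_def\<close>)
  then obtain a where a: "-1/2 \<le> a" "a \<le> -1/4" "\<And>n x. x \<in> X n \<Longrightarrow> d n \<le> \<bar>a - x\<bar>" by auto
  obtain K where K: "K > 0" 
    "\<And>s d. -1/2 \<le> Re s \<Longrightarrow> Re s \<le> 2 \<Longrightarrow> d > 0 \<Longrightarrow> (\<And>a. a \<in> near_zeros (Im s) \<Longrightarrow> d \<le> norm (s - a)) \<Longrightarrow>
       zeta_reg s \<noteq> 0 \<and> norm (deriv zeta_reg s / zeta_reg s) \<le> K * (1 + \<bar>Im s\<bar>) * (1 + 1 / d)"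
    using near_zeros_bounds by metis
  have *: "zeta_reg (Complex a t) \<noteq> 0 \<and> norm (deriv zeta_reg (Complex a t) / zeta_reg (Complex a t)) \<le>
            K * (1 + \<bar>t\<bar>) * (1 + 1 / (c / (5 + \<bar>t\<bar>) ^ 3))" for t
  proof (rule K(2)[of "Complex a t", simplified])
    fix r assume r: "r \<in> near_zeros t"
    \<comment> \<open>Near zeros lie within 4 of the height t, so their box index n satisfies n + 1
      <= 5 + |t|.\<close>
    have Imr: "\<bar>Im r\<bar> \<le> \<bar>t\<bar> + 4"
      using r abs_Im_le_cmod[of "Complex 2 t - r"] by (auto simp: near_zeros_def dist_norm)
    have "c / (5 + \<bar>t\<bar>) ^ 3 \<le> \<bar>a - Re r\<bar>"
    proof (cases "Re r \<ge> -1")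
      case True
      define n where "n = nat \<lfloor>\<bar>Im r\<bar>\<rfloor>"
      have n: "real n \<le> \<bar>Im r\<bar>" "\<bar>Im r\<bar> < real n + 1" unfolding n_def by linarith+
      hence "Re r \<in> X n" using r True by (auto simp: X_def zero_box_def near_zeros_def)
      hence "d n \<le> \<bar>a - Re r\<bar>" by (rule a)
      moreover have "c / (5 + \<bar>t\<bar>) ^ 3 \<le> d n"
        unfolding d_def using c n Imr by (intro divide_left_mono power_mono mult_pos_pos zero_less_power) auto
      ultimately show ?thesis by simp
    next
      case False
      have "c / (5 + \<bar>t\<bar>) ^ 3 \<le> c / 1" using c by (intro divide_left_mono) auto
      thus ?thesis using c a False by simp
    qed
    also have "\<dots> \<le> norm (Complex a t - r)" using abs_Re_le_cmod[of "Complex a t - r"] by simp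
    finally show "c / (5 + \<bar>t\<bar>) ^ 3 \<le> norm (Complex a t - r)" .
  qed (use a c in auto)
  show ?thesis
  proof (rule that[OF a(1,2), of "K * (1 + 125 / c)"])
    fix t :: real
    show "zeta_reg (Complex a t) \<noteq> 0" using * by blast
    have "norm (deriv zeta_reg (Complex a t) / zeta_reg (Complex a t)) \<le>
            K * (1 + \<bar>t\<bar>) * (1 + 1 / (c / (5 + \<bar>t\<bar>) ^ 3))" using * by blast
    also have "\<dots> \<le> K * (1 + \<bar>t\<bar>) * ((1 + 125 / c) * (1 + \<bar>t\<bar>) ^ 3)"
    proof (rule mult_left_mono)
      have "(5 + \<bar>t\<bar>) ^ 3 \<le> (5 * (1 + \<bar>t\<bar>)) ^ 3" by (intro power_mono) auto
      also have "\<dots> = 125 * (1 + \<bar>t\<bar>) ^ 3" unfolding power_mult_distrib by simp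
      finally have "(5 + \<bar>t\<bar>) ^ 3 / c \<le> 125 * (1 + \<bar>t\<bar>) ^ 3 / c" using c by (intro divide_right_mono) auto
      moreover have "1 \<le> (1 + \<bar>t\<bar>) ^ 3" by (rule one_le_power) auto
      ultimately have "1 + (5 + \<bar>t\<bar>) ^ 3 / c \<le> (1 + \<bar>t\<bar>) ^ 3 + 125 * (1 + \<bar>t\<bar>) ^ 3 / c" by linarith
      thus "1 + 1 / (c / (5 + \<bar>t\<bar>) ^ 3) \<le> (1 + 125 / c) * (1 + \<bar>t\<bar>) ^ 3" by (simp add: algebra_simps)
    qed (use K in auto)
    also have "\<dots> = K * (1 + 125 / c) * (1 + \<bar>t\<bar>) ^ 4" by (simp add: power_numeral_reduce mult_ac)
    finally show "norm (deriv zeta_reg (Complex a t) / zeta_reg (Complex a t)) \<le> K * (1 + 125 / c) * (1 + \<bar>t\<bar>) ^ 4" .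
  qed (use K c in \<open>auto intro!: mult_pos_pos add_pos_pos\<close>)
qed

text \<open>T k lies at least one unit inside the heights covered by the boxes k to k + 2, so only
  their O(k + 1) zeros have to be avoided. Working with |Im a| makes the edges at T k and at -T k
  safe at once.\<close>

lemma exists_heights:
  obtains C T where "C > 0" "\<And>k::nat. real k + 1 \<le> T k \<and> T k \<le> real k + 2"
    "\<And>k s. -1/2 \<le> Re s \<Longrightarrow> Re s \<le> 2 \<Longrightarrow> \<bar>Im s\<bar> = T k \<Longrightarrow>
       zeta_reg s \<noteq> 0 \<and> norm (deriv zeta_reg s / zeta_reg s) \<le> C * (1 + T k) ^ 2"
proof -
  obtain C where C: "C > 0" "\<And>n. real (card (zero_box n)) \<le> C * (real n + 1)"
    using zero_box_count by metis
  obtain K where K: "K > 0" 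
    "\<And>s d. -1/2 \<le> Re s \<Longrightarrow> Re s \<le> 2 \<Longrightarrow> d > 0 \<Longrightarrow> (\<And>a. a \<in> near_zeros (Im s) \<Longrightarrow> d \<le> norm (s - a)) \<Longrightarrow>
       zeta_reg s \<noteq> 0 \<and> norm (deriv zeta_reg s / zeta_reg s) \<le> K * (1 + \<bar>Im s\<bar>) * (1 + 1 / d)"
    using near_zeros_bounds by metis
  \<comment> \<open>With q = 3 C (k + 3) bounding the number of zeros, 2 d q < 1 leaves room in an
    interval of length 1, and d <= 1/4 covers all zeros outside the three boxes.\<close>
  define d where "d = (\<lambda>k. 1 / (4 * (1 + 3 * C * (real k + 3))))"
  have d: "d k > 0" "d k \<le> 1/4" for k
  proof -
    have "3 * C * (real k + 3) \<ge> 0" using C(1) by simp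
    hence "4 * (1 + 3 * C * (real k + 3)) \<ge> 4" by simp
    thus "d k > 0" "d k \<le> 1/4" unfolding d_def
      by (simp_all add: divide_simps split: if_splits)
  qed
  have "\<exists>T. real k + 1 \<le> T \<and> T \<le> real k + 2 \<and>
      (\<forall>a. zeta_reg a = 0 \<longrightarrow> Re a \<ge> -1 \<longrightarrow> d k \<le> \<bar>T - \<bar>Im a\<bar>\<bar>)" for k
  proof -
    define Z where "Z = zero_box k \<union> zero_box (k+1) \<union> zero_box (k+2)"
    \<comment> \<open>\<open>exists_far_point\<close> expects a sequence of sets; the finite set
      sits at index 0.\<close>
    define X where "X = (\<lambda>n::nat. if n = 0 then (\<lambda>a. \<bar>Im a\<bar>) ` Z else {})"
    have fZ: "finite Z" by (simp add: Z_def finite_zero_box)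
    have sm: "(\<lambda>n. 2 * d k * real (card (X n))) sums (2 * d k * real (card (X 0)))"
      by (rule sums_finite[of "{0}", simplified]) (auto simp: X_def)
    have "real (card (X 0)) \<le> real (card Z)" using card_image_le[OF fZ] by (simp add: X_def)
    also have "\<dots> \<le> real (card (zero_box k) + card (zero_box (k+1)) + card (zero_box (k+2)))"
      unfolding Z_def of_nat_le_iff by (meson add_mono card_Un_le le_refl order_trans)
    also have "\<dots> \<le> 3 * C * (real k + 3)"
      using C(2)[of k] C(2)[of "k+1"] C(2)[of "k+2"] C(1) by (simp add: algebra_simps)
    finally have "2 * d k * real (card (X 0)) \<le> 2 * d k * (3 * C * (real k + 3))"
      using d[of k] by (intro mult_left_mono) auto
    also have "\<dots> < (real k + 2) - (real k + 1)"
    proof -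
      have "2 * (1 / (4 * (1 + q))) * q < 1" if "q \<ge> 0" for q :: real using that by (simp add: field_simps)
      from this[of "3 * C * (real k + 3)"] show ?thesis using C(1) by (simp add: d_def)
    qed
    finally have lt: "2 * d k * real (card (X 0)) < (real k + 2) - (real k + 1)" .
    have "finite (X n)" for n using fZ by (simp add: X_def)
    from exists_far_point[OF this _ sm lt] d(1)[of k]
    obtain T where T: "T \<in> {real k + 1..real k + 2}" "\<And>n x. x \<in> X n \<Longrightarrow> d k \<le> \<bar>T - x\<bar>"
      by (auto simp: less_imp_le)
    have "d k \<le> \<bar>T - \<bar>Im a\<bar>\<bar>" if a: "zeta_reg a = 0" "Re a \<ge> -1" for a
    proof (cases "a \<in> Z")
      case True
      thus ?thesis using T(2)[of "\<bar>Im a\<bar>" 0] by (auto simp: X_def)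
    next
      case False
      hence "\<bar>Im a\<bar> < real k \<or> \<bar>Im a\<bar> \<ge> real k + 3"
        using a by (auto simp: Z_def zero_box_def)
      thus ?thesis using T(1) d[of k] by auto
    qed
    thus ?thesis using T(1) by auto
  qed
  then obtain T where T: "\<And>k. real k + 1 \<le> T k \<and> T k \<le> real k + 2"
    "\<And>k a. zeta_reg a = 0 \<Longrightarrow> Re a \<ge> -1 \<Longrightarrow> d k \<le> \<bar>T k - \<bar>Im a\<bar>\<bar>" by metis
  show ?thesis
  proof (rule that[OF _ T(1), of "K * (5 + 48 * C)"])
    show "K * (5 + 48 * C) > 0" using K C by (simp add: add_pos_pos)
    fix k s assume s: "-1/2 \<le> Re s" "Re s \<le> 2" "\<bar>Im s\<bar> = T k"
    have "zeta_reg s \<noteq> 0 \<and> norm (deriv zeta_reg s / zeta_reg s) \<le> K * (1 + \<bar>Im s\<bar>) * (1 + 1 / d k)"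
    proof (rule K(2)[OF s(1,2) d(1)])
      fix a assume a: "a \<in> near_zeros (Im s)"
      show "d k \<le> norm (s - a)"
      proof (cases "Re a \<ge> -1")
        case True
        have "d k \<le> \<bar>T k - \<bar>Im a\<bar>\<bar>" by (rule T(2)) (use True a in \<open>auto simp: near_zeros_def\<close>)
        also have "\<dots> \<le> \<bar>Im (s - a)\<bar>" using s(3) by simp
        also have "\<dots> \<le> norm (s - a)" by (rule abs_Im_le_cmod)
        finally show ?thesis .
      next
        case False
        hence "d k \<le> \<bar>Re (s - a)\<bar>" using s d[of k] by simp
        also have "\<dots> \<le> norm (s - a)" by (rule abs_Re_le_cmod)
        finally show ?thesis .
      qed
    qed
    moreover have "K * (1 + \<bar>Im s\<bar>) * (1 + 1 / d k) \<le> K * (5 + 48 * C) * (1 + T k) ^ 2"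
    proof -
      have Tk: "real k \<le> T k" "T k \<ge> 1" using T(1)[of k] by auto
      have "1 + 1 / d k = 5 + 12 * C * (real k + 3)" by (simp add: d_def)
      also have "\<dots> \<le> 5 * (1 + T k) + 12 * C * (4 * (1 + T k))"
        using Tk C(1) by (intro add_mono mult_left_mono) auto
      also have "\<dots> = (5 + 48 * C) * (1 + T k)" by (simp add: algebra_simps)
      finally have "K * (1 + T k) * (1 + 1 / d k) \<le> K * (1 + T k) * ((5 + 48 * C) * (1 + T k))"
        using K Tk by (intro mult_left_mono) auto
      thus ?thesis using s(3) by (simp add: power2_eq_square mult_ac)
    qed
    ultimately show "zeta_reg s \<noteq> 0 \<and> norm (deriv zeta_reg s / zeta_reg s) \<le> K * (5 + 48 * C) * (1 + T k) ^ 2"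
      by linarith
  qed
qed

text \<open>Grouping by the integer part of |Im a| reduces this to the convergent series of (n + 1)
  exp (-n). The weight is the one that \<open>Gamma\<close> supplies.\<close>

lemma summable_zeros_exp:
  "(\<lambda>a. real (zmult a) * exp (- \<bar>Im a\<bar>)) summable_on {a. zeta_reg a = 0 \<and> Re a \<ge> -1}"
proof -
  obtain C where C: "C > 0" "\<And>n. (\<Sum>a\<in>zero_box n. real (zmult a)) \<le> C * (real n + 1)"
    using zero_box_count by metis
  have sm: "summable (\<lambda>n. C * (real n + 1) * exp (- real n))"
  proof (rule summable_comparison_test_bigo)
    show "summable (\<lambda>n. norm (1 / real n ^ 2))" using inverse_power_summable[of 2] by (simp add: inverse_eq_divide)
    show "(\<lambda>n. C * (real n + 1) * exp (- real n)) \<in> O(\<lambda>n. 1 / real n ^ 2)" by real_asymp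
  qed
  define S where "S = (\<Sum>n. C * (real n + 1) * exp (- real n))"
  show ?thesis
  proof (rule nonneg_bounded_partial_sums_imp_summable_on)
    have "(\<Sum>a\<in>F. real (zmult a) * exp (- \<bar>Im a\<bar>)) \<le> S" if F: "finite F" "F \<subseteq> {a. zeta_reg a = 0 \<and> Re a \<ge> -1}" for F
    proof -
      define h where "h = (\<lambda>a. nat \<lfloor>\<bar>Im a\<bar>\<rfloor>)"
      have h: "real (h a) \<le> \<bar>Im a\<bar>" "\<bar>Im a\<bar> < real (h a) + 1" for a unfolding h_def by linarith+
      have "(\<Sum>a\<in>F. real (zmult a) * exp (- \<bar>Im a\<bar>)) = (\<Sum>n\<in>h ` F. \<Sum>a\<in>{a\<in>F. h a = n}. real (zmult a) * exp (- \<bar>Im a\<bar>))"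
        by (rule sum.image_gen[OF F(1)])
      also have "\<dots> \<le> (\<Sum>n\<in>h ` F. C * (real n + 1) * exp (- real n))"
      proof (rule sum_mono)
        fix n assume "n \<in> h ` F"
        have sub: "{a\<in>F. h a = n} \<subseteq> zero_box n" using F(2) h by (auto simp: zero_box_def)
        have "(\<Sum>a\<in>{a\<in>F. h a = n}. real (zmult a) * exp (- \<bar>Im a\<bar>)) \<le> (\<Sum>a\<in>{a\<in>F. h a = n}. real (zmult a) * exp (- real n))"
          using h by (intro sum_mono mult_left_mono) auto
        also have "\<dots> = (\<Sum>a\<in>{a\<in>F. h a = n}. real (zmult a)) * exp (- real n)" by (simp only: sum_distrib_right)
        also have "\<dots> \<le> (\<Sum>a\<in>zero_box n. real (zmult a)) * exp (- real n)"
          by (intro mult_right_mono sum_mono2 sub finite_zero_box) auto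
        also have "\<dots> \<le> C * (real n + 1) * exp (- real n)" by (intro mult_right_mono C) auto
        finally show "(\<Sum>a\<in>{a\<in>F. h a = n}. real (zmult a) * exp (- \<bar>Im a\<bar>)) \<le> C * (real n + 1) * exp (- real n)" .
      qed
      also have "\<dots> \<le> S" unfolding S_def using sm F(1) C(1) by (intro sum_le_suminf) auto
      finally show ?thesis .
    qed
    thus "\<forall>\<^sub>F F in finite_subsets_at_top {a. zeta_reg a = 0 \<and> Re a \<ge> -1}.
        (\<Sum>a\<in>F. real (zmult a) * exp (- \<bar>Im a\<bar>)) \<le> S"
      by (intro eventually_finite_subsets_at_top_weakI) auto
  qed auto
qed

section \<open>Decay of the Gamma function\<close>

lemma norm_pochhammer: "norm (pochhammer (z::complex) n) = (\<Prod>k<n. norm (z + of_nat k))"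
  by (simp add: pochhammer_prod prod_norm atLeast0LessThan)

text \<open>In Euler's limit |Gamma (x + i t)| / Gamma x is built from the factors (x + k) / |x + k
  + i t|, all increasing in x. Decay on a vertical line is thereby inherited by the lines to its
  left with positive abscissa.\<close>

lemma norm_Gamma_mono:
  assumes "0 < x" "x \<le> y"
  shows "norm (Gamma (Complex x t)) * Gamma y \<le> norm (Gamma (Complex y t)) * Gamma x"
proof (rule LIMSEQ_le)
  show "(\<lambda>n. norm (Gamma_series (Complex x t) n) * Gamma_series y n) \<longlonglongrightarrow> norm (Gamma (Complex x t)) * Gamma y"
    by (intro tendsto_intros)
  show "(\<lambda>n. norm (Gamma_series (Complex y t) n) * Gamma_series x n) \<longlonglongrightarrow> norm (Gamma (Complex y t)) * Gamma x"
    by (intro tendsto_intros)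
  have pos: "norm (Complex u t + of_nat k) > 0" if "u > 0" for u :: real and k
    using that by (auto simp: complex_eq_iff)
  have le: "(\<Prod>k\<le>n. norm (Complex y t + of_nat k)) * pochhammer x (n+1) \<le> (\<Prod>k\<le>n. norm (Complex x t + of_nat k)) * pochhammer y (n+1)" for n
  proof -
    have "norm (Complex y t + of_nat k) * (x + real k) \<le> norm (Complex x t + of_nat k) * (y + real k)" for k
    proof (rule power2_le_imp_le)
      have "(x + real k)\<^sup>2 \<le> (y + real k)\<^sup>2" using assms by (intro power_mono) auto
      hence "t\<^sup>2 * (x + real k)\<^sup>2 \<le> t\<^sup>2 * (y + real k)\<^sup>2" by (intro mult_left_mono) auto
      thus "(norm (Complex y t + of_nat k) * (x + real k))\<^sup>2 \<le> (norm (Complex x t + of_nat k) * (y + real k))\<^sup>2"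
        unfolding power_mult_distrib cmod_power2 by (simp add: algebra_simps)
    qed (use assms in auto)
    hence "(\<Prod>k\<le>n. norm (Complex y t + of_nat k) * (x + real k)) \<le> (\<Prod>k\<le>n. norm (Complex x t + of_nat k) * (y + real k))"
      using assms by (intro prod_mono) auto
    thus ?thesis by (simp add: prod.distrib pochhammer_prod atLeast0LessThan lessThan_Suc_atMost)
  qed
  have eq: "norm (Gamma_series (Complex u t) n) = fact n * exp (u * ln (real n)) / (\<Prod>k\<le>n. norm (Complex u t + of_nat k))" for u n
  proof -
    have "norm (pochhammer (Complex u t) (n+1)) = (\<Prod>k\<le>n. norm (Complex u t + of_nat k))"
      by (simp add: norm_pochhammer lessThan_Suc_atMost del: pochhammer_Suc)
    thus ?thesis unfolding Gamma_series_def by (simp only: norm_divide norm_mult) (simp add: norm_exp_eq_Re)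
  qed
  show "\<exists>N. \<forall>n\<ge>N. norm (Gamma_series (Complex x t) n) * Gamma_series y n \<le> norm (Gamma_series (Complex y t) n) * Gamma_series x n"
  proof (intro exI allI impI)
    fix n :: nat
    define X Y px py where "X = (\<Prod>k\<le>n. norm (Complex x t + of_nat k))" "Y = (\<Prod>k\<le>n. norm (Complex y t + of_nat k))"
      "px = pochhammer x (n+1)" "py = pochhammer y (n+1)"
    have p: "X > 0" "Y > 0" "px > 0" "py > 0"
      unfolding X_Y_px_py_def using assms pos by (auto intro!: prod_pos pochhammer_pos simp del: pochhammer_Suc)
    define A where "A = (fact n * exp (x * ln (real n))) * (fact n * exp (y * ln (real n)))"
    have A: "A \<ge> 0" by (simp add: A_def)
    have "A / (X * py) \<le> A / (Y * px)"
      using p A le[of n] unfolding X_Y_px_py_def[symmetric] by (intro divide_left_mono mult_pos_pos) auto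
    thus "norm (Gamma_series (Complex x t) n) * Gamma_series y n \<le> norm (Gamma_series (Complex y t) n) * Gamma_series x n"
      unfolding eq Gamma_series_def[of x] Gamma_series_def[of y] X_Y_px_py_def[symmetric] A_def by (simp add: mult_ac)
  qed
qed

text \<open>By reflection |Gamma (1/2 + i t)|^2 = pi / cosh (pi t); then pi > 3 gives the exponent
  and 2 pi < 9 the factor.\<close>

lemma norm_Gamma_half: "norm (Gamma (Complex (1/2) t)) \<le> 3 * exp (- (3/2) * \<bar>t\<bar>)"
proof -
  let ?z = "Complex (1/2) t"
  have "1 - ?z = cnj ?z" by (simp add: complex_eq_iff)
  hence "Gamma ?z * cnj (Gamma ?z) = of_real pi / sin (of_real pi * ?z)"
    using Gamma_reflection_complex[of ?z] by (simp add: cnj_Gamma)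
  hence "norm (Gamma ?z * cnj (Gamma ?z)) = norm (of_real pi / sin (of_real pi * ?z))" by simp
  hence eq: "(norm (Gamma ?z))\<^sup>2 = pi / norm (sin (of_real pi * ?z))"
    by (simp add: norm_mult norm_divide power2_eq_square)
  have "sin (of_real pi * ?z) = cos (of_real (pi * t) * \<i>)"
  proof -
    have "of_real pi * ?z = of_real (pi * t) * \<i> + of_real pi / 2" by (simp add: complex_eq_iff)
    thus ?thesis by (simp only: sin_cos_eq) (simp add: cos_diff sin_add cos_add)
  qed
  also have "\<dots> = cosh (of_real (pi * t))" by (simp only: cosh_conv_cos mult.commute)
  also have "\<dots> = of_real (cosh (pi * t))"
    unfolding cosh_field_def by (simp add: exp_minus exp_of_real del: of_real_mult)
  finally have "norm (sin (of_real pi * ?z)) = cosh (pi * t)" by simp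
  moreover have "cosh (pi * t) \<ge> exp (3 * \<bar>t\<bar>) / 2"
  proof -
    have "exp (3 * \<bar>t\<bar>) \<le> exp (pi * \<bar>t\<bar>)" using pi_gt3 by (simp add: mult_right_mono)
    also have "\<dots> \<le> 2 * cosh (pi * \<bar>t\<bar>)" by (simp add: cosh_def)
    also have "cosh (pi * \<bar>t\<bar>) = cosh (pi * t)" by (simp add: abs_if)
    finally show ?thesis by simp
  qed
  ultimately have "(norm (Gamma ?z))\<^sup>2 \<le> pi / (exp (3 * \<bar>t\<bar>) / 2)"
    unfolding eq by (intro divide_left_mono) (auto intro!: mult_pos_pos)
  also have "\<dots> \<le> 9 * exp (- (3 * \<bar>t\<bar>))"
    using pi_less_4 by (simp add: exp_minus field_simps)
  also have "\<dots> = (3 * exp (- (3/2) * \<bar>t\<bar>))\<^sup>2" by (simp add: power_mult_distrib exp_double[symmetric])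
  finally show ?thesis by (rule power2_le_imp_le) simp
qed

lemma norm_Gamma_shift_le:
  fixes s :: complex
  assumes "s \<notin> \<int>\<^sub>\<le>\<^sub>0" "\<And>k. k < n \<Longrightarrow> 0 < c k \<and> c k \<le> norm (s + of_nat k)"
  shows "norm (Gamma s) * (\<Prod>k<n. c k) \<le> norm (Gamma (s + of_nat n))"
proof -
  have "norm (Gamma s) * (\<Prod>k<n. c k) \<le> norm (Gamma s) * norm (pochhammer s n)"
    unfolding norm_pochhammer using assms(2) by (intro mult_left_mono prod_mono) (auto simp: less_imp_le)
  also have "\<dots> = norm (Gamma (s + of_nat n))"
    using assms(1) by (simp add: pochhammer_Gamma norm_divide Gamma_eq_zero_iff)
  finally show ?thesis .
qed

lemma Gamma_decay_left:
  assumes "0 < x" "x \<le> 1/2"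
  shows "norm (Gamma (Complex x t)) \<le> (3 * Gamma x / Gamma (1/2)) * exp (- \<bar>t\<bar>)"
proof -
  have "norm (Gamma (Complex x t)) * Gamma (1/2) \<le> norm (Gamma (Complex (1/2) t)) * Gamma x"
    by (rule norm_Gamma_mono) (use assms in auto)
  also have "\<dots> \<le> 3 * exp (- (3/2) * \<bar>t\<bar>) * Gamma x"
    using norm_Gamma_half[of t] assms by (intro mult_right_mono) auto
  also have "\<dots> \<le> 3 * exp (- \<bar>t\<bar>) * Gamma x" using assms by (intro mult_right_mono mult_left_mono) auto
  finally show ?thesis using Gamma_real_pos[of "1/2"] by (simp add: field_simps)
qed

text \<open>For |Im s| >= 1 shifting to the right multiplies by factors of modulus at least 1, so it
  suffices to bound \<open>Gamma\<close> for 1/2 <= Re s <= 3/2. Monotonicity moves to Re s = 3/2,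
  where the factor |1/2 + i t| <= 2 exp (|t| / 2) lowers the exponent from 3/2 to 1.\<close>

lemma Gamma_decay:
  obtains C where "C > 0" "\<And>s. Re s \<le> 1 \<Longrightarrow> \<bar>Im s\<bar> \<ge> 1 \<Longrightarrow> norm (Gamma s) \<le> C * exp (- \<bar>Im s\<bar>)"
proof -
  have "continuous_on {1/2..3/2::real} Gamma"
    by (intro continuous_on_Gamma) auto
  hence "bounded (Gamma ` {1/2..3/2::real})"
    by (intro compact_imp_bounded compact_continuous_image) auto
  then obtain M where M: "M > 0" "\<And>x::real. 1/2 \<le> x \<Longrightarrow> x \<le> 3/2 \<Longrightarrow> \<bar>Gamma x\<bar> \<le> M"
    by (force simp: bounded_pos)
  define G where "G = (Gamma (3/2) :: real)"
  have G: "G > 0" unfolding G_def by simp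
  show ?thesis
  proof (rule that[of "6 * M / G"])
    show "6 * M / G > 0" using M G by simp
    fix s assume s: "Re s \<le> 1" "\<bar>Im s\<bar> \<ge> 1"
    define t where "t = Im s"
    define n where "n = nat \<lceil>1/2 - Re s\<rceil>"
    define x where "x = Re s + real n"
    have x: "1/2 \<le> x" "x \<le> 3/2" unfolding x_def n_def using s(1) by linarith+
    have sn: "s + of_nat n = Complex x t" by (simp add: complex_eq_iff x_def t_def)
    have "s \<notin> \<int>\<^sub>\<le>\<^sub>0" using s(2) by (auto simp: nonpos_Ints_def)
    hence "norm (Gamma s) * (\<Prod>k<n. 1) \<le> norm (Gamma (s + of_nat n))"
    proof (rule norm_Gamma_shift_le)
      fix k
      show "0 < (1::real) \<and> 1 \<le> norm (s + of_nat k)" using s(2) abs_Im_le_cmod[of "s + of_nat k"] by simp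
    qed
    hence "norm (Gamma s) * G \<le> norm (Gamma (Complex x t)) * G" using G sn by simp
    also have "\<dots> \<le> norm (Gamma (Complex (3/2) t)) * Gamma x"
      unfolding G_def by (rule norm_Gamma_mono) (use x in auto)
    also have "\<dots> \<le> norm (Gamma (Complex (3/2) t)) * M" using M(2)[OF x] by (intro mult_left_mono) auto
    also have "Gamma (Complex (3/2) t) = Complex (1/2) t * Gamma (Complex (1/2) t)"
    proof -
      have "Complex (1/2) t \<notin> \<int>\<^sub>\<le>\<^sub>0"
      proof
        assume "Complex (1/2) t \<in> \<int>\<^sub>\<le>\<^sub>0"
        then obtain n where n: "Complex (1/2) t = of_int n" "n \<le> 0" by (auto simp: nonpos_Ints_def)
        hence "1/2 = real_of_int n" by (simp add: complex_eq_iff)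
        thus False using n(2) by linarith
      qed
      moreover have "Complex (3/2) t = Complex (1/2) t + 1" by (simp add: complex_eq_iff)
      ultimately show ?thesis by (simp add: Gamma_plus1)
    qed
    also have "norm (Complex (1/2) t * Gamma (Complex (1/2) t)) \<le> (2 * exp (\<bar>t\<bar> / 2)) * (3 * exp (- (3/2) * \<bar>t\<bar>))"
      unfolding norm_mult
    proof (intro mult_mono norm_Gamma_half)
      have "norm (Complex (1/2) t) \<le> 1/2 + \<bar>t\<bar>" using cmod_le[of "Complex (1/2) t"] by simp
      also have "\<dots> \<le> 2 * exp (\<bar>t\<bar> / 2)" using exp_ge_add_one_self[of "\<bar>t\<bar> / 2"] by linarith
      finally show "norm (Complex (1/2) t) \<le> 2 * exp (\<bar>t\<bar> / 2)" .
    qed auto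
    also have "\<dots> = 6 * exp (- \<bar>t\<bar>)" by (simp add: mult_exp_exp)
    finally have "norm (Gamma s) * G \<le> 6 * exp (- \<bar>t\<bar>) * M" using M by simp
    thus "norm (Gamma s) \<le> 6 * M / G * exp (- \<bar>Im s\<bar>)" using G by (simp add: t_def field_simps)
  qed
qed

text \<open>N + 1 steps lead to Re s = 1/2; the factors have moduli at least N + 1/2, N - 1/2, ...,
  1/2, with product at least N! / 2. This factorial later defeats x^(N + 1/2).\<close>

lemma Gamma_half_line:
  "norm (Gamma (Complex (- real N - 1/2) t)) \<le> 6 / fact N * exp (- \<bar>t\<bar>)"
proof -
  let ?s = "Complex (- real N - 1/2) t"
  have Ns: "?s \<notin> \<int>\<^sub>\<le>\<^sub>0"
  proof
    assume "?s \<in> \<int>\<^sub>\<le>\<^sub>0"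
    then obtain m where "?s = of_int m" by (auto simp: nonpos_Ints_def)
    hence "of_int m = - real N - 1/2" by (simp add: complex_eq_iff)
    hence "2 * m = - 2 * int N - 1" by linarith
    thus False by presburger
  qed
  have "norm (Gamma ?s) * (\<Prod>k<Suc N. real (N - k) + 1/2) \<le> norm (Gamma (?s + of_nat (Suc N)))"
  proof (rule norm_Gamma_shift_le[OF Ns])
    fix k assume "k < Suc N"
    hence "real (N - k) + 1/2 = \<bar>Re (?s + of_nat k)\<bar>" by (simp add: of_nat_diff)
    thus "0 < real (N - k) + 1/2 \<and> real (N - k) + 1/2 \<le> norm (?s + of_nat k)"
      using abs_Re_le_cmod[of "?s + of_nat k"] by simp
  qed
  also have "?s + of_nat (Suc N) = Complex (1/2) t" by (simp add: complex_eq_iff)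
  also have "(\<Prod>k<Suc N. real (N - k) + 1/2) = (\<Prod>k\<le>N. real k + 1/2)"
    unfolding lessThan_Suc_atMost by (rule prod.reindex_bij_witness[of _ "\<lambda>k. N - k" "\<lambda>k. N - k"]) auto
  finally have 1: "norm (Gamma ?s) * (\<Prod>k\<le>N. real k + 1/2) \<le> norm (Gamma (Complex (1/2) t))" .
  have "fact N / 2 \<le> (\<Prod>k\<le>N. real k + 1/2)"
  proof (induction N)
    case (Suc N)
    have "fact (Suc N) / 2 = fact N / 2 * real (Suc N)" by simp
    also have "\<dots> \<le> (\<Prod>k\<le>N. real k + 1/2) * (real (Suc N) + 1/2)"
      by (intro mult_mono Suc.IH) (auto intro!: prod_nonneg)
    finally show ?case by simp
  qed auto
  hence "norm (Gamma ?s) * (fact N / 2) \<le> norm (Gamma ?s) * (\<Prod>k\<le>N. real k + 1/2)" by (intro mult_left_mono) auto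
  also note 1
  also have "norm (Gamma (Complex (1/2) t)) \<le> 3 * exp (- (3/2) * \<bar>t\<bar>)" by (rule norm_Gamma_half)
  also have "\<dots> \<le> 3 * exp (- \<bar>t\<bar>)" by auto
  finally show ?thesis by (simp add: field_simps)
qed

lemma Gamma_uminus_residue_limit:
  "((\<lambda>s. Gamma (- s) * (s - of_nat k)) \<longlongrightarrow> - ((-1) ^ k / fact k)) (at (of_nat k :: complex))"
proof -
  have "filterlim uminus (at (- of_nat k)) (at (of_nat k :: complex))"
    unfolding filterlim_at by (auto intro!: tendsto_intros simp: eventually_at_filter)
  from filterlim_compose[OF Gamma_residues[of k] this]
  have "((\<lambda>s. Gamma (- s) * (- s + of_nat k)) \<longlongrightarrow> (-1) ^ k / fact k) (at (of_nat k :: complex))" .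
  hence "((\<lambda>s. - (Gamma (- s) * (- s + of_nat k))) \<longlongrightarrow> - ((-1) ^ k / fact k)) (at (of_nat k :: complex))"
    by (rule tendsto_minus)
  thus ?thesis by (simp add: algebra_simps)
qed

section \<open>Integrals along vertical edges\<close>

text \<open>The majorant integrates to 2 K arctan T, at most pi K, hence a bound independent of the
  height.\<close>

lemma vertical_contour_bound:
  assumes cont: "continuous_on (closed_segment (Complex c (-T)) (Complex c T)) f" and T: "T \<ge> 0"
    and le: "\<And>t. \<bar>t\<bar> \<le> T \<Longrightarrow> norm (f (Complex c t)) \<le> K / (1 + t\<^sup>2)" and K: "K \<ge> 0"
  shows "norm (contour_integral (linepath (Complex c (-T)) (Complex c T)) f) \<le> 4 * K"
proof -
  define g where "g = (\<lambda>x. K / (1 + (- T + 2 * T * x)\<^sup>2) * (2 * T))"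
  have lp: "linepath (Complex c (-T)) (Complex c T) x = Complex c (- T + 2 * T * x)" for x
    by (simp add: linepath_def complex_eq_iff algebra_simps)
  have hg: "(g has_integral (K * arctan (- T + 2 * T * 1) - K * arctan (- T + 2 * T * 0))) {0..1}"
  proof (rule fundamental_theorem_of_calculus)
    show "((\<lambda>x. K * arctan (- T + 2 * T * x)) has_vector_derivative g x) (at x within {0..1})" for x
      unfolding has_real_derivative_iff_has_vector_derivative[symmetric] g_def
      by (rule derivative_eq_intros refl)+ (simp add: inverse_eq_divide add_nonneg_eq_0_iff)
  qed auto
  have ci: "f contour_integrable_on linepath (Complex c (-T)) (Complex c T)"
    by (rule contour_integrable_continuous_linepath[OF cont])
  have fi: "(\<lambda>x. f (linepath (Complex c (-T)) (Complex c T) x) * (Complex c T - Complex c (-T))) integrable_on {0..1}"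
    using ci by (simp add: contour_integrable_on)
  have "norm (integral {0..1} (\<lambda>x. f (linepath (Complex c (-T)) (Complex c T) x) * (Complex c T - Complex c (-T)))) \<le> integral {0..1} g"
  proof (rule integral_norm_bound_integral[OF fi])
    show "g integrable_on {0..1}" using hg by blast
    fix x :: real assume x: "x \<in> {0..1}"
    have "\<bar>- T + 2 * T * x\<bar> \<le> T"
    proof -
      have "T * x \<le> T * 1" using x T by (intro mult_left_mono) auto
      moreover have "T * x \<ge> 0" using x T by simp
      ultimately show ?thesis by (simp add: abs_le_iff)
    qed
    from le[OF this] have "norm (f (Complex c (- T + 2 * T * x))) \<le> K / (1 + (- T + 2 * T * x)\<^sup>2)" .
    moreover have "norm (Complex c T - Complex c (-T)) = 2 * T"
    proof -
      have "Complex c T - Complex c (-T) = of_real (2 * T) * \<i>" by (simp add: complex_eq_iff)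
      thus ?thesis using T by (simp add: norm_mult)
    qed
    ultimately show "norm (f (linepath (Complex c (-T)) (Complex c T) x) * (Complex c T - Complex c (-T))) \<le> g x"
      unfolding lp norm_mult g_def using T K by (intro mult_mono) auto
  qed
  also have "contour_integral (linepath (Complex c (-T)) (Complex c T)) f = integral {0..1} (\<lambda>x. f (linepath (Complex c (-T)) (Complex c T) x) * (Complex c T - Complex c (-T)))"
    by (simp add: contour_integral_integral)
  hence "integral {0..1} (\<lambda>x. f (linepath (Complex c (-T)) (Complex c T) x) * (Complex c T - Complex c (-T))) = contour_integral (linepath (Complex c (-T)) (Complex c T)) f" by simp
  also have "integral {0..1} g = K * (2 * arctan T)" using hg by (simp add: integral_unique arctan_minus)
  also have "\<dots> \<le> K * 4"
    using arctan_ubound[of T] pi_less_4 K by (intro mult_left_mono) auto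
  finally show ?thesis by simp
qed

text \<open>From the Taylor term of order 6 of exp (1 + u), hence 720 = 6!. The exponent 4 is that
  of the logarithmic derivative on the left line.\<close>

lemma exp_minus_le_inverse_square:
  assumes "u \<ge> (0::real)"
  shows "(1 + u) ^ 4 * exp (- u) \<le> (720 * exp 1) / (1 + u\<^sup>2)"
proof -
  have "(1 + u) ^ 6 / fact 6 \<le> exp (1 + u)"
  proof -
    have "(\<Sum>k\<in>{6}. (1 + u) ^ k /\<^sub>R fact k) \<le> exp (1 + u)"
      unfolding exp_def by (rule sum_le_suminf[OF summable_exp_generic]) (use assms in auto)
    thus ?thesis by (simp add: divide_inverse mult.commute)
  qed
  hence 1: "(1 + u) ^ 6 \<le> 720 * exp 1 * exp u" by (simp add: fact_numeral exp_add)
  have "(1 + u) ^ 4 * (1 + u\<^sup>2) \<le> (1 + u) ^ 4 * (1 + u) ^ 2"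
    using assms by (intro mult_left_mono) (auto simp: power2_eq_square algebra_simps)
  also have "\<dots> = (1 + u) ^ 6" by (simp add: power_add[symmetric])
  also note 1
  finally have "(1 + u) ^ 4 * (1 + u\<^sup>2) * exp (- u) \<le> 720 * exp 1 * exp u * exp (- u)" by (intro mult_right_mono) auto
  also have "\<dots> = 720 * exp 1" by (simp add: exp_minus)
  finally have "(1 + u) ^ 4 * exp (- u) * (1 + u\<^sup>2) \<le> 720 * exp 1" by (simp only: mult_ac)
  thus ?thesis by (simp add: pos_le_divide_eq add_pos_nonneg)
qed

section \<open>Residues and the contour integral\<close>

text \<open>This is -zeta'/zeta with its pole at 1 made explicit.\<close>

definition zeta_nlogderiv :: "complex \<Rightarrow> complex" where
  "zeta_nlogderiv s = 1 / (s - 1) - deriv zeta_reg s / zeta_reg s"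

definition integrand :: "real \<Rightarrow> complex \<Rightarrow> complex" where
  "integrand x s = Gamma (- s) * of_real x powr s * zeta_nlogderiv s"

definition poles :: "complex set" where
  "poles = \<nat> \<union> {a. zeta_reg a = 0}"

lemma deriv_zeta_reg_hol: "deriv zeta_reg holomorphic_on A"
  using holomorphic_deriv[OF zeta_reg_entire] holomorphic_on_subset by blast

lemma zeta_reg_hol: "zeta_reg holomorphic_on A"
  using zeta_reg_entire holomorphic_on_subset by blast

text \<open>This makes the poles coming from \<open>Gamma\<close> disjoint from those at the
  zeros.\<close>

lemma zeta_reg_nonzero_Nats: "z \<in> \<nat> \<Longrightarrow> zeta_reg z \<noteq> 0"
proof -
  assume "z \<in> \<nat>"
  then obtain k :: nat where k: "z = of_nat k" by (auto elim: Nats_cases)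
  consider "k = 0" | "k = 1" | "k \<ge> 2" by linarith
  thus ?thesis
    unfolding k by cases (auto simp: zeta_reg_0 zeta_reg_nonzero_right)
qed

lemma finite_poles: "finite (poles \<inter> ball c r)"
proof -
  obtain M :: nat where M: "real M > norm c + r" using reals_Archimedean2 by blast
  have "\<nat> \<inter> ball c r \<subseteq> of_nat ` {..M}"
  proof
    fix z assume z: "z \<in> \<nat> \<inter> ball c r"
    then obtain k where k: "z = of_nat k" by (auto elim: Nats_cases)
    have "norm z < norm c + r" using z norm_triangle_sub[of z c] by (simp add: dist_norm norm_minus_commute)
    thus "z \<in> of_nat ` {..M}" using k M by simp
  qed
  hence "finite (\<nat> \<inter> ball c r)" by (rule finite_subset) simp
  moreover have "finite ({a. zeta_reg a = 0} \<inter> ball c r)"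
    using finite_zeta_reg_zeros[of "ball c r"] by (simp add: Int_def conj_commute)
  ultimately show ?thesis by (simp add: poles_def Int_Un_distrib2)
qed

lemma integrand_holomorphic:
  assumes "x > 0" "A \<inter> poles = {}"
  shows "integrand x holomorphic_on A"
proof -
  have 1: "- s \<notin> \<int>\<^sub>\<le>\<^sub>0" "s \<noteq> 1" "zeta_reg s \<noteq> 0" if "s \<in> A" for s
    using that assms(2) by (auto simp: poles_def uminus_in_nonpos_Ints_iff)
  show ?thesis
    unfolding integrand_def[abs_def] zeta_nlogderiv_def
    by (intro holomorphic_intros deriv_zeta_reg_hol zeta_reg_hol) (use 1 assms in auto)
qed

lemma pole_isolated:
  obtains S where "open S" "p \<in> S" "(S - {p}) \<inter> poles = {}"
proof (rule that[of "ball p 1 - (poles \<inter> ball p 1 - {p})"])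
  show "open (ball p 1 - (poles \<inter> ball p 1 - {p}))"
    by (intro open_Diff finite_imp_closed finite_Diff finite_poles) auto
qed auto

lemma residue_integrand_simple:
  assumes x: "x > 0" and lim: "((\<lambda>s. integrand x s * (s - p)) \<longlongrightarrow> c) (at p)"
  shows "residue (integrand x) p = c"
proof -
  obtain S where S: "open S" "p \<in> S" "(S - {p}) \<inter> poles = {}" using pole_isolated .
  show ?thesis by (rule residue_simple'[OF S(1,2) integrand_holomorphic[OF x S(3)] lim])
qed

lemma isCont_zeta_reg: "isCont zeta_reg s" "isCont (deriv zeta_reg) s"
  using zeta_reg_hol[of UNIV] deriv_zeta_reg_hol[of UNIV]
  by (auto intro!: continuous_on_interior[of UNIV] holomorphic_on_imp_continuous_on)

lemma isCont_powr_right: "x > 0 \<Longrightarrow> isCont (\<lambda>s. of_real x powr s :: complex) s"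
  by (intro continuous_intros) auto

lemma residue_integrand_nat:
  assumes x: "x > 0" and k: "k \<noteq> 1"
  shows "residue (integrand x) (of_nat k) = - ((-1) ^ k / fact k) * of_real x powr of_nat k * zeta_nlogderiv (of_nat k)"
proof (rule residue_integrand_simple[OF x])
  have nz: "zeta_reg (of_nat k) \<noteq> 0" by (rule zeta_reg_nonzero_Nats) auto
  have ne: "(of_nat k :: complex) \<noteq> 1" using k by (metis of_nat_1 of_nat_eq_iff)
  have "isCont zeta_nlogderiv (of_nat k)"
    unfolding zeta_nlogderiv_def[abs_def] using nz ne
    by (intro continuous_intros isCont_zeta_reg) auto
  hence "((\<lambda>s. Gamma (- s) * (s - of_nat k) * (of_real x powr s) * zeta_nlogderiv s) \<longlongrightarrow>
      - ((-1) ^ k / fact k) * of_real x powr of_nat k * zeta_nlogderiv (of_nat k)) (at (of_nat k))"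
    using isCont_powr_right[OF x, of "of_nat k"]
    by (intro tendsto_mult Gamma_uminus_residue_limit) (auto simp: isCont_def)
  thus "((\<lambda>s. integrand x s * (s - of_nat k)) \<longlongrightarrow>
      - ((-1) ^ k / fact k) * of_real x powr of_nat k * zeta_nlogderiv (of_nat k)) (at (of_nat k))"
    by (simp add: integrand_def mult_ac)
qed

lemma residue_integrand_zero:
  assumes x: "x > 0" and z: "zeta_reg p = 0"
  shows "residue (integrand x) p = - (of_nat (zmult p) * (of_real x powr p * Gamma (- p)))"
proof (rule residue_integrand_simple[OF x])
  have pN: "p \<notin> \<nat>" using z zeta_reg_nonzero_Nats by blast
  hence ne: "p \<noteq> 1" by auto
  have "isCont (\<lambda>s. Gamma (- s)) p"
    using pN by (intro continuous_intros) (auto simp: uminus_in_nonpos_Ints_iff)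
  hence t1: "((\<lambda>s. Gamma (- s)) \<longlongrightarrow> Gamma (- p)) (at p)" by (simp add: isCont_def)
  have t2: "((\<lambda>s. of_real x powr s) \<longlongrightarrow> of_real x powr p) (at p)"
    using isCont_powr_right[OF x, of p] by (simp add: isCont_def)
  have t3: "((\<lambda>s. (s - p) / (s - 1)) \<longlongrightarrow> (p - p) / (p - 1)) (at p)"
    using ne by (intro tendsto_intros) auto
  note t4 = tendsto_log_deriv[OF zeta_reg_entire zeta_reg_2_nonzero, of p]
  have "((\<lambda>s. Gamma (- s) * (of_real x powr s) * ((s - p) / (s - 1) - (s - p) * (deriv zeta_reg s / zeta_reg s))) \<longlongrightarrow>
      Gamma (- p) * of_real x powr p * ((p - p) / (p - 1) - of_nat (zmult p))) (at p)"
    by (intro tendsto_mult[OF tendsto_mult[OF t1 t2] tendsto_diff[OF t3 t4]])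
  thus "((\<lambda>s. integrand x s * (s - p)) \<longlongrightarrow> - (of_nat (zmult p) * (of_real x powr p * Gamma (- p)))) (at p)"
    by (simp add: integrand_def zeta_nlogderiv_def algebra_simps)
qed

text \<open>Two applications of the functional equation of \<open>Gamma\<close> write the integrand
  as H s / (s - 1)^2, so that the residue is H' 1. Euler's constant enters with opposite signs from
  Gamma (2 - s) and from the logarithmic derivative; the -x comes from 1 / s.\<close>

lemma residue_integrand_1:
  assumes x: "x > 0"
  shows "residue (integrand x) 1 = of_real (x * ln x - x)"
proof -
  obtain r0 where r0: "r0 > 0" "\<And>s. dist 1 s < r0 \<Longrightarrow> zeta_reg s \<noteq> 0"
    using continuous_at_avoid[OF isCont_zeta_reg(1)[of 1], of 0] by auto
  define r where "r = min r0 (1/2)"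
  have r: "r > 0" "r \<le> r0" "r \<le> 1/2" using r0(1) by (auto simp: r_def)
  define B where "B = ball (1::complex) r"
  have B: "zeta_reg s \<noteq> 0" "1/2 < Re s" "Re s < 3/2" if "s \<in> B" for s
  proof -
    have "\<bar>Re (1 - s)\<bar> < 1/2" using that abs_Re_le_cmod[of "1 - s"] r by (simp add: B_def dist_norm)
    thus "1/2 < Re s" "Re s < 3/2" unfolding abs_less_iff by auto
    show "zeta_reg s \<noteq> 0" using r0(2)[of s] that r by (simp add: B_def)
  qed
  have nn: "2 - s \<notin> \<int>\<^sub>\<le>\<^sub>0" "s \<noteq> 0" if "s \<in> B" for s
    using B(2,3)[OF that] by (auto simp: nonpos_Ints_def complex_eq_iff)
  define H where "H = (\<lambda>s. Gamma (2 - s) / s * of_real x powr s * (1 - (s - 1) * (deriv zeta_reg s / zeta_reg s)))"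
  have Hhol: "H holomorphic_on B"
    unfolding H_def by (intro holomorphic_intros deriv_zeta_reg_hol zeta_reg_hol) (use B nn x in auto)
  have "residue (\<lambda>s. H s / (s - 1) ^ Suc 1) 1 = (deriv ^^ 1) H 1 / fact 1"
    by (rule residue_holomorphic_over_power[OF _ _ Hhol]) (use r in \<open>auto simp: B_def\<close>)
  also have "residue (\<lambda>s. H s / (s - 1) ^ Suc 1) 1 = residue (integrand x) 1"
  proof (rule residue_cong)
    have "eventually (\<lambda>s. s \<in> B - {1}) (at 1)"
      using r by (auto simp: B_def eventually_at intro!: exI[of _ r] simp: dist_commute)
    thus "eventually (\<lambda>s. H s / (s - 1) ^ Suc 1 = integrand x s) (at 1)"
    proof eventually_elim
      case (elim s)
      have s: "s \<noteq> 0" "s \<noteq> 1" using elim nn by auto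
      have n1: "- s \<notin> \<int>\<^sub>\<le>\<^sub>0"
      proof
        assume "- s \<in> \<int>\<^sub>\<le>\<^sub>0"
        then obtain n where n: "- s = of_int n" by (auto simp: nonpos_Ints_def)
        hence sn: "s = of_int (- n)" by (metis add.inverse_inverse of_int_minus)
        hence "Re s = of_int (- n)" by simp
        moreover have "1/2 < Re s" "Re s < 3/2" using B(2,3)[of s] elim by auto
        ultimately have "- n = 1" by linarith
        thus False using sn s by simp
      qed
      have n2: "- s + 1 \<notin> \<int>\<^sub>\<le>\<^sub>0" using n1 plus_one_in_nonpos_Ints_imp by blast
      have "Gamma (2 - s) = (1 - s) * Gamma (- s + 1)" using Gamma_plus1[OF n2] by (simp add: add_ac)
      also have "Gamma (- s + 1) = - s * Gamma (- s)" by (rule Gamma_plus1[OF n1])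
      finally have G: "Gamma (2 - s) = (s - 1) * s * Gamma (- s)" by (simp add: algebra_simps)
      have "zeta_nlogderiv s = (1 - (s - 1) * (deriv zeta_reg s / zeta_reg s)) / (s - 1)"
        using s by (simp add: zeta_nlogderiv_def diff_divide_distrib)
      thus ?case using s by (simp add: H_def G integrand_def power2_eq_square)
    qed
  qed auto
  finally have res: "residue (integrand x) 1 = deriv H 1" by simp
  have d1: "((\<lambda>s. Gamma (2 - s)) has_field_derivative - (Gamma 1 * Digamma (1::complex))) (at 1)"
    by (rule derivative_eq_intros refl | simp)+
  have d2: "((\<lambda>s. of_real x powr s) has_field_derivative (of_real x * of_real (ln x))) (at (1::complex))"
  proof -
    have "((\<lambda>s. of_real x powr s) has_field_derivative (Ln (of_real x) * of_real x powr 1)) (at (1::complex))"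
      using x by (intro has_field_derivative_powr_right) auto
    thus ?thesis using x by (simp add: Ln_of_real mult.commute)
  qed
  define q where "q = (\<lambda>s. deriv zeta_reg s / zeta_reg s)"
  have "q holomorphic_on B"
    unfolding q_def by (intro holomorphic_intros deriv_zeta_reg_hol zeta_reg_hol) (use B in auto)
  hence d3: "(q has_field_derivative deriv q 1) (at 1)"
    using r by (intro holomorphic_derivI[of q B]) (auto simp: B_def)
  have d1': "((\<lambda>s. Gamma (2 - s) / s) has_field_derivative (euler_mascheroni - 1)) (at (1::complex))"
    using DERIV_divide[OF d1 DERIV_ident] by simp
  have d4: "((\<lambda>s. 1 - (s - 1) * q s) has_field_derivative (- euler_mascheroni)) (at 1)"
    using DERIV_diff[OF DERIV_const DERIV_mult[OF DERIV_diff[OF DERIV_ident DERIV_const] d3], of 1 1]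
    by (simp add: q_def deriv_zeta_reg_1)
  have "H = (\<lambda>s. Gamma (2 - s) / s * of_real x powr s * (1 - (s - 1) * q s))"
    by (simp add: H_def q_def fun_eq_iff)
  with DERIV_mult[OF DERIV_mult[OF d1' d2] d4]
  have "(H has_field_derivative of_real (x * ln x - x)) (at 1)"
    using x by (simp add: algebra_simps)
  thus ?thesis using res by (simp add: DERIV_imp_deriv)
qed

lemma contour_integral_integrand:
  assumes x: "x > 0" and T: "T > 0" and a: "-1 < a" "a < 0" and N: "N \<ge> 1"
    and avoid: "path_image (rectpath (Complex a (-T)) (Complex (real N + 1/2) T)) \<inter> poles = {}"
  shows "contour_integral (rectpath (Complex a (-T)) (Complex (real N + 1/2) T)) (integrand x) =
     2 * pi * \<i> * ((\<Sum>k\<le>N. residue (integrand x) (of_nat k)) +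
       (\<Sum>p | zeta_reg p = 0 \<and> a < Re p \<and> \<bar>Im p\<bar> < T. residue (integrand x) p))"
proof -
  define g where "g = rectpath (Complex a (-T)) (Complex (real N + 1/2) T)"
  define R where "R = 3 + real N + T"
  define S where "S = ball (0::complex) R"
  define pts where "pts = poles \<inter> S"
  define bx where "bx = box (Complex a (-T)) (Complex (real N + 1/2) T)"
  define cbx where "cbx = cbox (Complex a (-T)) (Complex (real N + 1/2) T)"
  have le: "Re (Complex a (-T)) \<le> Re (Complex (real N + 1/2) T)" "Im (Complex a (-T)) \<le> Im (Complex (real N + 1/2) T)"
    using a T by auto
  have pimg: "path_image g = cbx - bx" unfolding g_def cbx_def bx_def by (rule path_image_rectpath_cbox_minus_box[OF le])
  have cbxS: "cbx \<subseteq> S"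
  proof
    fix z assume "z \<in> cbx"
    hence z: "a \<le> Re z" "Re z \<le> real N + 1/2" "\<bar>Im z\<bar> \<le> T" by (auto simp: cbx_def in_cbox_complex_iff abs_le_iff)
    have "norm z \<le> \<bar>Re z\<bar> + \<bar>Im z\<bar>" by (rule cmod_le)
    also have "\<dots> < R" using z a by (auto simp: R_def)
    finally show "z \<in> S" by (simp add: S_def)
  qed
  have fin: "finite pts" unfolding pts_def S_def by (rule finite_poles)
  have bxcbx: "bx \<subseteq> cbx" unfolding bx_def cbx_def by (rule box_subset_cbox)
  have "contour_integral g (integrand x) = 2 * pi * \<i> * (\<Sum>p\<in>pts. winding_number g p * residue (integrand x) p)"
  proof (rule Residue_theorem)
    show "integrand x holomorphic_on S - pts" by (rule integrand_holomorphic[OF x]) (auto simp: pts_def)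
    show "path_image g \<subseteq> S - pts" using avoid cbxS pimg unfolding g_def[symmetric] pts_def by auto
    show "\<forall>z. z \<notin> S \<longrightarrow> winding_number g z = 0"
    proof safe
      fix z assume "z \<notin> S"
      thus "winding_number g z = 0"
        by (intro winding_number_zero_outside[of g S]) (use pimg cbxS in \<open>auto simp: g_def S_def\<close>)
    qed
  qed (use fin in \<open>auto simp: S_def g_def\<close>)
  also have "(\<Sum>p\<in>pts. winding_number g p * residue (integrand x) p) = (\<Sum>p\<in>poles \<inter> bx. residue (integrand x) p)"
  proof (rule sum.mono_neutral_cong_right[OF fin])
    show "poles \<inter> bx \<subseteq> pts" using bxcbx cbxS by (auto simp: pts_def)
    show "\<forall>p\<in>pts - poles \<inter> bx. winding_number g p * residue (integrand x) p = 0"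
    proof
      fix p assume p: "p \<in> pts - poles \<inter> bx"
      hence "p \<notin> cbx" using avoid pimg by (auto simp: pts_def g_def[symmetric])
      hence "winding_number g p = 0"
        by (intro winding_number_zero_outside[of g cbx]) (use pimg in \<open>auto simp: g_def cbx_def\<close>)
      thus "winding_number g p * residue (integrand x) p = 0" by simp
    qed
    show "winding_number g p * residue (integrand x) p = residue (integrand x) p" if "p \<in> poles \<inter> bx" for p
      using that unfolding g_def bx_def by (simp add: winding_number_rectpath)
  qed
  \<comment> \<open>The right edge imposes no condition on the zeros, since their real parts are
    less than 1 <= N.\<close>
  also have "poles \<inter> bx = of_nat ` {..N} \<union> {p. zeta_reg p = 0 \<and> a < Re p \<and> \<bar>Im p\<bar> < T}"
  proof (intro equalityI subsetI)
    fix p assume p: "p \<in> poles \<inter> bx"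
    show "p \<in> of_nat ` {..N} \<union> {p. zeta_reg p = 0 \<and> a < Re p \<and> \<bar>Im p\<bar> < T}"
    proof (cases "p \<in> \<nat>")
      case True
      then obtain k where k: "p = of_nat k" by (auto elim: Nats_cases)
      hence "real k < real N + 1/2" using p by (auto simp: bx_def in_box_complex_iff)
      hence "k \<le> N" by linarith
      thus ?thesis using k by auto
    next
      case False
      thus ?thesis using p by (auto simp: poles_def bx_def in_box_complex_iff)
    qed
  next
    fix p assume "p \<in> of_nat ` {..N} \<union> {p. zeta_reg p = 0 \<and> a < Re p \<and> \<bar>Im p\<bar> < T}"
    thus "p \<in> poles \<inter> bx"
    proof
      assume "p \<in> of_nat ` {..N}"
      then obtain k where k: "p = of_nat k" "k \<le> N" by auto
      have "real k \<le> real N" using k(2) by simp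
      thus ?thesis using k(1) a T by (auto simp: poles_def bx_def in_box_complex_iff intro: less_le_trans[of a 0])
    next
      assume "p \<in> {p. zeta_reg p = 0 \<and> a < Re p \<and> \<bar>Im p\<bar> < T}"
      moreover from this have "Re p < 1" using zero_Re_less_1[of p] by auto
      moreover have "real N \<ge> 1" using N by simp
      ultimately show ?thesis by (auto simp: poles_def bx_def in_box_complex_iff abs_less_iff)
    qed
  qed
  also have "(\<Sum>p\<in>of_nat ` {..N} \<union> {p. zeta_reg p = 0 \<and> a < Re p \<and> \<bar>Im p\<bar> < T}. residue (integrand x) p) =
     (\<Sum>p\<in>of_nat ` {..N}. residue (integrand x) p) + (\<Sum>p | zeta_reg p = 0 \<and> a < Re p \<and> \<bar>Im p\<bar> < T. residue (integrand x) p)"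
  proof (rule sum.union_disjoint)
    have "{p. zeta_reg p = 0 \<and> a < Re p \<and> \<bar>Im p\<bar> < T} \<subseteq> pts"
    proof
      fix p assume p: "p \<in> {p. zeta_reg p = 0 \<and> a < Re p \<and> \<bar>Im p\<bar> < T}"
      have "norm p \<le> \<bar>Re p\<bar> + \<bar>Im p\<bar>" by (rule cmod_le)
      also have "\<dots> < R" using p a zero_Re_less_1[of p] by (auto simp: R_def)
      finally show "p \<in> pts" using p by (simp add: pts_def S_def poles_def)
    qed
    thus "finite {p. zeta_reg p = 0 \<and> a < Re p \<and> \<bar>Im p\<bar> < T}" using fin by (rule finite_subset)
    show "of_nat ` {..N} \<inter> {p. zeta_reg p = 0 \<and> a < Re p \<and> \<bar>Im p\<bar> < T} = {}"
      using zeta_reg_nonzero_Nats by auto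
  qed auto
  also have "(\<Sum>p\<in>of_nat ` {..N}. residue (integrand x) p) = (\<Sum>k\<le>N. residue (integrand x) (of_nat k))"
    by (subst sum.reindex) (auto simp: inj_on_def)
  finally show ?thesis by (simp add: g_def)
qed

text \<open>The vertical edges grow with T and therefore need an integrable majorant; for the
  horizontal ones the supremum H is enough.\<close>

lemma norm_rectpath_integral_le:
  assumes cont: "continuous_on (path_image (rectpath (Complex a (-T)) (Complex b T))) f"
    and ab: "a \<le> b" and T: "T \<ge> 0"
    and top: "\<And>s. a \<le> Re s \<Longrightarrow> Re s \<le> b \<Longrightarrow> \<bar>Im s\<bar> = T \<Longrightarrow> norm (f s) \<le> H" and H: "H \<ge> 0"
    and left: "\<And>t. \<bar>t\<bar> \<le> T \<Longrightarrow> norm (f (Complex a t)) \<le> K1 / (1 + t\<^sup>2)" and K1: "K1 \<ge> 0"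
    and right: "\<And>t. \<bar>t\<bar> \<le> T \<Longrightarrow> norm (f (Complex b t)) \<le> K2 / (1 + t\<^sup>2)" and K2: "K2 \<ge> 0"
  shows "norm (contour_integral (rectpath (Complex a (-T)) (Complex b T)) f) \<le> 4 * K1 + 4 * K2 + 2 * H * (b - a)"
proof -
  define a1 a2 a3 a4 where "a1 = Complex a (-T)" "a2 = Complex b (-T)" "a3 = Complex b T" "a4 = Complex a T"
  note defs = a1_a2_a3_a4_def
  have rp: "rectpath a1 a3 = linepath a1 a2 +++ linepath a2 a3 +++ linepath a3 a4 +++ linepath a4 a1"
    by (simp add: rectpath_def Let_def defs)
  have pi: "path_image (rectpath a1 a3) = closed_segment a1 a2 \<union> closed_segment a2 a3 \<union> closed_segment a3 a4 \<union> closed_segment a4 a1"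
    unfolding rp by (simp add: path_image_join Un_assoc)
  have c: "continuous_on (closed_segment a1 a2) f" "continuous_on (closed_segment a2 a3) f"
    "continuous_on (closed_segment a3 a4) f" "continuous_on (closed_segment a4 a1) f"
    using cont unfolding defs(1)[symmetric] defs(3)[symmetric] pi by (auto intro: continuous_on_subset)
  note i = c[THEN contour_integrable_continuous_linepath]
  define I1 I2 I3 I4 where "I1 = contour_integral (linepath a1 a2) f" "I2 = contour_integral (linepath a2 a3) f"
     "I3 = contour_integral (linepath a3 a4) f" "I4 = contour_integral (linepath a4 a1) f"
  note Idefs = I1_I2_I3_I4_def
  have sum: "contour_integral (rectpath a1 a3) f = I1 + (I2 + (I3 + I4))"
    unfolding rp Idefs using i
    by (simp only: contour_integral_join contour_integrable_join valid_path_linepath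
          valid_path_join pathfinish_linepath pathstart_linepath pathstart_join simp_thms)
  have na: "norm (a2 - a1) = b - a" "norm (a4 - a3) = b - a"
    using ab by (simp_all add: defs cmod_def)
  have "norm I2 \<le> 4 * K2"
    unfolding Idefs(2) defs(2,3)
    by (rule vertical_contour_bound) (use c(2) T right K2 in \<open>auto simp: defs\<close>)
  moreover have "norm I4 \<le> 4 * K1"
  proof -
    have "I4 = - contour_integral (linepath a1 a4) f"
      unfolding Idefs by (rule contour_integral_reverse_linepath[OF c(4)])
    moreover have "norm (contour_integral (linepath a1 a4) f) \<le> 4 * K1"
      unfolding defs(1,4)
      by (rule vertical_contour_bound) (use c(4) T left K1 in \<open>auto simp: defs closed_segment_commute\<close>)
    ultimately show ?thesis by simp
  qed
  moreover have "norm I1 \<le> H * (b - a)"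
    unfolding na(1)[symmetric]
  proof (rule has_contour_integral_bound_linepath[OF _ H])
    show "(f has_contour_integral I1) (linepath a1 a2)"
      unfolding Idefs using i(1) by (rule has_contour_integral_integral)
    fix s assume "s \<in> closed_segment a1 a2"
    hence "a \<le> Re s" "Re s \<le> b" "\<bar>Im s\<bar> = T"
      using ab T by (auto simp: defs closed_segment_same_Im closed_segment_eq_real_ivl split: if_splits)
    thus "norm (f s) \<le> H" by (rule top)
  qed
  moreover have "norm I3 \<le> H * (b - a)"
    unfolding na(2)[symmetric]
  proof (rule has_contour_integral_bound_linepath[OF _ H])
    show "(f has_contour_integral I3) (linepath a3 a4)"
      unfolding Idefs using i(3) by (rule has_contour_integral_integral)
    fix s assume "s \<in> closed_segment a3 a4"
    hence "a \<le> Re s" "Re s \<le> b" "\<bar>Im s\<bar> = T"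
      using ab T by (auto simp: defs closed_segment_same_Im closed_segment_eq_real_ivl split: if_splits)
    thus "norm (f s) \<le> H" by (rule top)
  qed
  moreover have "norm (I1 + (I2 + (I3 + I4))) \<le> norm I1 + (norm I2 + (norm I3 + norm I4))"
    using norm_triangle_ineq[of I1 "I2 + (I3 + I4)"] norm_triangle_ineq[of I2 "I3 + I4"] norm_triangle_ineq[of I3 I4]
    by linarith
  ultimately have "norm (contour_integral (rectpath a1 a3) f) \<le> H * (b - a) + (4 * K2 + (H * (b - a) + 4 * K1))"
    unfolding sum by linarith
  thus ?thesis by (simp add: defs algebra_simps)
qed

section \<open>The sums over prime powers and over zeros\<close>

text \<open>Removing the terms up to order 1 leaves O(y^2), which makes the series over all prime
  powers converge.\<close>

definition exp_defect :: "real \<Rightarrow> real" where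
  "exp_defect y = exp (- y) - 1 + y"

definition mangoldt_exp_sum :: "real \<Rightarrow> real" where
  "mangoldt_exp_sum x = (\<Sum>n. mangoldt (Suc n) * exp_defect (x / real (Suc n)))"

lemma exp_defect_nonneg: "exp_defect y \<ge> 0"
  using exp_ge_add_one_self[of "-y"] by (simp add: exp_defect_def)

lemma exp_defect_taylor:
  assumes "y \<ge> 0" "N \<ge> 1"
  shows "\<bar>exp_defect y - (\<Sum>k=2..N. (-y) ^ k / fact k)\<bar> \<le> exp y * y ^ Suc N / fact (Suc N)"
proof -
  obtain t where t: "\<bar>t\<bar> \<le> \<bar>-y\<bar>" "exp (-y) = (\<Sum>m<Suc N. (-y) ^ m / fact m) + exp t / fact (Suc N) * (-y) ^ Suc N"
    using Maclaurin_exp_le[of "-y" "Suc N"] by blast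
  have "{..<Suc N} = {0, 1} \<union> {2..N}" using assms(2) by auto
  hence "(\<Sum>m<Suc N. (-y) ^ m / fact m) = (\<Sum>m\<in>{0,1}. (-y) ^ m / fact m) + (\<Sum>k=2..N. (-y) ^ k / fact k)"
    by (simp only:, intro sum.union_disjoint) auto
  hence "(\<Sum>m<Suc N. (-y) ^ m / fact m) = 1 - y + (\<Sum>k=2..N. (-y) ^ k / fact k)" by simp
  hence "exp_defect y - (\<Sum>k=2..N. (-y) ^ k / fact k) = exp t / fact (Suc N) * (-y) ^ Suc N"
    using t(2) by (simp only: exp_defect_def)
  also have "\<bar>\<dots>\<bar> = exp t * y ^ Suc N / fact (Suc N)"
    using assms by (simp add: abs_mult power_abs del: fact_Suc power_Suc)
  also have "\<dots> \<le> exp y * y ^ Suc N / fact (Suc N)"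
    using t(1) assms by (intro divide_right_mono mult_right_mono) auto
  finally show ?thesis .
qed

lemma mseries_of_nat:
  assumes "k \<ge> 2"
  shows "summable (\<lambda>n. mangoldt (Suc n) / real (Suc n) ^ k :: real)"
    and "mseries (of_nat k) = of_real (\<Sum>n. mangoldt (Suc n) / real (Suc n) ^ k)"
proof -
  have eq: "mangoldt (Suc n) * real (Suc n) powr (- real k) = mangoldt (Suc n) / real (Suc n) ^ k" for n
    by (simp add: powr_minus powr_realpow divide_inverse del: of_nat_Suc)
  have "summable (\<lambda>n. mangoldt (Suc n) * real (Suc n) powr (- real k))"
    by (rule summable_mangoldt_powr) (use assms in auto)
  thus sm: "summable (\<lambda>n. mangoldt (Suc n) / real (Suc n) ^ k :: real)" by (simp only: eq)
  have "mangoldt (Suc n) * npow n (- of_nat k) = of_real (mangoldt (Suc n) / real (Suc n) ^ k)" for n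
  proof -
    have "npow n (- of_nat k) = 1 / of_nat (Suc n) ^ k"
      by (subst powr_minus, subst powr_complexpow) (auto simp: divide_inverse simp del: of_nat_Suc)
    thus ?thesis by (simp del: of_nat_Suc)
  qed
  thus "mseries (of_nat k) = of_real (\<Sum>n. mangoldt (Suc n) / real (Suc n) ^ k)"
    unfolding mseries_def using sm by (simp only: suminf_of_real)
qed

text \<open>Taylor's formula is applied in each summand, and the orders k <= N are then summed over
  n separately. As x / n <= x, the error is at most exp x * x^(N + 1) / (N + 1)! times the sum of
  mangoldt(n) / n^2. Partial sums in k are what the rectangle with right edge N + 1/2
  produces.\<close>

lemma mangoldt_exp_sum_expansion:
  assumes x: "x \<ge> 0"
  shows "summable (\<lambda>n. mangoldt (Suc n) * exp_defect (x / real (Suc n)))"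
    and "(\<lambda>N. \<Sum>k=2..N. (-x) ^ k / fact k * (\<Sum>n. mangoldt (Suc n) / real (Suc n) ^ k)) \<longlonglongrightarrow> mangoldt_exp_sum x"
proof -
  define b where "b = (\<lambda>N n. \<Sum>k=2..N. (-x) ^ k / fact k * (mangoldt (Suc n) / real (Suc n) ^ k))"
  define c where "c = (\<lambda>N. exp x * x ^ Suc N / fact (Suc N))"
  have sb: "summable (b N)" for N
    unfolding b_def by (intro summable_sum summable_mult mseries_of_nat) auto
  have bd: "\<bar>mangoldt (Suc n) * exp_defect (x / real (Suc n)) - b N n\<bar> \<le> c N * (mangoldt (Suc n) / real (Suc n) ^ 2)" if "N \<ge> 1" for N n
  proof -
    define d where "d = real (Suc n)"
    have d: "d \<ge> 1" by (simp add: d_def)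
    define y where "y = x / d"
    have "x / d \<le> x / 1" using x d by (intro divide_left_mono) auto
    hence y: "y \<ge> 0" "y \<le> x" using x d by (auto simp: y_def)
    have "b N n = mangoldt (Suc n) * (\<Sum>k=2..N. (-y) ^ k / fact k)"
      unfolding b_def sum_distrib_left y_def d_def by (intro sum.cong) (auto simp: power_divide power_minus' field_simps simp del: of_nat_Suc)
    hence "\<bar>mangoldt (Suc n) * exp_defect y - b N n\<bar> = mangoldt (Suc n) * \<bar>exp_defect y - (\<Sum>k=2..N. (-y) ^ k / fact k)\<bar>"
      by (simp add: abs_mult mangoldt_nonneg flip: right_diff_distrib)
    also have "\<dots> \<le> mangoldt (Suc n) * (exp y * y ^ Suc N / fact (Suc N))"
      by (intro mult_left_mono exp_defect_taylor that y mangoldt_nonneg) 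
    also have "\<dots> \<le> mangoldt (Suc n) * (exp x * (x ^ Suc N / d ^ 2) / fact (Suc N))"
    proof (intro mult_left_mono divide_right_mono mult_mono mangoldt_nonneg)
      have "y ^ Suc N = x ^ Suc N / d ^ Suc N" by (simp only: y_def power_divide)
      also have "\<dots> \<le> x ^ Suc N / d ^ 2"
        using x d that by (intro divide_left_mono power_increasing mult_pos_pos zero_less_power) auto
      finally show "y ^ Suc N \<le> x ^ Suc N / d ^ 2" .
    qed (use y x in auto)
    finally show ?thesis by (simp add: c_def y_def d_def mult_ac)
  qed
  have s2: "summable (\<lambda>n. mangoldt (Suc n) / real (Suc n) ^ 2 :: real)" by (rule mseries_of_nat) auto
  define K where "K = (\<Sum>n. mangoldt (Suc n) / real (Suc n) ^ 2 :: real)"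
  have sd: "summable (\<lambda>n. mangoldt (Suc n) * exp_defect (x / real (Suc n)) - b N n)" if "N \<ge> 1" for N
    by (rule summable_comparison_test'[OF summable_mult[OF s2, of "c N"], of 0]) (use bd that in auto)
  from summable_add[OF sd[of 1] sb[of 1]]
  show sF: "summable (\<lambda>n. mangoldt (Suc n) * exp_defect (x / real (Suc n)))" by simp
  have sumb: "(\<Sum>n. b N n) = (\<Sum>k=2..N. (-x) ^ k / fact k * (\<Sum>n. mangoldt (Suc n) / real (Suc n) ^ k))" for N
  proof -
    have "(\<Sum>n. b N n) = (\<Sum>k=2..N. \<Sum>n. (-x) ^ k / fact k * (mangoldt (Suc n) / real (Suc n) ^ k))"
      unfolding b_def by (intro suminf_sum summable_mult mseries_of_nat) simp
    also have "\<dots> = (\<Sum>k=2..N. (-x) ^ k / fact k * (\<Sum>n. mangoldt (Suc n) / real (Suc n) ^ k))"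
      by (intro sum.cong suminf_mult mseries_of_nat) auto
    finally show ?thesis .
  qed
  have le: "\<bar>mangoldt_exp_sum x - (\<Sum>n. b N n)\<bar> \<le> c N * K" if "N \<ge> 1" for N
  proof -
    have "mangoldt_exp_sum x - (\<Sum>n. b N n) = (\<Sum>n. mangoldt (Suc n) * exp_defect (x / real (Suc n)) - b N n)"
      unfolding mangoldt_exp_sum_def by (rule suminf_diff[OF sF sb])
    also have "norm \<dots> \<le> (\<Sum>n. c N * (mangoldt (Suc n) / real (Suc n) ^ 2))"
      using bd[OF that] by (intro norm_suminf_le summable_mult s2) (simp del: of_nat_Suc)
    also have "\<dots> = c N * K" unfolding K_def by (rule suminf_mult[OF s2])
    finally show ?thesis by simp
  qed
  have c0: "(\<lambda>N. c N * K) \<longlonglongrightarrow> 0"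
  proof -
    have "(\<lambda>N. x ^ N / fact N) \<longlonglongrightarrow> 0"
      using summable_LIMSEQ_zero[OF summable_exp_generic[of x]] by (simp add: divide_inverse mult.commute)
    hence "(\<lambda>N. x ^ Suc N / fact (Suc N)) \<longlonglongrightarrow> 0" by (rule LIMSEQ_Suc)
    from tendsto_mult_right_zero[OF this, of "exp x * K"] show ?thesis by (simp only: c_def mult_ac times_divide_eq_right)
  qed
  have "(\<lambda>N. mangoldt_exp_sum x - (\<Sum>n. b N n)) \<longlonglongrightarrow> 0"
    by (rule Lim_null_comparison[OF _ c0]) (use le in \<open>auto simp: eventually_at_top_linorder intro!: exI[of _ 1]\<close>)
  from tendsto_diff[OF tendsto_const[of "mangoldt_exp_sum x"] this]
  show "(\<lambda>N. \<Sum>k=2..N. (-x) ^ k / fact k * (\<Sum>n. mangoldt (Suc n) / real (Suc n) ^ k)) \<longlonglongrightarrow> mangoldt_exp_sum x"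
    by (simp add: sumb)
qed

lemma residue_integrand_ge_2:
  assumes x: "x > 0" and k: "k \<ge> 2"
  shows "residue (integrand x) (of_nat k) = - of_real ((-x) ^ k / fact k * (\<Sum>n. mangoldt (Suc n) / real (Suc n) ^ k))"
proof -
  have "zeta_nlogderiv (of_nat k) = mseries (of_nat k)"
    using k by (simp add: zeta_nlogderiv_def mseries_eq)
  moreover have "of_real x powr of_nat k = (of_real x ^ k :: complex)"
    using x by (intro powr_complexpow) auto
  ultimately show ?thesis
    using residue_integrand_nat[OF x, of k] k
    by (simp add: mseries_of_nat(2)[OF k] power_minus' [of x] power_minus[of x] field_simps)
qed

section \<open>Convergence of the sum over zeros\<close>

abbreviation strip_zeros :: "real \<Rightarrow> complex set" where
  "strip_zeros a \<equiv> {p. zeta_reg p = 0 \<and> a < Re p}"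

definition reg_zero_term :: "real \<Rightarrow> complex \<Rightarrow> complex" where
  "reg_zero_term x p = of_nat (zmult p) * (of_real x powr p * Gamma (- p))"

lemma Gamma_zero_bound:
  obtains C where "C > 0" "\<And>p. zeta_reg p = 0 \<Longrightarrow> Re p \<ge> -1 \<Longrightarrow> norm (Gamma (- p)) \<le> C * exp (- \<bar>Im p\<bar>)"
proof -
  obtain C1 where C1: "C1 > 0" "\<And>s. Re s \<le> 1 \<Longrightarrow> \<bar>Im s\<bar> \<ge> 1 \<Longrightarrow> norm (Gamma s) \<le> C1 * exp (- \<bar>Im s\<bar>)"
    using Gamma_decay by metis
  \<comment> \<open>The decay of \<open>Gamma\<close> is available only for |Im p| >= 1; the
    finitely many lower zeros are absorbed in this constant.\<close>
  define C2 where "C2 = (\<Sum>p\<in>zero_box 0. norm (Gamma (- p)) * exp (\<bar>Im p\<bar>))"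
  have C2: "C2 \<ge> 0" unfolding C2_def by (intro sum_nonneg) auto
  show ?thesis
  proof (rule that[of "C1 + C2"])
    fix p assume p: "zeta_reg p = 0" "Re p \<ge> -1"
    show "norm (Gamma (- p)) \<le> (C1 + C2) * exp (- \<bar>Im p\<bar>)"
    proof (cases "\<bar>Im p\<bar> \<ge> 1")
      case True
      have "norm (Gamma (- p)) \<le> C1 * exp (- \<bar>Im p\<bar>)" using C1(2)[of "-p"] p True by simp
      also have "\<dots> \<le> (C1 + C2) * exp (- \<bar>Im p\<bar>)" using C2 by (intro mult_right_mono) auto
      finally show ?thesis .
    next
      case False
      hence "p \<in> zero_box 0" using p by (simp add: zero_box_def)
      hence "norm (Gamma (- p)) * exp (\<bar>Im p\<bar>) \<le> C2"
        unfolding C2_def by (intro member_le_sum finite_zero_box) auto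
      also have "\<dots> \<le> C1 + C2" using C1 by simp
      finally have "norm (Gamma (- p)) * exp (\<bar>Im p\<bar>) * exp (- \<bar>Im p\<bar>) \<le> (C1 + C2) * exp (- \<bar>Im p\<bar>)"
        by (intro mult_right_mono) auto
      thus ?thesis by (simp add: mult.assoc mult_exp_exp)
    qed
  qed (use C1 C2 in auto)
qed

lemma norm_of_real_powr: "x > 0 \<Longrightarrow> norm (of_real x powr s :: complex) = x powr Re s"
  by (subst norm_powr_real_powr) auto

text \<open>The majorant separates the zero from x, so one summable g serves all x; zeros with -1 <=
  Re p <= 0 then contribute a bounded amount for x >= 1.\<close>

lemma reg_zero_term_summable:
  obtains g where "g summable_on {p. zeta_reg p = 0 \<and> Re p \<ge> -1}"
    "\<And>p x. zeta_reg p = 0 \<Longrightarrow> Re p \<ge> -1 \<Longrightarrow> x > 0 \<Longrightarrow> norm (reg_zero_term x p) \<le> g p * x powr Re p"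
    "\<And>p. g p \<ge> 0"
proof -
  obtain C where C: "C > 0" "\<And>p. zeta_reg p = 0 \<Longrightarrow> Re p \<ge> -1 \<Longrightarrow> norm (Gamma (- p)) \<le> C * exp (- \<bar>Im p\<bar>)"
    using Gamma_zero_bound by metis
  show ?thesis
  proof (rule that[of "\<lambda>p. C * (real (zmult p) * exp (- \<bar>Im p\<bar>))"])
    show "(\<lambda>p. C * (real (zmult p) * exp (- \<bar>Im p\<bar>))) summable_on {p. zeta_reg p = 0 \<and> Re p \<ge> -1}"
      by (intro summable_on_cmult_right summable_zeros_exp)
    fix p and x :: real assume p: "zeta_reg p = 0" "Re p \<ge> -1" and x: "x > 0"
    have "norm (reg_zero_term x p) = real (zmult p) * x powr Re p * norm (Gamma (- p))"
      using x by (simp add: reg_zero_term_def norm_mult norm_of_real_powr)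
    also have "\<dots> \<le> real (zmult p) * x powr Re p * (C * exp (- \<bar>Im p\<bar>))"
      using C(2)[OF p] by (intro mult_left_mono) auto
    finally show "norm (reg_zero_term x p) \<le> C * (real (zmult p) * exp (- \<bar>Im p\<bar>)) * x powr Re p" by (simp add: mult_ac)
  qed (use C in auto)
qed

lemma reg_zero_term_summable_on:
  assumes "x > 0" "A \<subseteq> {p. zeta_reg p = 0 \<and> Re p \<ge> -1}"
  shows "reg_zero_term x summable_on A"
proof -
  obtain g where g: "g summable_on {p. zeta_reg p = 0 \<and> Re p \<ge> -1}"
    "\<And>p x. zeta_reg p = 0 \<Longrightarrow> Re p \<ge> -1 \<Longrightarrow> x > 0 \<Longrightarrow> norm (reg_zero_term x p) \<le> g p * x powr Re p"
    "\<And>p. g p \<ge> 0"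
    using reg_zero_term_summable by metis
  \<comment> \<open>The two maxima bound x^(Re p) for -1 <= Re p < 1 whether x is above or below 1.
    Values below 1 do occur: ln 2 < 1.\<close>
  have "(\<lambda>p. g p * max 1 x powr 1 * max 1 (1/x) powr 1) summable_on A"
    by (intro summable_on_cmult_left summable_on_subset_banach[OF g(1) assms(2)])
  moreover have "norm (reg_zero_term x p) \<le> g p * max 1 x powr 1 * max 1 (1/x) powr 1" if "p \<in> A" for p
  proof -
    have p: "zeta_reg p = 0" "Re p \<ge> -1" "Re p < 1" using that assms(2) zero_Re_less_1 by auto
    have "x powr Re p \<le> max 1 x powr 1 * max 1 (1/x) powr 1"
    proof (cases "x \<ge> 1")
      case True
      have "x powr Re p \<le> x powr 1" using True p by (intro powr_mono) auto
      thus ?thesis using True by (simp add: max_def)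
    next
      case False
      have "x powr Re p \<le> x powr (-1)" using False p assms(1) by (intro powr_mono') auto
      also have "x powr (-1) = 1 / x" using assms(1) by (simp add: powr_minus_divide)
      finally show ?thesis using False assms(1) by (simp add: max_def field_simps)
    qed
    hence "g p * x powr Re p \<le> g p * (max 1 x powr 1 * max 1 (1/x) powr 1)" by (intro mult_left_mono g)
    thus ?thesis using g(2)[OF p(1,2) assms(1)] by (simp add: mult.assoc)
  qed
  ultimately have "(\<lambda>p. norm (reg_zero_term x p)) summable_on A"
    by (rule summable_on_comparison_test) auto
  thus ?thesis by (rule abs_summable_summable)
qed

section \<open>The explicit formula\<close>

text \<open>As a < 0, the factor x^s has modulus at most 1, so this edge stays bounded for x >=
  1.\<close>

lemma integrand_left_bound:
  assumes a: "-1/2 \<le> a" "a \<le> -1/4" and C: "C > 0"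
    and le: "\<And>t. norm (deriv zeta_reg (Complex a t) / zeta_reg (Complex a t)) \<le> C * (1 + \<bar>t\<bar>) ^ 4"
  obtains K where "K \<ge> 0" "\<And>x t. x \<ge> 1 \<Longrightarrow> norm (integrand x (Complex a t)) \<le> K / (1 + t\<^sup>2)"
proof -
  define G where "G = 3 * Gamma (- a) / Gamma (1/2)"
  have G: "G \<ge> 0" unfolding G_def using a by (intro divide_nonneg_pos mult_nonneg_nonneg) auto
  show ?thesis
  proof (rule that[of "G * (1 + C) * (720 * exp 1)"])
    fix x t :: real assume x: "x \<ge> 1"
    let ?s = "Complex a t"
    have "- ?s = Complex (- a) (- t)" by (simp add: complex_eq_iff)
    hence 1: "norm (Gamma (- ?s)) \<le> G * exp (- \<bar>t\<bar>)"
      using Gamma_decay_left[of "-a" "-t"] a by (simp add: G_def)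
    have 2: "norm (of_real x powr ?s) \<le> 1"
      using x a powr_mono[of a 0 x] by (simp add: norm_of_real_powr)
    have "1 \<le> norm (?s - 1)" using abs_Re_le_cmod[of "?s - 1"] a by simp
    hence "norm (1 / (?s - 1)) \<le> 1" by (simp add: norm_divide divide_le_eq_1)
    moreover have "1 \<le> (1 + \<bar>t\<bar>) ^ 4" by (rule one_le_power) auto
    ultimately have "norm (zeta_nlogderiv ?s) \<le> (1 + \<bar>t\<bar>) ^ 4 + C * (1 + \<bar>t\<bar>) ^ 4"
      unfolding zeta_nlogderiv_def using norm_triangle_ineq4[of "1 / (?s - 1)" "deriv zeta_reg ?s / zeta_reg ?s"] le[of t]
      by linarith
    hence 3: "norm (zeta_nlogderiv ?s) \<le> (1 + C) * (1 + \<bar>t\<bar>) ^ 4" by (simp add: algebra_simps)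
    have "norm (integrand x ?s) \<le> (G * exp (- \<bar>t\<bar>)) * 1 * ((1 + C) * (1 + \<bar>t\<bar>) ^ 4)"
      unfolding integrand_def norm_mult using 1 2 3 G by (intro mult_mono) auto
    also have "\<dots> = G * (1 + C) * ((1 + \<bar>t\<bar>) ^ 4 * exp (- \<bar>t\<bar>))" by (simp add: mult_ac)
    also have "\<dots> \<le> G * (1 + C) * ((720 * exp 1) / (1 + \<bar>t\<bar>\<^sup>2))"
      using exp_minus_le_inverse_square[of "\<bar>t\<bar>"] G C by (intro mult_left_mono) auto
    finally show "norm (integrand x ?s) \<le> G * (1 + C) * (720 * exp 1) / (1 + t\<^sup>2)" by simp
  qed (use G C in auto)
qed

lemma zeta_nlogderiv_eq_mseries: "Re s > 1 \<Longrightarrow> zeta_nlogderiv s = mseries s"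
  by (simp add: zeta_nlogderiv_def mseries_eq)

lemma integrand_right_bound:
  obtains K where "K \<ge> 0" "\<And>x t N. x > 0 \<Longrightarrow> N \<ge> 1 \<Longrightarrow>
     norm (integrand x (Complex (real N + 1/2) t)) \<le> (K * x powr (real N + 1/2) / fact N) / (1 + t\<^sup>2)"
proof -
  define M where "M = Re (mseries (of_real (3/2)))"
  have M: "norm (mseries s) \<le> M" if "Re s \<ge> 3/2" for s
    unfolding M_def by (rule norm_mseries_le) (use that in auto)
  have M0: "M \<ge> 0" using order.trans[OF norm_ge_zero M[of 2]] by simp
  show ?thesis
  proof (rule that[of "6 * M * (720 * exp 1)"])
    fix x t :: real and N :: nat assume x: "x > 0" and N: "N \<ge> 1"
    let ?s = "Complex (real N + 1/2) t"
    have "- ?s = Complex (- real N - 1/2) (- t)" by (simp add: complex_eq_iff)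
    hence 1: "norm (Gamma (- ?s)) \<le> 6 / fact N * exp (- \<bar>t\<bar>)"
      using Gamma_half_line[of N "-t"] by simp
    have "real N \<ge> 1" using N by simp
    hence 3: "norm (zeta_nlogderiv ?s) \<le> M" by (subst zeta_nlogderiv_eq_mseries) (auto intro!: M)
    have "1 * exp (- \<bar>t\<bar>) \<le> (1 + \<bar>t\<bar>) ^ 4 * exp (- \<bar>t\<bar>)" by (intro mult_right_mono one_le_power) auto
    also have "\<dots> \<le> (720 * exp 1) / (1 + t\<^sup>2)" using exp_minus_le_inverse_square[of "\<bar>t\<bar>"] by simp
    finally have 4: "exp (- \<bar>t\<bar>) \<le> (720 * exp 1) / (1 + t\<^sup>2)" by simp
    have "norm (integrand x ?s) \<le> (6 / fact N * exp (- \<bar>t\<bar>)) * x powr (real N + 1/2) * M"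
      unfolding integrand_def norm_mult using 1 3 x M0 by (intro mult_mono) (auto simp: norm_of_real_powr)
    also have "\<dots> = (6 / fact N * x powr (real N + 1/2) * M) * exp (- \<bar>t\<bar>)" by (simp add: mult_ac)
    also have "\<dots> \<le> (6 / fact N * x powr (real N + 1/2) * M) * ((720 * exp 1) / (1 + t\<^sup>2))"
      by (intro mult_left_mono 4) (use M0 in auto)
    finally show "norm (integrand x ?s) \<le> (6 * M * (720 * exp 1) * x powr (real N + 1/2) / fact N) / (1 + t\<^sup>2)"
      by (simp add: field_simps)
  qed (use M0 in auto)
qed

text \<open>Zeros are an issue only for Re s <= 2, where the bound B comes from the choice of the
  height; further right the Dirichlet series bounds the logarithmic derivative by a
  constant.\<close>

lemma integrand_top_bound:
  obtains K where "K \<ge> 0" "\<And>x s N T B. x \<ge> 1 \<Longrightarrow> T \<ge> 1 \<Longrightarrow> \<bar>Im s\<bar> = T \<Longrightarrow> -1/2 \<le> Re s \<Longrightarrow> Re s \<le> real N + 1/2 \<Longrightarrow> B \<ge> 0 \<Longrightarrow>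
     (Re s \<le> 2 \<Longrightarrow> norm (deriv zeta_reg s / zeta_reg s) \<le> B) \<Longrightarrow>
     norm (integrand x s) \<le> K * exp (- T) * x powr (real N + 1/2) * (1 + B)"
proof -
  obtain C where C: "C > 0" "\<And>s. Re s \<le> 1 \<Longrightarrow> \<bar>Im s\<bar> \<ge> 1 \<Longrightarrow> norm (Gamma s) \<le> C * exp (- \<bar>Im s\<bar>)"
    using Gamma_decay by metis
  define M where "M = Re (mseries (of_real 2))"
  have M: "norm (mseries s) \<le> M" if "Re s \<ge> 2" for s
    unfolding M_def by (rule norm_mseries_le) (use that in auto)
  have M0: "M \<ge> 0" using order.trans[OF norm_ge_zero M[of 2]] by simp
  show ?thesis
  proof (rule that[of "C * (1 + M)"])
    fix x T B :: real and s and N :: nat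
    assume x: "x \<ge> 1" and T: "T \<ge> 1" "\<bar>Im s\<bar> = T" and s: "-1/2 \<le> Re s" "Re s \<le> real N + 1/2"
      and B: "B \<ge> 0" "Re s \<le> 2 \<Longrightarrow> norm (deriv zeta_reg s / zeta_reg s) \<le> B"
    have 1: "norm (Gamma (- s)) \<le> C * exp (- T)" using C(2)[of "-s"] s T by simp
    have 2: "norm (of_real x powr s) \<le> x powr (real N + 1/2)"
      using x s by (simp add: norm_of_real_powr powr_mono)
    have 3: "norm (zeta_nlogderiv s) \<le> (1 + M) * (1 + B)"
    proof (cases "Re s \<le> 2")
      case True
      have "1 \<le> norm (s - 1)" using abs_Im_le_cmod[of "s - 1"] T by simp
      hence "norm (1 / (s - 1)) \<le> 1" by (simp add: norm_divide divide_le_eq_1)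
      hence "norm (zeta_nlogderiv s) \<le> 1 + B"
        unfolding zeta_nlogderiv_def using norm_triangle_ineq4[of "1 / (s - 1)" "deriv zeta_reg s / zeta_reg s"] B(2)[OF True]
        by linarith
      also have "\<dots> \<le> (1 + M) * (1 + B)" using B M0 by (simp add: algebra_simps)
      finally show ?thesis .
    next
      case False
      hence "norm (zeta_nlogderiv s) \<le> M" by (subst zeta_nlogderiv_eq_mseries) (auto intro!: M)
      also have "\<dots> \<le> (1 + M) * (1 + B)" using B M0 by (simp add: algebra_simps)
      finally show ?thesis .
    qed
    have "norm (integrand x s) \<le> (C * exp (- T)) * x powr (real N + 1/2) * ((1 + M) * (1 + B))"
      unfolding integrand_def norm_mult using 1 2 3 C by (intro mult_mono) auto
    thus "norm (integrand x s) \<le> C * (1 + M) * exp (- T) * x powr (real N + 1/2) * (1 + B)" by (simp add: mult_ac)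
  qed (use C M0 in auto)
qed

text \<open>The height tends to infinity while N and x are fixed, and the horizontal edges
  disappear. Of the remaining edges the left one gives the constant and the right one the term with
  N!.\<close>

lemma truncated_explicit_formula:
  obtains a K where "-1/2 \<le> a" "a \<le> -1/4" "K \<ge> 0"
    "\<And>x N. x \<ge> 1 \<Longrightarrow> N \<ge> 1 \<Longrightarrow>
       norm ((\<Sum>k\<le>N. residue (integrand x) (of_nat k)) - (\<Sum>\<^sub>\<infinity>p\<in>strip_zeros a. reg_zero_term x p))
         \<le> K + K * x powr (real N + 1/2) / fact N"
proof -
  obtain a C where a: "-1/2 \<le> a" "a \<le> -1/4" "C > 0" "\<And>t. zeta_reg (Complex a t) \<noteq> 0"
    "\<And>t. norm (deriv zeta_reg (Complex a t) / zeta_reg (Complex a t)) \<le> C * (1 + \<bar>t\<bar>) ^ 4"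
    using exists_left_line by blast
  obtain K1 where K1: "K1 \<ge> 0" "\<And>x t. x \<ge> 1 \<Longrightarrow> norm (integrand x (Complex a t)) \<le> K1 / (1 + t\<^sup>2)"
    using integrand_left_bound[OF a(1,2,3,5)] by metis
  obtain K2 where K2: "K2 \<ge> 0" "\<And>x t N. x > 0 \<Longrightarrow> N \<ge> 1 \<Longrightarrow>
     norm (integrand x (Complex (real N + 1/2) t)) \<le> (K2 * x powr (real N + 1/2) / fact N) / (1 + t\<^sup>2)"
    using integrand_right_bound by metis
  obtain K3 where K3: "K3 \<ge> 0" "\<And>x s N T B. x \<ge> 1 \<Longrightarrow> T \<ge> 1 \<Longrightarrow> \<bar>Im s\<bar> = T \<Longrightarrow> -1/2 \<le> Re s \<Longrightarrow> Re s \<le> real N + 1/2 \<Longrightarrow> B \<ge> 0 \<Longrightarrow>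
     (Re s \<le> 2 \<Longrightarrow> norm (deriv zeta_reg s / zeta_reg s) \<le> B) \<Longrightarrow>
     norm (integrand x s) \<le> K3 * exp (- T) * x powr (real N + 1/2) * (1 + B)"
    using integrand_top_bound by metis
  obtain Ch T where Ch: "Ch > 0" and T: "\<And>k::nat. real k + 1 \<le> T k \<and> T k \<le> real k + 2"
    and hgt: "\<And>k s. -1/2 \<le> Re s \<Longrightarrow> Re s \<le> 2 \<Longrightarrow> \<bar>Im s\<bar> = T k \<Longrightarrow>
       zeta_reg s \<noteq> 0 \<and> norm (deriv zeta_reg s / zeta_reg s) \<le> Ch * (1 + T k) ^ 2"
    using exists_heights by metis
  have T1: "T j \<ge> 1" "T j > 0" for j using T[of j] by auto
  define zs where "zs = (\<lambda>j. {p. zeta_reg p = 0 \<and> a < Re p \<and> \<bar>Im p\<bar> < T j})"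
  have fzs: "finite (zs j)" for j
  proof (rule finite_subset)
    show "zs j \<subseteq> poles \<inter> ball 0 (2 + T j)"
    proof
      fix p assume p: "p \<in> zs j"
      have "norm p \<le> \<bar>Re p\<bar> + \<bar>Im p\<bar>" by (rule cmod_le)
      also have "\<dots> < 2 + T j" using p a zero_Re_less_1[of p] by (auto simp: zs_def)
      finally show "p \<in> poles \<inter> ball 0 (2 + T j)" using p by (simp add: zs_def poles_def)
    qed
  qed (rule finite_poles)
  show ?thesis
  proof (rule that[OF a(1,2), of "K1 + K2"])
    show "K1 + K2 \<ge> 0" using K1 K2 by simp
    fix x :: real and N :: nat assume x: "x \<ge> 1" and N: "N \<ge> 1"
    define R where "R = (\<Sum>k\<le>N. residue (integrand x) (of_nat k))"
    define E where "E = K2 * x powr (real N + 1/2) / fact N"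
    have E: "E \<ge> 0" using K2 by (simp add: E_def)
    define H where "H = (\<lambda>j. K3 * exp (- (real j + 1)) * x powr (real N + 1/2) * (1 + Ch * (real j + 3) ^ 2))"
    have H0: "H j \<ge> 0" for j unfolding H_def using K3 Ch by (intro mult_nonneg_nonneg add_nonneg_nonneg) auto
    have fin: "norm (R - (\<Sum>p\<in>zs j. reg_zero_term x p)) \<le> K1 + E + H j * (real N + 1)" for j
    proof -
      define g where "g = rectpath (Complex a (- T j)) (Complex (real N + 1/2) (T j))"
      have pimg: "path_image g = {z. Re z \<in> {a, real N + 1/2} \<and> Im z \<in> {- T j..T j}} \<union>
           {z. Im z \<in> {- T j, T j} \<and> Re z \<in> {a..real N + 1/2}}"
        unfolding g_def using a T1[of j] by (subst path_image_rectpath) auto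
      have avoid: "path_image g \<inter> poles = {}"
      proof -
        have "s \<notin> poles" if s: "s \<in> path_image g" for s
        proof -
          consider "Re s = a" | "Re s = real N + 1/2" | "\<bar>Im s\<bar> = T j" "a \<le> Re s"
            using s T1[of j] unfolding pimg by auto
          thus ?thesis
          proof cases
            case 1
            hence "s = Complex a (Im s)" by (simp add: complex_eq_iff)
            hence "zeta_reg s \<noteq> 0" using a(4) by metis
            moreover have "s \<notin> \<nat>" using 1 a by (auto elim!: Nats_cases)
            ultimately show ?thesis by (simp add: poles_def)
          next
            case 2
            have "real N \<ge> 1" using N by simp
            hence "zeta_reg s \<noteq> 0" using 2 by (intro zeta_reg_nonzero_right) simp
            moreover have "s \<notin> \<nat>"
            proof
              assume "s \<in> \<nat>"
              then obtain k where "s = of_nat k" by (auto elim: Nats_cases)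
              hence "2 * real k = 2 * real N + 1" using 2 by simp
              hence "2 * k = 2 * N + 1" by linarith
              thus False by presburger
            qed
            ultimately show ?thesis by (simp add: poles_def)
          next
            case 3
            have "zeta_reg s \<noteq> 0"
            proof (cases "Re s \<le> 2")
              case True
              thus ?thesis using hgt[of s j] 3 a by auto
            qed (intro zeta_reg_nonzero_right, simp)
            moreover have "s \<notin> \<nat>" using 3(1) T1[of j] by (auto elim!: Nats_cases)
            ultimately show ?thesis by (simp add: poles_def)
          qed
        qed
        thus ?thesis by blast
      qed
      have "contour_integral g (integrand x) = 2 * pi * \<i> * (R + (\<Sum>p\<in>zs j. residue (integrand x) p))"
        unfolding g_def R_def zs_def
        by (rule contour_integral_integrand) (use x T1 a N avoid in \<open>auto simp: g_def\<close>)
      also have "(\<Sum>p\<in>zs j. residue (integrand x) p) = - (\<Sum>p\<in>zs j. reg_zero_term x p)"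
        unfolding sum_negf[symmetric]
        by (intro sum.cong refl) (use x in \<open>auto simp: zs_def residue_integrand_zero reg_zero_term_def\<close>)
      finally have ci: "contour_integral g (integrand x) = 2 * pi * \<i> * (R - (\<Sum>p\<in>zs j. reg_zero_term x p))" by simp
      have "norm (contour_integral g (integrand x)) \<le> 4 * K1 + 4 * E + 2 * H j * (real N + 1/2 - a)"
        unfolding g_def
      proof (rule norm_rectpath_integral_le)
        show "continuous_on (path_image (rectpath (Complex a (- T j)) (Complex (real N + 1/2) (T j)))) (integrand x)"
          using avoid x unfolding g_def[symmetric]
          by (intro holomorphic_on_imp_continuous_on integrand_holomorphic) auto
        show "norm (integrand x (Complex a t)) \<le> K1 / (1 + t\<^sup>2)" for t by (rule K1(2)[OF x])
        show "norm (integrand x (Complex (real N + 1/2) t)) \<le> E / (1 + t\<^sup>2)" for t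
          unfolding E_def using x N by (intro K2(2)) auto
        fix s assume s: "a \<le> Re s" "Re s \<le> real N + 1/2" "\<bar>Im s\<bar> = T j"
        have "norm (integrand x s) \<le> K3 * exp (- T j) * x powr (real N + 1/2) * (1 + Ch * (1 + T j) ^ 2)"
        proof (rule K3(2)[OF x T1(1) s(3) _ s(2)])
          show "norm (deriv zeta_reg s / zeta_reg s) \<le> Ch * (1 + T j) ^ 2" if "Re s \<le> 2"
            using hgt[of s j] that s a by auto
        qed (use s a Ch in auto)
        also have "\<dots> \<le> H j"
        proof -
          have "exp (- T j) \<le> exp (- (real j + 1))" using T[of j] by simp
          moreover have "(1 + T j) ^ 2 \<le> (real j + 3) ^ 2" using T[of j] by (intro power_mono) auto
          hence "1 + Ch * (1 + T j) ^ 2 \<le> 1 + Ch * (real j + 3) ^ 2"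
            using Ch by (intro add_left_mono mult_left_mono) auto
          ultimately show ?thesis
            unfolding H_def using K3(1) Ch by (intro mult_mono mult_right_mono mult_left_mono) auto
        qed
        finally show "norm (integrand x s) \<le> H j" .
      qed (use a T1[of j] K1 E H0 in auto)
      also have "2 * H j * (real N + 1/2 - a) \<le> 2 * H j * (real N + 1)"
        using a H0 by (intro mult_left_mono) auto
      finally have "norm (contour_integral g (integrand x)) \<le> 4 * K1 + 4 * E + 2 * H j * (real N + 1)" by simp
      moreover have "norm (contour_integral g (integrand x)) = 2 * pi * norm (R - (\<Sum>p\<in>zs j. reg_zero_term x p))"
        unfolding ci by (simp add: norm_mult)
      ultimately have "2 * pi * norm (R - (\<Sum>p\<in>zs j. reg_zero_term x p)) \<le> 4 * K1 + 4 * E + 4 * (H j * (real N + 1))"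
        using H0[of j] mult_nonneg_nonneg[OF H0[of j], of "real N + 1"] by linarith
      \<comment> \<open>The contour integral carries the factor 2 pi >= 4, which cancels the 4 in
        the edge bounds.\<close>
      moreover have "4 * norm (R - (\<Sum>p\<in>zs j. reg_zero_term x p)) \<le> 2 * pi * norm (R - (\<Sum>p\<in>zs j. reg_zero_term x p))"
        using pi_gt3 by (intro mult_right_mono) auto
      ultimately show ?thesis by linarith
    qed
    have H_lim: "(\<lambda>j. H j) \<longlonglongrightarrow> 0"
    proof -
      have "(\<lambda>j::nat. exp (- (real j + 1)) * (1 + Ch * (real j + 3) ^ 2)) \<longlonglongrightarrow> 0" using Ch by real_asymp
      from tendsto_mult_right_zero[OF this, of "K3 * x powr (real N + 1/2)"] show ?thesis
        by (simp add: H_def mult_ac)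
    qed
    have sum_lim: "(\<lambda>j. \<Sum>p\<in>zs j. reg_zero_term x p) \<longlonglongrightarrow> (\<Sum>\<^sub>\<infinity>p\<in>strip_zeros a. reg_zero_term x p)"
    proof -
      have "reg_zero_term x summable_on strip_zeros a"
        using x a by (intro reg_zero_term_summable_on) auto
      hence "(sum (reg_zero_term x) \<longlongrightarrow> (\<Sum>\<^sub>\<infinity>p\<in>strip_zeros a. reg_zero_term x p)) (finite_subsets_at_top (strip_zeros a))"
        using has_sum_infsum unfolding has_sum_def by blast
      \<comment> \<open>The truncated sets are finite and eventually contain every finite set of
        zeros, so the unconditional sum is also the limit along the heights.\<close>
      moreover have "filterlim zs (finite_subsets_at_top (strip_zeros a)) sequentially"
        unfolding filterlim_finite_subsets_at_top
      proof safe
        fix X assume X: "finite X" "X \<subseteq> strip_zeros a"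
        obtain J :: nat where J: "\<And>p. p \<in> X \<Longrightarrow> \<bar>Im p\<bar> \<le> real J"
        proof -
          have "finite ((\<lambda>p. \<bar>Im p\<bar>) ` X)" using X by simp
          then obtain B where "\<And>p. p \<in> X \<Longrightarrow> \<bar>Im p\<bar> \<le> B"
            using bdd_above_finite[of "(\<lambda>p. \<bar>Im p\<bar>) ` X"] by (auto simp: bdd_above_def)
          moreover obtain J :: nat where "B \<le> real J" using real_arch_simple by blast
          ultimately show ?thesis using that[of J] by fastforce
        qed
        show "\<forall>\<^sub>F j in sequentially. finite (zs j) \<and> X \<subseteq> zs j \<and> zs j \<subseteq> strip_zeros a"
          using eventually_ge_at_top[of J]
        proof eventually_elim
          case (elim j)
          have "\<bar>Im p\<bar> < T j" if "p \<in> X" for p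
          proof -
            have "real J \<le> real j" using elim by simp
            thus ?thesis using J[OF that] T[of j] by linarith
          qed
          thus ?case using X fzs by (auto simp: zs_def)
        qed
      qed
      ultimately show ?thesis by (rule filterlim_compose)
    qed
    have "norm (R - (\<Sum>\<^sub>\<infinity>p\<in>strip_zeros a. reg_zero_term x p)) \<le> K1 + E + 0 * (real N + 1)"
    proof (rule LIMSEQ_le)
      show "(\<lambda>j. norm (R - (\<Sum>p\<in>zs j. reg_zero_term x p))) \<longlonglongrightarrow> norm (R - (\<Sum>\<^sub>\<infinity>p\<in>strip_zeros a. reg_zero_term x p))"
        by (intro tendsto_intros sum_lim)
      show "(\<lambda>j. K1 + E + H j * (real N + 1)) \<longlonglongrightarrow> K1 + E + 0 * (real N + 1)"
        by (intro tendsto_intros H_lim)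
    qed (use fin in auto)
    also have "\<dots> \<le> (K1 + K2) + (K1 + K2) * x powr (real N + 1/2) / fact N"
    proof -
      have "K2 * x powr (real N + 1/2) \<le> (K1 + K2) * x powr (real N + 1/2)" using K1 by (intro mult_right_mono) auto
      hence "E \<le> (K1 + K2) * x powr (real N + 1/2) / fact N" unfolding E_def by (intro divide_right_mono) auto
      thus ?thesis using K2 by simp
    qed
    finally show "norm ((\<Sum>k\<le>N. residue (integrand x) (of_nat k)) - (\<Sum>\<^sub>\<infinity>p\<in>strip_zeros a. reg_zero_term x p))
         \<le> (K1 + K2) + (K1 + K2) * x powr (real N + 1/2) / fact N" unfolding R_def .
  qed
qed

text \<open>Now N tends to infinity: x^(N + 1/2) / N! vanishes, and the residues at 2, 3, ... add up
  to -F(x). Passing from \<open>strip_zeros a\<close> to \<open>strip_zeros 0\<close> and dropping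
  the residue at 0 cost O(1).\<close>

lemma explicit_formula:
  obtains C where "\<And>x. x \<ge> 1 \<Longrightarrow> norm (of_real (mangoldt_exp_sum x) -
     (of_real (x * ln x - x) - (\<Sum>\<^sub>\<infinity>p\<in>strip_zeros 0. reg_zero_term x p))) \<le> C"
proof -
  obtain a K where a: "-1/2 \<le> a" "a \<le> -1/4" "K \<ge> 0"
    and K: "\<And>x N. x \<ge> 1 \<Longrightarrow> N \<ge> 1 \<Longrightarrow>
       norm ((\<Sum>k\<le>N. residue (integrand x) (of_nat k)) - (\<Sum>\<^sub>\<infinity>p\<in>strip_zeros a. reg_zero_term x p))
         \<le> K + K * x powr (real N + 1/2) / fact N"
    using truncated_explicit_formula by blast
  obtain g where g: "g summable_on {p. zeta_reg p = 0 \<and> Re p \<ge> -1}"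
    "\<And>p x. zeta_reg p = 0 \<Longrightarrow> Re p \<ge> -1 \<Longrightarrow> x > 0 \<Longrightarrow> norm (reg_zero_term x p) \<le> g p * x powr Re p"
    "\<And>p. g p \<ge> 0"
    using reg_zero_term_summable by metis
  define L where "L = {p. zeta_reg p = 0 \<and> a < Re p \<and> Re p \<le> 0}"
  have gL: "g summable_on L" by (rule summable_on_subset_banach[OF g(1)]) (use a in \<open>auto simp: L_def\<close>)
  define r0 where "r0 = zeta_nlogderiv 0"
  show ?thesis
  proof (rule that[of "K + norm r0 + (\<Sum>\<^sub>\<infinity>p\<in>L. g p)"])
    fix x :: real assume x: "x \<ge> 1"
    define S where "S = (\<Sum>\<^sub>\<infinity>p\<in>strip_zeros a. reg_zero_term x p)"
    define F where "F = mangoldt_exp_sum x"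
    define P where "P = (\<lambda>N. \<Sum>k=2..N. (-x) ^ k / fact k * (\<Sum>n. mangoldt (Suc n) / real (Suc n) ^ k))"
    have P: "P \<longlonglongrightarrow> F" unfolding P_def F_def using x by (intro mangoldt_exp_sum_expansion) auto
    have R: "(\<Sum>k\<le>N. residue (integrand x) (of_nat k)) = - r0 + of_real (x * ln x - x) - of_real (P N)" if "N \<ge> 1" for N
    proof -
      have "{..N} = {0, 1} \<union> {2..N}" using that by auto
      hence "(\<Sum>k\<le>N. residue (integrand x) (of_nat k)) = (\<Sum>k\<in>{0,1}. residue (integrand x) (of_nat k)) + (\<Sum>k=2..N. residue (integrand x) (of_nat k))"
        by (simp only:, intro sum.union_disjoint) auto
      also have "(\<Sum>k\<in>{0,1}. residue (integrand x) (of_nat k)) = residue (integrand x) (of_nat 0) + residue (integrand x) 1" by simp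
      also have "residue (integrand x) (of_nat 0) = - r0"
        using residue_integrand_nat[of x 0] x by (simp add: r0_def)
      also have "residue (integrand x) 1 = of_real (x * ln x - x)" using x by (intro residue_integrand_1) auto
      also have "(\<Sum>k=2..N. residue (integrand x) (of_nat k)) = - of_real (P N)"
        unfolding P_def of_real_sum sum_negf[symmetric]
        using x by (intro sum.cong refl residue_integrand_ge_2) auto
      finally show ?thesis by simp
    qed
    have "norm (- r0 + of_real (x * ln x - x) - of_real F - S) \<le> K + K * 0"
    proof (rule LIMSEQ_le)
      show "(\<lambda>N. norm (- r0 + of_real (x * ln x - x) - of_real (P N) - S)) \<longlonglongrightarrow> norm (- r0 + of_real (x * ln x - x) - of_real F - S)"
        by (intro tendsto_intros P)
      have "(\<lambda>N. x powr (1/2) * (x ^ N / fact N)) \<longlonglongrightarrow> 0"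
        using summable_LIMSEQ_zero[OF summable_exp_generic[of x]]
        by (intro tendsto_mult_right_zero) (simp add: divide_inverse mult.commute)
      moreover have "x powr (1/2) * (x ^ N / fact N) = x powr (real N + 1/2) / fact N" for N
        using x by (simp add: powr_add powr_realpow)
      ultimately have "(\<lambda>N. x powr (real N + 1/2) / fact N) \<longlonglongrightarrow> 0" by simp
      thus "(\<lambda>N. K + K * (x powr (real N + 1/2) / fact N)) \<longlonglongrightarrow> K + K * 0" by (intro tendsto_intros)
      show "\<exists>N0. \<forall>N\<ge>N0. norm (- r0 + of_real (x * ln x - x) - of_real (P N) - S) \<le> K + K * (x powr (real N + 1/2) / fact N)"
        using K[OF x] R by (intro exI[of _ 1]) (auto simp: S_def)
    qed
    hence main: "norm (- r0 + of_real (x * ln x - x) - of_real F - S) \<le> K" by simp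
    define S0 S1 where "S0 = (\<Sum>\<^sub>\<infinity>p\<in>strip_zeros 0. reg_zero_term x p)" "S1 = (\<Sum>\<^sub>\<infinity>p\<in>L. reg_zero_term x p)"
    note S01 = S0_S1_def
    have "S = S0 + S1"
    proof -
      have "strip_zeros a = strip_zeros 0 \<union> L" using a by (auto simp: L_def)
      moreover have "(\<Sum>\<^sub>\<infinity>p\<in>strip_zeros 0 \<union> L. reg_zero_term x p) = S0 + S1"
        unfolding S01 using x a by (intro infsum_Un_disjoint reg_zero_term_summable_on) (auto simp: L_def)
      ultimately show ?thesis unfolding S_def by (simp only:)
    qed
    have "norm S1 \<le> (\<Sum>\<^sub>\<infinity>p\<in>L. g p)"
      unfolding S01
    proof (rule norm_infsum_le)
      show "(reg_zero_term x has_sum (\<Sum>\<^sub>\<infinity>p\<in>L. reg_zero_term x p)) L"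
        using x a by (intro has_sum_infsum reg_zero_term_summable_on) (auto simp: L_def)
      show "(g has_sum (\<Sum>\<^sub>\<infinity>p\<in>L. g p)) L" by (rule has_sum_infsum[OF gL])
      fix p assume p: "p \<in> L"
      have "norm (reg_zero_term x p) \<le> g p * x powr Re p" by (rule g(2)) (use p a x in \<open>auto simp: L_def\<close>)
      also have "\<dots> \<le> g p * x powr 0" using p x by (intro mult_left_mono powr_mono g(3)) (auto simp: L_def)
      finally show "norm (reg_zero_term x p) \<le> g p" using x by simp
    qed
    moreover have "of_real F - (of_real (x * ln x - x) - S0) = - (- r0 + of_real (x * ln x - x) - of_real F - S) - r0 - S1"
      using \<open>S = S0 + S1\<close> by simp
    hence "norm (of_real F - (of_real (x * ln x - x) - S0)) \<le> norm (- r0 + of_real (x * ln x - x) - of_real F - S) + norm r0 + norm S1"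
      using norm_triangle_ineq4[of "- (- r0 + of_real (x * ln x - x) - of_real F - S) - r0" S1]
        norm_triangle_ineq4[of "- (- r0 + of_real (x * ln x - x) - of_real F - S)" r0]
      by (simp only: norm_minus_cancel)
    ultimately show "norm (of_real (mangoldt_exp_sum x) -
     (of_real (x * ln x - x) - (\<Sum>\<^sub>\<infinity>p\<in>strip_zeros 0. reg_zero_term x p))) \<le> K + norm r0 + (\<Sum>\<^sub>\<infinity>p\<in>L. g p)"
      using main unfolding F_def[symmetric] S01(1)[symmetric] by linarith
  qed
qed

text \<open>The bound Re p < 1 is automatic by nonvanishing for Re s >= 1; it also excludes the
  artificial zero of \<open>zeta\<close> at 1.\<close>

lemma nontrivial_zeta_zeros_eq: "nontrivial_zeta_zeros = strip_zeros 0"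
proof -
  have "zeta p = 0 \<longleftrightarrow> zeta_reg p = 0" if "p \<noteq> 1" for p using that by (simp add: zeta_reg_def)
  thus ?thesis using zero_Re_less_1 by (auto simp: nontrivial_zeta_zeros_def zeta_reg_def)
qed

text \<open>The factor s - 1 does not vanish at p and contributes order 0.\<close>

lemma zorder_zeta:
  assumes "p \<noteq> 1"
  shows "zorder zeta p = zorder zeta_reg p"
proof -
  have an: "zeta analytic_on {p}" "(\<lambda>s. s - 1) analytic_on {p}"
  proof -
    show "zeta analytic_on {p}"
      using is_zeta_zeta assms by (auto simp: is_zeta_def analytic_at intro!: exI[of _ "-{1}"])
  qed (intro analytic_intros)
  have nz: "eventually (\<lambda>s. zeta_reg s \<noteq> 0 \<and> s \<in> UNIV) (at p)"
    by (rule non_zero_neighbour_alt[OF zeta_reg_entire open_UNIV connected_UNIV UNIV_I UNIV_I zeta_reg_2_nonzero])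
  have ev1: "eventually (\<lambda>s. s \<noteq> 1) (at p)" by (rule eventually_neq_at_within)
  have ev: "eventually (\<lambda>s. zeta s * (s - 1) \<noteq> 0) (at p)"
    using nz ev1 by eventually_elim (auto simp: zeta_reg_def)
  have "zorder zeta_reg p = zorder (\<lambda>s. zeta s * (s - 1)) p"
    by (rule zorder_cong[OF _ refl], use ev1 in eventually_elim) (simp add: zeta_reg_def)
  also have "\<dots> = zorder zeta p + zorder (\<lambda>s. s - 1) p"
    by (rule zorder_times_analytic[OF an ev])
  also have "zorder (\<lambda>s. s - 1) p = 0" using assms by (intro zorder_eq_0I an) auto
  finally show ?thesis by simp
qed

lemma zero_term_eq:
  assumes "p \<in> strip_zeros 0"
  shows "zero_term x p = reg_zero_term x p"
proof -
  have p: "p \<noteq> 1" using assms by auto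
  have "zorder zeta_reg p > 0" using zmult_pos[of p] assms by simp
  thus ?thesis using p by (simp add: zero_term_def reg_zero_term_def zorder_zeta)
qed

section \<open>Cycle lengths of a random permutation\<close>

lemma orbit_eq_of_mem:
  assumes "\<sigma> permutes S" "finite S" "y \<in> orbit \<sigma> x"
  shows "orbit \<sigma> y = orbit \<sigma> x"
  using orbit_cyclic_eq3[OF cyclic_on_orbit[OF assms(1,2)] assms(3)] .

lemma self_in_orbit:
  assumes "\<sigma> permutes S" "finite S"
  shows "x \<in> orbit \<sigma> x"
  using assms by (intro permutation_self_in_orbit) (auto simp: permutation_permutes)

text \<open>Under the composition x goes to y and y to the old image of x, so y is inserted into the
  cycle of x and no other cycle is touched.\<close>

lemma orbit_insert:
  assumes \<tau>: "\<tau> permutes S" and fin: "finite S" and x: "x \<in> S" and y: "y \<notin> S"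
  defines "\<sigma> \<equiv> \<tau> \<circ> Transposition.transpose x y"
  shows "orbit \<sigma> x = insert y (orbit \<tau> x)"
    and "\<And>z. z \<in> S \<Longrightarrow> z \<notin> orbit \<tau> x \<Longrightarrow> orbit \<sigma> z = orbit \<tau> z"
proof -
  have \<tau>y: "\<tau> y = y" using \<tau> y by (rule permutes_not_in)
  have xy: "x \<noteq> y" using x y by auto
  have \<sigma>x: "\<sigma> x = y" "\<sigma> y = \<tau> x" using \<tau>y by (auto simp: \<sigma>_def)
  have \<sigma>z: "\<sigma> z = \<tau> z" if "z \<noteq> x" "z \<noteq> y" for z using that by (simp add: \<sigma>_def transpose_apply_other)
  have sub: "orbit \<tau> z \<subseteq> S" if "z \<in> S" for z by (rule permutes_orbit_subset[OF \<tau> that])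
  show 1: "orbit \<sigma> x = insert y (orbit \<tau> x)"
  proof
    show "orbit \<sigma> x \<subseteq> insert y (orbit \<tau> x)"
    proof
      fix u assume "u \<in> orbit \<sigma> x"
      thus "u \<in> insert y (orbit \<tau> x)"
      proof induction
        case base
        show ?case by (simp add: \<sigma>x)
      next
        case (step u)
        show ?case
        proof (cases "u = y \<or> u = x")
          case True
          thus ?thesis by (auto simp: \<sigma>x intro: orbit.base)
        next
          case False
          thus ?thesis using step.IH by (auto simp: \<sigma>z intro: orbit.step)
        qed
      qed
    qed
    have y_in: "y \<in> orbit \<sigma> x" using orbit.base[of \<sigma> x] by (simp add: \<sigma>x)
    have "\<tau> x \<in> orbit \<sigma> x" using orbit.step[OF y_in] by (simp add: \<sigma>x)
    have "u \<in> orbit \<sigma> x" if "u \<in> orbit \<tau> x" for u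
      using that
    proof induction
      case base
      show ?case by fact
    next
      case (step u)
      have "u \<noteq> y" using sub[OF x] step.hyps y by auto
      thus ?case using step.IH \<open>\<tau> x \<in> orbit \<sigma> x\<close> orbit.step[OF step.IH] by (cases "u = x") (auto simp: \<sigma>z)
    qed
    thus "insert y (orbit \<tau> x) \<subseteq> orbit \<sigma> x" using y_in by auto
  qed
  fix z assume z: "z \<in> S" "z \<notin> orbit \<tau> x"
  have avoid: "u \<noteq> x \<and> u \<noteq> y" if "u \<in> orbit \<tau> z" for u
  proof
    show "u \<noteq> y" using sub[OF z(1)] that y by auto
    show "u \<noteq> x"
    proof
      assume "u = x"
      hence "orbit \<tau> x = orbit \<tau> z" using orbit_eq_of_mem[OF \<tau> fin that] by simp
      thus False using z(2) self_in_orbit[OF \<tau> fin, of z] by simp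
    qed
  qed
  show "orbit \<sigma> z = orbit \<tau> z"
    by (rule orbit_cong0[of z "orbit \<tau> z"])
       (use avoid self_in_orbit[OF \<tau> fin, of z] in \<open>auto simp: \<sigma>z intro: orbit.step\<close>)
qed

definition cycle_perms :: "(nat \<Rightarrow> bool) \<Rightarrow> 'a set \<Rightarrow> ('a \<Rightarrow> 'a) set" where
  "cycle_perms P S = {\<sigma>. \<sigma> permutes S \<and> (\<forall>y\<in>S. P (card (orbit \<sigma> y)))}"

text \<open>In the second family the cycle through \<open>x\<close> is counted as if it were longer by \<open>l\<close>; this
  makes removing the successor of \<open>x\<close> from its cycle a bijection.\<close>
definition marked_perms :: "(nat \<Rightarrow> bool) \<Rightarrow> 'a set \<Rightarrow> 'a \<Rightarrow> nat \<Rightarrow> ('a \<Rightarrow> 'a) set" where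
  "marked_perms P S x l = {\<sigma>. \<sigma> permutes S \<and> P (card (orbit \<sigma> x) + l) \<and> (\<forall>y\<in>S - orbit \<sigma> x. P (card (orbit \<sigma> y)))}"

lemma finite_marked_perms: "finite S \<Longrightarrow> finite (marked_perms P S x l)"
  by (rule finite_subset[OF _ finite_permutations]) (auto simp: marked_perms_def)

lemma marked_perms_0:
  assumes "finite S" "x \<in> S"
  shows "marked_perms P S x 0 = cycle_perms P S"
proof (intro equalityI subsetI)
  fix \<sigma> assume \<sigma>: "\<sigma> \<in> marked_perms P S x 0"
  hence p: "\<sigma> permutes S" by (simp add: marked_perms_def)
  have "P (card (orbit \<sigma> y))" if "y \<in> S" for y
    using \<sigma> that orbit_eq_of_mem[OF p assms(1), of y x] by (cases "y \<in> orbit \<sigma> x") (auto simp: marked_perms_def)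
  thus "\<sigma> \<in> cycle_perms P S" using p by (simp add: cycle_perms_def)
next
  fix \<sigma> assume "\<sigma> \<in> cycle_perms P S"
  thus "\<sigma> \<in> marked_perms P S x 0" using assms by (auto simp: cycle_perms_def marked_perms_def)
qed

text \<open>Classify by the image of x. A fixed point x forms a cycle of counted length l + 1.
  Otherwise the image y is cut out of the cycle and l grows by one to preserve the counted
  length.\<close>

lemma card_marked_perms:
  assumes fin: "finite S" and x: "x \<in> S"
  shows "card (marked_perms P S x l) = (if P (Suc l) then card (cycle_perms P (S - {x})) else 0) +
           (\<Sum>y\<in>S - {x}. card (marked_perms P (S - {y}) x (Suc l)))"
proof -
  define M where "M = (\<lambda>y. {\<sigma> \<in> marked_perms P S x l. \<sigma> x = y})"
  have finM: "finite (M y)" for y unfolding M_def using finite_marked_perms[OF fin] by simp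
  have "marked_perms P S x l = (\<Union>y\<in>S. M y)"
    using x by (auto simp: M_def marked_perms_def permutes_in_image)
  hence "card (marked_perms P S x l) = (\<Sum>y\<in>S. card (M y))"
    using finM fin by (simp only:) (subst card_UN_disjoint, auto simp: M_def)
  also have "\<dots> = card (M x) + (\<Sum>y\<in>S - {x}. card (M y))"
    using fin x by (rule sum.remove)
  also have "card (M x) = (if P (Suc l) then card (cycle_perms P (S - {x})) else 0)"
  proof -
    have "M x = (if P (Suc l) then cycle_perms P (S - {x}) else {})"
    proof -
      have fixed: "\<sigma> permutes S \<and> \<sigma> x = x \<longleftrightarrow> \<sigma> permutes (S - {x})" for \<sigma> :: "'a \<Rightarrow> 'a"
        using permutes_superset[of \<sigma> S "S - {x}"] permutes_subset[of \<sigma> "S - {x}" S] permutes_not_in[of \<sigma> "S - {x}" x] by auto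
      have "\<sigma> \<in> M x \<longleftrightarrow> P (Suc l) \<and> \<sigma> \<in> cycle_perms P (S - {x})" for \<sigma>
      proof (cases "\<sigma> x = x")
        case True
        hence "orbit \<sigma> x = {x}" by (simp add: orbit_eq_singleton_iff)
        thus ?thesis using fixed[of \<sigma>] True by (auto simp: M_def marked_perms_def cycle_perms_def)
      next
        case False
        thus ?thesis using fixed[of \<sigma>] by (auto simp: M_def cycle_perms_def)
      qed
      thus ?thesis by auto
    qed
    thus ?thesis by simp
  qed
  also have "(\<Sum>y\<in>S - {x}. card (M y)) = (\<Sum>y\<in>S - {x}. card (marked_perms P (S - {y}) x (Suc l)))"
  proof (rule sum.cong[OF refl])
    fix y assume y: "y \<in> S - {x}"
    \<comment> \<open>An involution: it both cuts y out of the cycle after x and puts it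
      back.\<close>
    define f where "f = (\<lambda>\<tau> :: 'a \<Rightarrow> 'a. \<tau> \<circ> Transposition.transpose x y)"
    have ff: "f (f \<tau>) = \<tau>" for \<tau> :: "'a \<Rightarrow> 'a" by (auto simp: f_def fun_eq_iff)
    have S': "finite (S - {y})" "x \<in> S - {y}" "y \<notin> S - {y}" using fin x y by auto
    have key: "f \<tau> \<in> M y \<longleftrightarrow> \<tau> \<in> marked_perms P (S - {y}) x (Suc l)" if \<tau>: "\<tau> permutes (S - {y})" for \<tau>
    proof -
      have fe: "f \<tau> = \<tau> \<circ> Transposition.transpose x y" by (simp add: f_def)
      note oi = orbit_insert[OF \<tau> S', folded fe]
      have sub: "orbit \<tau> x \<subseteq> S - {y}" by (rule permutes_orbit_subset[OF \<tau> S'(2)])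
      have "\<tau> permutes S" using permutes_subset[OF \<tau>] by auto
      hence pf: "f \<tau> permutes S" unfolding f_def using x y by (intro permutes_compose permutes_swap_id) auto
      have fx: "f \<tau> x = y" using permutes_not_in[OF \<tau> S'(3)] by (simp add: f_def)
      have "card (orbit (f \<tau>) x) = Suc (card (orbit \<tau> x))"
        unfolding oi(1) using sub fin by (subst card_insert_disjoint) (auto intro: finite_subset)
      moreover have "S - orbit (f \<tau>) x = (S - {y}) - orbit \<tau> x" unfolding oi(1) by auto
      ultimately show ?thesis
        using pf fx \<tau> oi(2) by (auto simp: M_def marked_perms_def)
    qed
    have "M y = f ` marked_perms P (S - {y}) x (Suc l)"
    proof (intro equalityI subsetI)
      fix \<sigma> assume \<sigma>: "\<sigma> \<in> M y"
      have p: "\<sigma> permutes S" "\<sigma> x = y" using \<sigma> by (auto simp: M_def marked_perms_def)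
      have "f \<sigma> permutes S" unfolding f_def using x y p by (intro permutes_compose permutes_swap_id) auto
      hence "f \<sigma> permutes (S - {y})" by (rule permutes_superset) (use p y in \<open>auto simp: f_def\<close>)
      hence "f \<sigma> \<in> marked_perms P (S - {y}) x (Suc l)" using key[of "f \<sigma>"] \<sigma> ff[of \<sigma>] by simp
      thus "\<sigma> \<in> f ` marked_perms P (S - {y}) x (Suc l)" using ff[of \<sigma>] by (metis imageI)
    next
      fix \<sigma> assume "\<sigma> \<in> f ` marked_perms P (S - {y}) x (Suc l)"
      thus "\<sigma> \<in> M y" using key by (auto simp: marked_perms_def)
    qed
    moreover have "inj_on f A" for A by (rule inj_on_inverseI[of _ f]) (rule ff)
    ultimately show "card (M y) = card (marked_perms P (S - {y}) x (Suc l))" by (simp add: card_image)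
  qed
  finally show ?thesis .
qed

text \<open>The marked formula in the induction reads: there are (n - 1)! / (n - j)! cycles of
  length j through x, and (n - j)! a(n - j) admissible permutations of the rest. With l = 0 and
  \<open>rec\<close> it gives the unmarked count. Both go through one induction because the marked
  count uses the unmarked one for a smaller set.\<close>

lemma card_cycle_perms:
  fixes a :: "nat \<Rightarrow> real" and S :: "'a set"
  assumes a0: "a 0 = 1"
    and rec: "\<And>n. n \<ge> 1 \<Longrightarrow> real n * a n = (\<Sum>j | j \<in> {1..n} \<and> P j. a (n - j))"
    and "finite S" "card S = n"
  shows "real (card (cycle_perms P S)) = fact n * a n"
proof -
  have "(\<forall>S::'a set. finite S \<longrightarrow> card S = n \<longrightarrow> real (card (cycle_perms P S)) = fact n * a n) \<and>
        (\<forall>(S::'a set) x l. finite S \<longrightarrow> card S = n \<longrightarrow> x \<in> S \<longrightarrow>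
          real (card (marked_perms P S x l)) = fact (n - 1) * (\<Sum>j | j \<in> {1..n} \<and> P (j + l). a (n - j)))" for n
  proof (induction n)
    case 0
    have "cycle_perms P ({} :: 'a set) = {id}" by (auto simp: cycle_perms_def)
    thus ?case by (auto simp: a0)
  next
    case (Suc n)
    note IH1 = Suc.IH[THEN conjunct1, rule_format] and IH2 = Suc.IH[THEN conjunct2, rule_format]
    have M: "real (card (marked_perms P S x l)) = fact n * (\<Sum>j | j \<in> {1..Suc n} \<and> P (j + l). a (Suc n - j))"
      if S: "finite S" "card S = Suc n" "x \<in> S" for S :: "'a set" and x l
    proof -
      define W where "W = (\<Sum>j | j \<in> {1..n} \<and> P (j + Suc l). a (n - j))"
      have "real (card (marked_perms P S x l)) = (if P (Suc l) then real (card (cycle_perms P (S - {x}))) else 0) +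
           (\<Sum>y\<in>S - {x}. real (card (marked_perms P (S - {y}) x (Suc l))))"
        using card_marked_perms[OF S(1,3)] by simp
      also have "real (card (cycle_perms P (S - {x}))) = fact n * a n"
        using S by (intro IH1) auto
      also have "(\<Sum>y\<in>S - {x}. real (card (marked_perms P (S - {y}) x (Suc l)))) = (\<Sum>y\<in>S - {x}. fact (n - 1) * W)"
        unfolding W_def using S by (intro sum.cong refl IH2) auto
      also have "\<dots> = real n * (fact (n - 1) * W)" using S by simp
      \<comment> \<open>For n = 0 both sides vanish, as W is an empty sum; otherwise n (n - 1)! =
        n!.\<close>
      also have "\<dots> = fact n * W"
        by (cases n) (auto simp: W_def)
      also have "(if P (Suc l) then fact n * a n else 0) + fact n * W = fact n * ((if P (1 + l) then a (Suc n - 1) else 0) + W)"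
        by (simp add: algebra_simps)
      also have "(if P (1 + l) then a (Suc n - 1) else 0) + W = (\<Sum>j | j \<in> {1..Suc n} \<and> P (j + l). a (Suc n - j))"
      proof -
        have "(\<Sum>j | j \<in> {1..Suc n} \<and> P (j + l). a (Suc n - j)) = (\<Sum>j=1..Suc n. if P (j + l) then a (Suc n - j) else 0)"
          by (rule sum.inter_filter) simp
        also have "\<dots> = (if P (1 + l) then a (Suc n - 1) else 0) + (\<Sum>j=1..n. if P (Suc j + l) then a (n - j) else 0)"
          by (subst sum.atLeast_Suc_atMost, simp, subst sum.shift_bounds_cl_Suc_ivl) (simp cong: if_cong)
        also have "(\<Sum>j=1..n. if P (Suc j + l) then a (n - j) else 0) = W"
          unfolding W_def add_Suc add_Suc_right by (rule sum.inter_filter[symmetric]) simp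
        finally show ?thesis by simp
      qed
      finally show ?thesis .
    qed
    have "real (card (cycle_perms P S)) = fact (Suc n) * a (Suc n)"
      if S: "finite S" "card S = Suc n" for S :: "'a set"
    proof -
      obtain x where x: "x \<in> S" using S by fastforce
      have "real (card (cycle_perms P S)) = fact n * (\<Sum>j | j \<in> {1..Suc n} \<and> P j. a (Suc n - j))"
        using M[OF S x, of 0] marked_perms_0[OF S(1) x, of P] by simp
      also have "(\<Sum>j | j \<in> {1..Suc n} \<and> P j. a (Suc n - j)) = real (Suc n) * a (Suc n)"
        by (rule rec[symmetric]) simp
      finally show ?thesis by simp
    qed
    thus ?case using M by auto
  qed
  thus ?thesis using assms(3,4) by blast
qed

section \<open>Permutations without cycle lengths divisible by d\<close>

text \<open>The coefficients of (1 - w)^(1/d - 1). The generating function of permutations without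
  cycle lengths divisible by d is (1 - z^d)^(1/d) / (1 - z), so with w = z^d each coefficient occurs
  d times in a row; hence the argument n div d later.\<close>

definition no_multiple_prob :: "nat \<Rightarrow> nat \<Rightarrow> real" where
  "no_multiple_prob d m = (\<Prod>i=1..m. 1 - 1 / (real i * real d))"

text \<open>Strong induction from k = n - d to n. The sum over m = n - j gains the indices strictly
  between k and k + d, where m div d takes only the values q = k div d and q + 1, and the recursion
  for the product combines them.\<close>

lemma no_multiple_prob_recurrence:
  assumes d: "d > 0" and n: "n \<ge> 1"
  shows "real n * no_multiple_prob d (n div d) = (\<Sum>j | j \<in> {1..n} \<and> \<not> d dvd j. no_multiple_prob d ((n - j) div d))"
proof -
  define b where "b = no_multiple_prob d"
  define W where "W = (\<lambda>n. \<Sum>m | m < n \<and> \<not> d dvd (n - m). b (m div d))"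
  have bSuc: "real (Suc q) * real d * b (Suc q) = (real (Suc q) * real d - 1) * b q" for q
  proof -
    have "u * (B * (1 - 1 / u)) = (u - 1) * B" if "u \<noteq> 0" for u B :: real using that by (simp add: field_simps)
    from this[of "real (Suc q) * real d" "b q"] show ?thesis
      using d by (simp add: b_def no_multiple_prob_def)
  qed
  have "W n = real n * b (n div d)" for n
  proof (induction n rule: less_induct)
    case (less n)
    show ?case
    proof (cases "n < d")
      case True
      have "{m. m < n \<and> \<not> d dvd (n - m)} = {..<n}" using True by (auto dest: dvd_imp_le)
      moreover have "b (m div d) = 1" if "m < d" for m using that by (simp add: b_def no_multiple_prob_def)
      ultimately show ?thesis using True by (simp add: W_def)
    next
      case False
      define k where "k = n - d"
      have k: "n = k + d" "k < n" using False d by (auto simp: k_def)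
      define q r where "q = k div d" "r = k mod d"
      have kqr: "k = q * d + r" "r < d" using d by (auto simp: q_r_def)
      have set: "{m. m < n \<and> \<not> d dvd (n - m)} = {m. m < k \<and> \<not> d dvd (k - m)} \<union> ({Suc k..<Suc q * d} \<union> {Suc q * d..<k + d})"
      proof (intro equalityI subsetI)
        fix m assume m: "m \<in> {m. m < n \<and> \<not> d dvd (n - m)}"
        show "m \<in> {m. m < k \<and> \<not> d dvd (k - m)} \<union> ({Suc k..<Suc q * d} \<union> {Suc q * d..<k + d})"
        proof (cases "m < k")
          case True
          hence "n - m = (k - m) + d" using k by simp
          hence "d dvd (n - m) \<longleftrightarrow> d dvd (k - m)" by (simp only: dvd_add_triv_right_iff)
          thus ?thesis using m True by blast
        next
          case False
          have "m \<noteq> k" using m k by auto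
          thus ?thesis using m False k by auto
        qed
      next
        fix m assume m: "m \<in> {m. m < k \<and> \<not> d dvd (k - m)} \<union> ({Suc k..<Suc q * d} \<union> {Suc q * d..<k + d})"
        consider "m < k" "\<not> d dvd (k - m)" | "k < m" "m < k + d"
          using m kqr by auto
        thus "m \<in> {m. m < n \<and> \<not> d dvd (n - m)}"
        proof cases
          case 1
          hence "n - m = (k - m) + d" using k by simp
          hence "d dvd (n - m) \<longleftrightarrow> d dvd (k - m)" by (simp only: dvd_add_triv_right_iff)
          thus ?thesis using 1 k by simp
        next
          case 2
          hence "0 < n - m" "n - m < d" using k by auto
          thus ?thesis using 2 k by (auto dest: dvd_imp_le)
        qed
      qed
      have "W n = W k + ((\<Sum>m\<in>{Suc k..<Suc q * d}. b (m div d)) + (\<Sum>m\<in>{Suc q * d..<k + d}. b (m div d)))"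
      proof -
        have kq: "k < Suc q * d" using kqr by simp
        have "(\<Sum>m\<in>{Suc k..<Suc q * d} \<union> {Suc q * d..<k + d}. b (m div d)) =
            (\<Sum>m\<in>{Suc k..<Suc q * d}. b (m div d)) + (\<Sum>m\<in>{Suc q * d..<k + d}. b (m div d))"
          by (intro sum.union_disjoint) auto
        moreover have "W n = W k + (\<Sum>m\<in>{Suc k..<Suc q * d} \<union> {Suc q * d..<k + d}. b (m div d))"
          unfolding W_def set using kq by (intro sum.union_disjoint) auto
        ultimately show ?thesis by simp
      qed
      also have "(\<Sum>m\<in>{Suc k..<Suc q * d}. b (m div d)) = (\<Sum>m\<in>{Suc k..<Suc q * d}. b q)"
      proof (intro sum.cong refl arg_cong[of _ _ b])
        fix m assume "m \<in> {Suc k..<Suc q * d}"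
        hence "q * d \<le> m" "m < Suc q * d" using kqr by auto
        thus "m div d = q" by (intro div_nat_eqI) (auto simp: mult.commute)
      qed
      also have "(\<Sum>m\<in>{Suc q * d..<k + d}. b (m div d)) = (\<Sum>m\<in>{Suc q * d..<k + d}. b (Suc q))"
      proof (intro sum.cong refl arg_cong[of _ _ b])
        fix m assume "m \<in> {Suc q * d..<k + d}"
        hence "Suc q * d \<le> m" "m < Suc (Suc q) * d" using kqr by auto
        thus "m div d = Suc q" by (intro div_nat_eqI) (auto simp: mult.commute)
      qed
      also have "W k = real k * b q" using less.IH[OF k(2)] by (simp add: q_r_def)
      also have "(\<Sum>m\<in>{Suc k..<Suc q * d}. b q) = (real d - 1 - real r) * b q"
      proof -
        have "Suc q * d - Suc k = d - 1 - r" using kqr by simp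
        moreover have "real (d - 1 - r) = real d - 1 - real r" using kqr by (simp add: of_nat_diff)
        ultimately show ?thesis by simp
      qed
      also have "(\<Sum>m\<in>{Suc q * d..<k + d}. b (Suc q)) = real r * b (Suc q)"
        using kqr by simp
      also have "real k * b q + ((real d - 1 - real r) * b q + real r * b (Suc q)) = real n * b (Suc q)"
      proof -
        have "real k = real q * real d + real r" using kqr(1) by simp
        hence "real k * b q + ((real d - 1 - real r) * b q + real r * b (Suc q)) = (real (Suc q) * real d - 1) * b q + real r * b (Suc q)"
          by (simp add: algebra_simps)
        also have "\<dots> = (real (Suc q) * real d + real r) * b (Suc q)" unfolding bSuc[symmetric] by (simp add: algebra_simps)
        also have "real (Suc q) * real d + real r = real n" using kqr(1) k(1) by (simp add: algebra_simps)
        finally show ?thesis .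
      qed
      also have "Suc q = n div d" using k(1) d by (simp add: q_r_def)
      finally show ?thesis .
    qed
  qed
  moreover have "W n = (\<Sum>j | j \<in> {1..n} \<and> \<not> d dvd j. b ((n - j) div d))"
    unfolding W_def by (rule sum.reindex_bij_witness[of _ "\<lambda>j. n - j" "\<lambda>m. n - m"]) auto
  ultimately show ?thesis by (simp add: b_def)
qed

lemma card_perms_no_multiple:
  assumes "d > 0" "finite S"
  shows "real (card (cycle_perms (\<lambda>k. \<not> d dvd k) S)) = fact (card S) * no_multiple_prob d (card S div d)"
  by (rule card_cycle_perms[where a = "\<lambda>n. no_multiple_prob d (n div d)"])
     (use assms no_multiple_prob_recurrence in \<open>auto simp: no_multiple_prob_def\<close>)

section \<open>The order as a sum over prime powers\<close>

text \<open>The exponent of p in an lcm is the largest exponent among the entries. For divisors that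
  are not prime powers the equivalence can fail, but there \<open>mangoldt\<close> vanishes.\<close>

lemma prime_power_dvd_Lcm_iff:
  fixes A :: "nat set"
  assumes p: "prime p" and k: "k > 0" and "finite A" "0 \<notin> A"
  shows "p ^ k dvd Lcm A \<longleftrightarrow> (\<exists>a\<in>A. p ^ k dvd a)"
  using assms(3,4)
proof (induction rule: finite_induct)
  case empty
  have "p ^ k \<noteq> 1" using p k by (metis not_prime_unit prime_power_iff dvd_refl is_unit_power_iff gr_implies_not0)
  thus ?case by simp
next
  case (insert a A)
  have nz: "a \<noteq> 0" "Lcm A \<noteq> 0" using insert by (auto simp: Lcm_0_iff_nat)
  have "p ^ k dvd lcm a (Lcm A) \<longleftrightarrow> p ^ k dvd a \<or> p ^ k dvd Lcm A"
    using p nz multiplicity_lcm[OF nz, of p] by (auto simp: power_dvd_iff_le_multiplicity multiplicity_lcm prime_nat_iff le_max_iff_disj)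
  thus ?case using insert by auto
qed

lemma ln_Lcm_eq:
  fixes A :: "nat set"
  assumes A: "A \<subseteq> {1..n}"
  shows "ln (real (Lcm A)) = (\<Sum>d=1..n. mangoldt d * of_bool (\<exists>a\<in>A. d dvd a))"
proof -
  have fin: "finite A" and "0 \<notin> A" using A finite_subset by auto
  hence L: "Lcm A \<noteq> 0" by (simp add: Lcm_0_iff_nat)
  have iff: "d dvd Lcm A \<longleftrightarrow> (\<exists>a\<in>A. d dvd a)" if "mangoldt d \<noteq> (0::real)" for d
  proof -
    have "primepow d" using that by (auto simp: mangoldt_def split: if_splits)
    then obtain p k where "prime p" "k > 0" "d = p ^ k" by (auto simp: primepow_def)
    thus ?thesis using prime_power_dvd_Lcm_iff[of p k A] fin \<open>0 \<notin> A\<close> by simp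
  qed
  have "ln (real (Lcm A)) = (\<Sum>d | d dvd Lcm A. mangoldt d)" using mangoldt_sum[OF L, where ?'a = real] by simp
  also have "\<dots> = (\<Sum>d\<in>{d. d dvd Lcm A} \<union> {1..n}. mangoldt d * of_bool (\<exists>a\<in>A. d dvd a))"
  proof (rule sum.mono_neutral_cong_left)
    show "finite ({d. d dvd Lcm A} \<union> {1..n})" using L by simp
    show "\<forall>i\<in>{d. d dvd Lcm A} \<union> {1..n} - {d. d dvd Lcm A}. mangoldt i * of_bool (\<exists>a\<in>A. i dvd a) = (0::real)"
      using iff by (auto simp: of_bool_def)
    show "mangoldt d = (mangoldt d * of_bool (\<exists>a\<in>A. d dvd a) :: real)" if "d \<in> {d. d dvd Lcm A}" for d
      using that iff[of d] by (cases "mangoldt d = (0::real)") auto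
  qed auto
  also have "\<dots> = (\<Sum>d=1..n. mangoldt d * of_bool (\<exists>a\<in>A. d dvd a))"
  proof (rule sum.mono_neutral_right)
    show "finite ({d. d dvd Lcm A} \<union> {1..n})" using L by simp
    show "\<forall>d\<in>{d. d dvd Lcm A} \<union> {1..n} - {1..n}. mangoldt d * of_bool (\<exists>a\<in>A. d dvd a) = (0::real)"
    proof
      fix d assume d: "d \<in> {d. d dvd Lcm A} \<union> {1..n} - {1..n}"
      have "\<not> (\<exists>a\<in>A. d dvd a)"
      proof
        assume "\<exists>a\<in>A. d dvd a"
        then obtain a where a: "a \<in> A" "d dvd a" by blast
        hence "a \<in> {1..n}" using A by auto
        hence "d \<in> {1..n}" using a(2) dvd_imp_le[of d a] by (auto intro!: Nat.gr0I simp: Suc_le_eq)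
        thus False using d by simp
      qed
      thus "mangoldt d * of_bool (\<exists>a\<in>A. d dvd a) = (0::real)" by simp
    qed
  qed auto
  finally show ?thesis .
qed

lemma expectation_ln_order:
  "measure_pmf.expectation (sym_group_pmf n) (\<lambda>\<sigma>. ln (real (O_lcm n (cycle_count n \<sigma>)))) =
     (\<Sum>d=1..n. mangoldt d * (1 - no_multiple_prob d (n div d)))"
proof -
  define S where "S = {1..n}"
  define A where "A = {\<sigma>. \<sigma> permutes S}"
  have fS: "finite S" by (simp add: S_def)
  have fin: "finite A" unfolding A_def by (rule finite_permutations[OF fS])
  have cA: "card A = fact n" unfolding A_def using card_permutations[of S n] by (simp add: S_def)
  have ne: "A \<noteq> {}" using permutes_id[of S] unfolding A_def by blast
  have val: "ln (real (O_lcm n (cycle_count n \<sigma>))) = (\<Sum>d=1..n. mangoldt d * (1 - of_bool (\<sigma> \<in> cycle_perms (\<lambda>k. \<not> d dvd k) S)))"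
    if \<sigma>: "\<sigma> \<in> A" for \<sigma>
  proof -
    have p: "\<sigma> permutes S" using \<sigma> by (simp add: A_def)
    have sub: "orbit \<sigma> y \<subseteq> S" if "y \<in> S" for y by (rule permutes_orbit_subset[OF p that])
    have "{i \<in> {1..n}. cycle_count n \<sigma> i > 0} = (\<lambda>y. card (orbit \<sigma> y)) ` S"
    proof (intro equalityI subsetI)
      fix i assume "i \<in> {i \<in> {1..n}. cycle_count n \<sigma> i > 0}"
      hence "{C \<in> orbit \<sigma> ` {1..n}. card C = i} \<noteq> {}" by (auto simp: cycle_count_def card_gt_0_iff)
      thus "i \<in> (\<lambda>y. card (orbit \<sigma> y)) ` S" by (auto simp: S_def)
    next
      fix i assume "i \<in> (\<lambda>y. card (orbit \<sigma> y)) ` S"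
      then obtain y where y: "y \<in> S" "i = card (orbit \<sigma> y)" by auto
      have "finite (orbit \<sigma> y)" using sub[OF y(1)] fS by (rule finite_subset)
      hence "i \<ge> 1" using y(2) self_in_orbit[OF p fS, of y] by (metis One_nat_def Suc_leI card_gt_0_iff empty_iff)
      moreover have "i \<le> n" using card_mono[OF fS sub[OF y(1)]] y(2) by (simp add: S_def)
      moreover have "orbit \<sigma> y \<in> {C \<in> orbit \<sigma> ` {1..n}. card C = i}" using y by (auto simp: S_def)
      hence "cycle_count n \<sigma> i > 0" unfolding cycle_count_def by (subst card_gt_0_iff) auto
      ultimately show "i \<in> {i \<in> {1..n}. cycle_count n \<sigma> i > 0}" by simp
    qed
    hence "ln (real (O_lcm n (cycle_count n \<sigma>))) = (\<Sum>d=1..n. mangoldt d * of_bool (\<exists>a\<in>(\<lambda>y. card (orbit \<sigma> y)) ` S. d dvd a))"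
      unfolding O_lcm_def by (subst ln_Lcm_eq[symmetric, of _ n]) (auto simp: S_def)
    also have "\<dots> = (\<Sum>d=1..n. mangoldt d * (1 - of_bool (\<sigma> \<in> cycle_perms (\<lambda>k. \<not> d dvd k) S)))"
      using p by (intro sum.cong refl) (auto simp: cycle_perms_def)
    finally show ?thesis .
  qed
  have "measure_pmf.expectation (sym_group_pmf n) (\<lambda>\<sigma>. ln (real (O_lcm n (cycle_count n \<sigma>)))) =
      (\<Sum>\<sigma>\<in>A. ln (real (O_lcm n (cycle_count n \<sigma>)))) / real (card A)"
    unfolding sym_group_pmf_def A_def S_def by (rule integral_pmf_of_set) (use ne fin in \<open>auto simp: A_def S_def\<close>)
  also have "(\<Sum>\<sigma>\<in>A. ln (real (O_lcm n (cycle_count n \<sigma>)))) = (\<Sum>\<sigma>\<in>A. \<Sum>d=1..n. mangoldt d * (1 - of_bool (\<sigma> \<in> cycle_perms (\<lambda>k. \<not> d dvd k) S)))"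
    by (intro sum.cong refl val)
  also have "\<dots> = (\<Sum>d=1..n. mangoldt d * (\<Sum>\<sigma>\<in>A. 1 - of_bool (\<sigma> \<in> cycle_perms (\<lambda>k. \<not> d dvd k) S)))"
    by (subst sum.swap) (simp add: sum_distrib_left)
  also have "\<dots> = (\<Sum>d=1..n. mangoldt d * (fact n * (1 - no_multiple_prob d (n div d))))"
  proof (intro sum.cong refl)
    fix d assume d: "d \<in> {1..n}"
    have "(\<Sum>\<sigma>\<in>A. 1 - of_bool (\<sigma> \<in> cycle_perms (\<lambda>k. \<not> d dvd k) S)) = real (card A) - real (card (A \<inter> cycle_perms (\<lambda>k. \<not> d dvd k) S))"
      using fin by (simp add: sum_subtractf Int_def)
    also have "A \<inter> cycle_perms (\<lambda>k. \<not> d dvd k) S = cycle_perms (\<lambda>k. \<not> d dvd k) S"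
      by (auto simp: A_def cycle_perms_def)
    also have "real (card (cycle_perms (\<lambda>k. \<not> d dvd k) S)) = fact n * no_multiple_prob d (n div d)"
      using card_perms_no_multiple[of d S] d by (simp add: S_def)
    finally have "(\<Sum>\<sigma>\<in>A. 1 - of_bool (\<sigma> \<in> cycle_perms (\<lambda>k. \<not> d dvd k) S)) = (fact n * (1 - no_multiple_prob d (n div d)) :: real)"
      by (simp add: cA right_diff_distrib)
    thus "mangoldt d * (\<Sum>\<sigma>\<in>A. 1 - of_bool (\<sigma> \<in> cycle_perms (\<lambda>k. \<not> d dvd k) S)) = mangoldt d * (fact n * (1 - no_multiple_prob d (n div d)) :: real)"
      by (simp only:)
  qed
  also have "\<dots> / real (card A) = (\<Sum>d=1..n. mangoldt d * (1 - no_multiple_prob d (n div d)))"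
    by (simp add: cA sum_divide_distrib)
  finally show ?thesis .
qed

section \<open>The elementary reduction\<close>

lemma harm_le_ln: "m \<ge> 1 \<Longrightarrow> harm m \<le> 1 + ln (real m)"
proof -
  assume "m \<ge> 1"
  then obtain k where k: "m = Suc k" by (cases m) auto
  show ?thesis using decseqD[OF decseq_harm_diff_ln, of 0 k] by (simp add: k harm_expand)
qed

text \<open>This is where \<open>1 * \<Lambda> = ln\<close> turns the first-order term of the expectation into a sum without primes.\<close>
lemma sum_mangoldt_harm:
  "(\<Sum>d=1..n. mangoldt d * harm (n div d) / real d) = (\<Sum>m=1..n. ln (real m) / real m)"
proof -
  have "(\<Sum>m=1..n. ln (real m) / real m) = (\<Sum>m=1..n. \<Sum>d | d dvd m. mangoldt d / real m)"
  proof (intro sum.cong refl)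
    fix m assume "m \<in> {1..n}"
    hence "m \<noteq> 0" by auto
    from mangoldt_sum[OF this, where ?'a = real]
    show "ln (real m) / real m = (\<Sum>d | d dvd m. mangoldt d / real m)" by (simp add: sum_divide_distrib[symmetric])
  qed
  also have "\<dots> = (\<Sum>(m, d)\<in>(SIGMA m:{1..n}. {d. d dvd m}). mangoldt d / real m)"
    by (rule sum.Sigma) auto
  also have "\<dots> = (\<Sum>(d, k)\<in>(SIGMA d:{1..n}. {1..n div d}). mangoldt d / (real d * real k))"
  proof (rule sum.reindex_bij_witness[of _ "\<lambda>(d, k). (d * k, d)" "\<lambda>(m, d). (d, m div d)"], goal_cases)
    case (2 x)
    then obtain m d where x: "x = (m, d)" "1 \<le> m" "m \<le> n" "d dvd m" by auto
    then obtain k where k: "m = d * k" by (elim dvdE)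
    hence p: "d > 0" "k > 0" using x by (auto intro!: Nat.gr0I)
    hence "d \<le> m" using k by simp
    hence "d \<le> n" using x(3) by simp
    moreover have "k \<le> n div d" using x(3) p by (simp add: k less_eq_div_iff_mult_less_eq mult.commute)
    ultimately show ?case using x p k by (simp add: Suc_le_eq)
  next
    case (4 y)
    then obtain d k where y: "y = (d, k)" "1 \<le> d" "d \<le> n" "1 \<le> k" "k \<le> n div d" by auto
    have "d * k \<le> n" using y by (simp add: less_eq_div_iff_mult_less_eq mult.commute)
    thus ?case using y by simp
  qed (auto simp: Suc_le_eq elim!: dvdE)
  also have "\<dots> = (\<Sum>d=1..n. \<Sum>k=1..n div d. mangoldt d / (real d * real k))"
    by (rule sum.Sigma[symmetric]) auto
  also have "\<dots> = (\<Sum>d=1..n. mangoldt d * harm (n div d) / real d)"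
    by (intro sum.cong refl) (simp add: harm_def sum_distrib_left sum_divide_distrib divide_inverse mult_ac)
  finally show ?thesis ..
qed

text \<open>ln t / t decreases for t >= e, so comparison with its integral makes D decreasing and D
  - f increasing from 3 on, since e <= 3.\<close>

lemma sum_ln_over:
  obtains C where "\<And>n. n \<ge> 3 \<Longrightarrow> \<bar>(\<Sum>m=1..n. ln (real m) / real m) - (ln (real n))\<^sup>2 / 2\<bar> \<le> C"
proof -
  define D where "D = (\<lambda>n. (\<Sum>m=1..n. ln (real m) / real m) - (ln (real n))\<^sup>2 / 2)"
  define f where "f = (\<lambda>n::nat. ln (real n) / real n)"
  have e3: "exp 1 \<le> (3::real)" by (rule exp_le)
  have step: "D (Suc n) \<le> D n \<and> D (Suc n) - f (Suc n) \<ge> D n - f n" if n: "n \<ge> 3" for n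
  proof -
    have "\<exists>z. real n < z \<and> z < real (Suc n) \<and> (ln (real (Suc n)))\<^sup>2 / 2 - (ln (real n))\<^sup>2 / 2 = (real (Suc n) - real n) * (ln z / z)"
    proof (rule MVT2)
      fix x assume "real n \<le> x" "x \<le> real (Suc n)"
      hence "x > 0" using n by auto
      thus "((\<lambda>x. (ln x)\<^sup>2 / 2) has_real_derivative ln x / x) (at x)"
        by (auto intro!: derivative_eq_intros)
    qed simp
    then obtain z where z: "real n < z" "z < real (Suc n)" "(ln (real (Suc n)))\<^sup>2 / 2 - (ln (real n))\<^sup>2 / 2 = ln z / z" by auto
    have n3: "exp 1 \<le> real n" using e3 n by simp
    have "ln z / z \<le> f n" unfolding f_def by (rule ln_x_over_x_mono) (use n3 z in auto)
    moreover have "f (Suc n) \<le> ln z / z" unfolding f_def by (rule ln_x_over_x_mono) (use n3 z in auto)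
    moreover have "D (Suc n) = D n + f (Suc n) - ln z / z" using z(3) by (simp add: D_def f_def)
    ultimately show ?thesis by linarith
  qed
  have bd: "D n \<le> D 3 \<and> D n - f n \<ge> D 3 - f 3" if "n \<ge> 3" for n
    using that
  proof (induction n rule: dec_induct)
    case (step k)
    thus ?case using \<open>\<And>n. n \<ge> 3 \<Longrightarrow> _\<close>[of k] by linarith
  qed auto
  show ?thesis
  proof (rule that[of "\<bar>D 3\<bar> + \<bar>f 3\<bar>"])
    fix n :: nat assume n: "n \<ge> 3"
    have "f n \<ge> 0" using n by (simp add: f_def)
    hence "\<bar>D n\<bar> \<le> \<bar>D 3\<bar> + \<bar>f 3\<bar>" using bd[OF n] by linarith
    thus "\<bar>(\<Sum>m=1..n. ln (real m) / real m) - (ln (real n))\<^sup>2 / 2\<bar> \<le> \<bar>D 3\<bar> + \<bar>f 3\<bar>"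
      by (simp only: D_def)
  qed
qed

lemma exp_defect_le_square: "y \<ge> 0 \<Longrightarrow> exp_defect y \<le> y\<^sup>2"
proof -
  assume y: "y \<ge> 0"
  have "exp (-y) = 1 / exp y" by (simp add: exp_minus inverse_eq_divide)
  also have "\<dots> \<le> 1 / (1 + y)" using y by (intro divide_left_mono) auto
  finally have "exp_defect y \<le> 1 / (1 + y) - 1 + y" by (simp add: exp_defect_def)
  also have "\<dots> = y\<^sup>2 / (1 + y)" using y by (simp add: field_simps power2_eq_square)
  also have "\<dots> \<le> y\<^sup>2 / 1" using y by (intro divide_left_mono) auto
  finally show ?thesis by simp
qed

lemma exp_defect_le: "y \<ge> 0 \<Longrightarrow> exp_defect y \<le> y"
  by (simp add: exp_defect_def)

text \<open>The derivative of \<open>exp_defect\<close> is 1 - exp (-y), which lies between 0 and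
  min 1 y. The gain of min 1 c over the Lipschitz constant 1 makes the later sum over d
  converge.\<close>

lemma exp_defect_diff_le:
  assumes "0 \<le> a" "0 \<le> b" "a \<le> c" "b \<le> c"
  shows "\<bar>exp_defect a - exp_defect b\<bar> \<le> \<bar>a - b\<bar> * min 1 c"
proof -
  have *: "\<bar>exp_defect a - exp_defect b\<bar> \<le> \<bar>a - b\<bar> * min 1 c" if "0 \<le> a" "a \<le> b" "b \<le> c" for a b
  proof -
    define \<delta> where "\<delta> = b - a"
    have \<delta>: "\<delta> \<ge> 0" using that by (simp add: \<delta>_def)
    have eq: "exp_defect b - exp_defect a = \<delta> - exp (- a) * (1 - exp (- \<delta>))"
      by (simp add: exp_defect_def \<delta>_def right_diff_distrib mult_exp_exp)
    have "exp (- a) * (1 - exp (- \<delta>)) \<le> 1 * \<delta>"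
      using that \<delta> exp_ge_add_one_self[of "- \<delta>"] by (intro mult_mono) auto
    hence 1: "exp_defect b - exp_defect a \<ge> 0" using eq by simp
    have "\<delta> * exp (- \<delta>) \<le> 1 - exp (- \<delta>)"
    proof -
      have "(1 + \<delta>) * exp (- \<delta>) \<le> exp \<delta> * exp (- \<delta>)" by (intro mult_right_mono) auto
      thus ?thesis by (simp add: algebra_simps mult_exp_exp)
    qed
    hence "exp (- a) * (\<delta> * exp (- \<delta>)) \<le> exp (- a) * (1 - exp (- \<delta>))" by (intro mult_left_mono) auto
    moreover have "exp (- a) * (\<delta> * exp (- \<delta>)) = \<delta> * exp (- b)"
      by (simp add: \<delta>_def mult_exp_exp mult.left_commute)
    ultimately have "exp_defect b - exp_defect a \<le> \<delta> * (1 - exp (- b))" using eq by (simp add: right_diff_distrib)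
    also have "1 - exp (- b) \<le> min 1 c" using exp_ge_add_one_self[of "- b"] that by auto
    hence "\<delta> * (1 - exp (- b)) \<le> \<delta> * min 1 c" using \<delta> by (rule mult_left_mono)
    finally show ?thesis using 1 that by (simp add: \<delta>_def)
  qed
  show ?thesis
    using *[of a b] *[of b a] assms by (cases "a \<le> b") (auto simp: abs_minus_commute)
qed

text \<open>All factors lie in {0..1}, so the products differ by at most the sum of the differences
  of the factors. Each difference is \<open>exp_defect u\<close>, at most u^2, with u = 1 / (i
  d).\<close>

lemma no_multiple_prob_approx:
  assumes d: "d \<ge> 2"
  shows "\<bar>no_multiple_prob d m - exp (- (harm m / real d))\<bar> \<le> 2 / (real d)\<^sup>2"
proof -
  have ex: "exp (- (harm m / real d)) = (\<Prod>i=1..m. exp (- (1 / (real i * real d))))"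
    unfolding exp_sum[OF finite_atLeastAtMost, symmetric]
    by (simp add: harm_def sum_negf sum_distrib_right divide_inverse)
  have id: "1 / (real i * real d) \<ge> 0" "1 / (real i * real d) \<le> 1" if "i \<in> {1..m}" for i
  proof -
    have "1 * 1 \<le> real i * real d" using that d by (intro mult_mono) auto
    thus "1 / (real i * real d) \<ge> 0" "1 / (real i * real d) \<le> 1" by (auto simp: divide_le_eq_1)
  qed
  have "norm ((\<Prod>i=1..m. 1 - 1 / (real i * real d)) - (\<Prod>i=1..m. exp (- (1 / (real i * real d)))))
      \<le> (\<Sum>i=1..m. norm ((1 - 1 / (real i * real d)) - exp (- (1 / (real i * real d)))))"
  proof (rule norm_prod_diff)
    fix i assume i: "i \<in> {1..m}"
    show "norm (1 - 1 / (real i * real d)) \<le> 1" "norm (exp (- (1 / (real i * real d)))) \<le> 1"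
      using id[OF i] by auto
  qed
  also have "\<dots> \<le> (\<Sum>i=1..m. 1 / (real i)\<^sup>2 / (real d)\<^sup>2)"
  proof (rule sum_mono)
    fix i assume i: "i \<in> {1..m}"
    define u where "u = 1 / (real i * real d)"
    have "norm ((1 - u) - exp (- u)) = exp_defect u"
      using exp_defect_nonneg[of u] by (simp add: exp_defect_def)
    also have "\<dots> \<le> u\<^sup>2" using id[OF i] by (intro exp_defect_le_square) (simp add: u_def)
    also have "\<dots> = 1 / (real i)\<^sup>2 / (real d)\<^sup>2" by (simp add: u_def power_divide power_mult_distrib)
    finally show "norm ((1 - 1 / (real i * real d)) - exp (- (1 / (real i * real d)))) \<le> 1 / (real i)\<^sup>2 / (real d)\<^sup>2"
      by (simp add: u_def)
  qed
  also have "\<dots> = (\<Sum>i=1..m. 1 / (real i)\<^sup>2) / (real d)\<^sup>2" by (simp only: sum_divide_distrib)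
  also have "(\<Sum>i=1..m. 1 / (real i)\<^sup>2) \<le> 2"
  proof -
    have "(\<Sum>i=1..m. 1 / (real i)\<^sup>2) \<le> 2 - 1 / real m" if "m \<ge> 1" for m
      using that
    proof (induction m rule: dec_induct)
      case (step k)
      have "1 / (real (Suc k))\<^sup>2 \<le> 1 / (real k * real (Suc k))"
        using step by (intro divide_left_mono) (auto simp: power2_eq_square)
      also have "\<dots> = 1 / real k - 1 / real (Suc k)" using step by (simp add: field_simps)
      finally show ?case using step.IH by simp
    qed auto
    from this[of m] show ?thesis
    proof (cases "m \<ge> 1")
      case True
      thus ?thesis using \<open>1 \<le> m \<Longrightarrow> _\<close> by (smt (verit) divide_nonneg_nonneg of_nat_0_le_iff)
    qed auto
  qed
  finally show ?thesis unfolding ex no_multiple_prob_def by (simp add: divide_right_mono)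
qed

section \<open>Weighted sums of the von Mangoldt function\<close>

text \<open>The simple pole at 1 accounts for 1 / eta, and the rest of the logarithmic derivative is
  continuous on {1..2}. This takes the role of a Chebyshev bound on primes.\<close>

lemma mangoldt_series_bound:
  obtains C where "C > 0" "\<And>\<eta>. 0 < \<eta> \<Longrightarrow> \<eta> \<le> 1 \<Longrightarrow>
     (\<Sum>n. mangoldt (Suc n) * real (Suc n) powr (-1 - \<eta>)) \<le> C / \<eta>"
proof -
  define q where "q = (\<lambda>e::real. deriv zeta_reg (of_real (1 + e)) / zeta_reg (of_real (1 + e)))"
  have nz: "zeta_reg (of_real (1 + e)) \<noteq> 0" if "e \<ge> 0" for e
    using that zeta_reg_nonzero_right[of "of_real (1 + e)"] by (cases "e = 0") auto
  have "continuous_on {0..1} q"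
    unfolding q_def using nz
    by (intro continuous_intros continuous_on_compose2[OF holomorphic_on_imp_continuous_on[OF deriv_zeta_reg_hol[of UNIV]]]
          continuous_on_compose2[OF holomorphic_on_imp_continuous_on[OF zeta_reg_hol[of UNIV]]]) auto
  hence "bounded (q ` {0..1})" by (intro compact_imp_bounded compact_continuous_image) auto
  then obtain B where B: "B > 0" "\<And>e. e \<in> {0..1} \<Longrightarrow> norm (q e) \<le> B" by (auto simp: bounded_pos)
  show ?thesis
  proof (rule that[of "1 + B"])
    fix \<eta> :: real assume \<eta>: "0 < \<eta>" "\<eta> \<le> 1"
    have sm: "summable (\<lambda>n. mangoldt (Suc n) * real (Suc n) powr (-1 - \<eta>))"
      by (rule summable_mangoldt_powr) (use \<eta> in auto)
    have "complex_of_real (mangoldt (Suc n) * real (Suc n) powr (-1 - \<eta>)) = mangoldt (Suc n) * npow n (- of_real (1 + \<eta>))" for n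
      using powr_of_real[of "real (Suc n)" "-1-\<eta>"] by (simp del: of_nat_Suc)
    hence eq: "of_real (\<Sum>n. mangoldt (Suc n) * real (Suc n) powr (-1 - \<eta>)) = mseries (of_real (1 + \<eta>))"
      unfolding mseries_def using sm by (simp only: suminf_of_real)
    have "(\<Sum>n. mangoldt (Suc n) * real (Suc n) powr (-1 - \<eta>)) \<le> norm (mseries (of_real (1 + \<eta>)))"
      unfolding eq[symmetric] by simp
    also have "mseries (of_real (1 + \<eta>)) = 1 / of_real \<eta> - q \<eta>"
      using \<eta> by (subst mseries_eq) (auto simp: q_def)
    also have "norm \<dots> \<le> 1 / \<eta> + B"
      using norm_triangle_ineq4[of "1 / of_real \<eta>" "q \<eta>"] B(2)[of \<eta>] \<eta> by (simp add: norm_divide)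
    also have "\<dots> \<le> (1 + B) / \<eta>" using \<eta> B by (simp add: field_simps mult_left_le)
    finally show "(\<Sum>n. mangoldt (Suc n) * real (Suc n) powr (-1 - \<eta>)) \<le> (1 + B) / \<eta>" .
  qed (use B in auto)
qed

text \<open>The quotient (ln d + 1) / d bounds the change of the argument when H(n/d) is replaced by
  ln n, and min 1 (X / d) is the Lipschitz factor of \<open>exp_defect_diff_le\<close>.\<close>

definition tail_weight :: "real \<Rightarrow> nat \<Rightarrow> real" where
  "tail_weight X d = mangoldt d * ((ln (real d) + 1) / real d * min 1 (X / real d))"

text \<open>Rankin's trick: \<open>min 1 (X/d) \<le> (X/d)\<^sup>\<delta>\<close> with \<open>\<delta> = 1 / ln X\<close>.\<close>
lemma tail_weight_sum:
  obtains C where "C > 0" "\<And>X. X \<ge> exp 1 \<Longrightarrow> summable (\<lambda>n. tail_weight X (Suc n)) \<and>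
     (\<Sum>n. tail_weight X (Suc n)) \<le> C * (ln X)\<^sup>2"
proof -
  obtain C where C: "C > 0" "\<And>\<eta>. 0 < \<eta> \<Longrightarrow> \<eta> \<le> 1 \<Longrightarrow>
     (\<Sum>n. mangoldt (Suc n) * real (Suc n) powr (-1 - \<eta>)) \<le> C / \<eta>"
    using mangoldt_series_bound by metis
  show ?thesis
  proof (rule that[of "8 * exp 1 * C"])
    fix X :: real assume X: "X \<ge> exp 1"
    have X0: "X > 0" using X exp_gt_zero[of "1::real"] by linarith
    have lX: "ln X \<ge> 1" using X X0 by (simp add: ln_ge_iff)
    define \<delta> where "\<delta> = 1 / ln X"
    have \<delta>: "0 < \<delta>" "\<delta> \<le> 1" using lX by (auto simp: \<delta>_def divide_le_eq_1)
    have Xd: "X powr \<delta> = exp 1" using X0 lX by (auto simp: powr_def \<delta>_def)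
    have le: "tail_weight X (Suc n) \<le> 4 * exp 1 / \<delta> * (mangoldt (Suc n) * real (Suc n) powr (-1 - \<delta>/2))" for n
    proof -
      define d where "d = real (Suc n)"
      have d: "d \<ge> 1" by (simp add: d_def)
      have "min 1 (X / d) \<le> (X / d) powr \<delta>"
      proof (cases "X / d \<ge> 1")
        case True
        thus ?thesis using \<delta> by (simp add: ge_one_powr_ge_zero)
      next
        case False
        hence "(X / d) powr 1 \<le> (X / d) powr \<delta>" using \<delta> X0 d by (intro powr_mono') auto
        thus ?thesis using False X0 d by simp
      qed
      also have "(X / d) powr \<delta> = exp 1 * d powr (- \<delta>)"
        using X0 d by (simp add: powr_divide Xd powr_minus_divide)
      finally have 1: "min 1 (X / d) \<le> exp 1 * d powr (- \<delta>)" .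
      have p1: "1 \<le> d powr (\<delta>/2)" using d \<delta> by (simp add: ge_one_powr_ge_zero)
      \<comment> \<open>Half of the exponent delta is spent on ln d, at the price 1 / delta; the
        other half keeps the series convergent and costs another 1 / delta. Together this is the (ln
        X)^2.\<close>
      have "ln d \<le> d powr (\<delta>/2) / (\<delta>/2)" using d \<delta> by (intro ln_le_powr) auto
      moreover have "1 \<le> d powr (\<delta>/2) / (\<delta>/2)" using p1 \<delta> by (simp add: le_divide_eq)
      ultimately have 2: "ln d + 1 \<le> 4 / \<delta> * d powr (\<delta>/2)" using \<delta> by (simp add: field_simps)
      have "(ln d + 1) / d * min 1 (X / d) \<le> (4 / \<delta> * d powr (\<delta>/2)) / d * (exp 1 * d powr (- \<delta>))"
        using 1 2 d X0 \<delta> by (intro mult_mono divide_right_mono) auto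
      also have "\<dots> = 4 * exp 1 / \<delta> * (d powr (\<delta>/2) * d powr (-1) * d powr (- \<delta>))"
        using d by (simp add: powr_minus_divide mult_ac)
      also have "d powr (\<delta>/2) * d powr (-1) * d powr (- \<delta>) = d powr (-1 - \<delta>/2)"
        unfolding powr_add[symmetric] by (rule arg_cong[of _ _ "\<lambda>e. d powr e"]) simp
      finally have "mangoldt (Suc n) * ((ln d + 1) / d * min 1 (X / d)) \<le> mangoldt (Suc n) * (4 * exp 1 / \<delta> * d powr (-1 - \<delta>/2))"
        by (intro mult_left_mono mangoldt_nonneg)
      thus ?thesis by (simp add: tail_weight_def d_def mult_ac)
    qed
    have sm: "summable (\<lambda>n. mangoldt (Suc n) * real (Suc n) powr (-1 - \<delta>/2))"
      by (rule summable_mangoldt_powr) (use \<delta> in auto)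
    have nn: "tail_weight X (Suc n) \<ge> 0" for n
      unfolding tail_weight_def using X0 by (intro mult_nonneg_nonneg divide_nonneg_nonneg mangoldt_nonneg add_nonneg_nonneg) auto
    have s: "summable (\<lambda>n. tail_weight X (Suc n))"
      by (rule summable_comparison_test'[OF summable_mult[OF sm, of "4 * exp 1 / \<delta>"], of 0]) (use le nn in \<open>simp del: of_nat_Suc\<close>)
    have "(\<Sum>n. tail_weight X (Suc n)) \<le> (\<Sum>n. 4 * exp 1 / \<delta> * (mangoldt (Suc n) * real (Suc n) powr (-1 - \<delta>/2)))"
      by (intro suminf_le le s summable_mult sm)
    also have "\<dots> = 4 * exp 1 / \<delta> * (\<Sum>n. mangoldt (Suc n) * real (Suc n) powr (-1 - \<delta>/2))" by (rule suminf_mult[OF sm])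
    also have "\<dots> \<le> 4 * exp 1 / \<delta> * (C / (\<delta>/2))" using \<delta> by (intro mult_left_mono C(2)) auto
    also have "\<dots> = 8 * exp 1 * C * (ln X)\<^sup>2" by (simp add: \<delta>_def power2_eq_square)
    finally show "summable (\<lambda>n. tail_weight X (Suc n)) \<and> (\<Sum>n. tail_weight X (Suc n)) \<le> 8 * exp 1 * C * (ln X)\<^sup>2"
      using s by blast
  qed (use C in auto)
qed

text \<open>The linear term is split off exactly before any approximation of H(n/d): replacing
  H(n/d) by ln n inside it would cost as much as the main term, since the sum of mangoldt(d) (ln d)
  / d over d <= n has order (ln n)^2.\<close>

lemma expectation_reduction:
  obtains C where "C > 0" "\<And>n. ln (real n) \<ge> 2 \<Longrightarrow>
    \<bar>(\<Sum>d=1..n. mangoldt d * (1 - no_multiple_prob d (n div d))) - ((ln (real n))\<^sup>2 / 2 - mangoldt_exp_sum (ln (real n)))\<bar>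
      \<le> C * (1 + (ln (ln (real n) + 1))\<^sup>2)"
proof -
  obtain C1 where C1: "\<And>n. n \<ge> 3 \<Longrightarrow> \<bar>(\<Sum>m=1..n. ln (real m) / real m) - (ln (real n))\<^sup>2 / 2\<bar> \<le> C1"
    using sum_ln_over by metis
  obtain C2 where C2: "C2 > 0" "\<And>X. X \<ge> exp 1 \<Longrightarrow> summable (\<lambda>n. tail_weight X (Suc n)) \<and>
     (\<Sum>n. tail_weight X (Suc n)) \<le> C2 * (ln X)\<^sup>2"
    using tail_weight_sum by metis
  have s2: "summable (\<lambda>n. mangoldt (Suc n) / real (Suc n) ^ 2 :: real)" by (rule mseries_of_nat) auto
  define K where "K = (\<Sum>n. mangoldt (Suc n) / real (Suc n) ^ 2 :: real)"
  have K: "K \<ge> 0" unfolding K_def by (intro suminf_nonneg s2) (auto simp: mangoldt_nonneg)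
  show ?thesis
  proof (rule that[of "\<bar>C1\<bar> + 2 * K + C2"])
    fix n :: nat assume n: "ln (real n) \<ge> 2"
    define x where "x = ln (real n)"
    have x: "x \<ge> 2" using n by (simp add: x_def)
    have n0: "n > 0" using n by (intro Nat.gr0I) auto
    have "real n = exp x" using n0 by (simp add: x_def)
    hence "real n \<ge> 3" using exp_ge_add_one_self[of x] x by linarith
    hence n3: "n \<ge> 3" by simp
    \<comment> \<open>Cut off at n, so that the finite sum can be compared termwise with the full
      series \<open>mangoldt_exp_sum\<close>.\<close>
    define h where "h = (\<lambda>d. if d \<le> n then exp_defect (harm (n div d) / real d) else 0)"
    define P where "P = (\<lambda>d. no_multiple_prob d (n div d))"
    have "(\<Sum>d=1..n. mangoldt d * (1 - P d)) - (\<Sum>m=1..n. ln (real m) / real m) =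
        - (\<Sum>d=1..n. mangoldt d * (P d - exp (- (harm (n div d) / real d)))) - (\<Sum>d=1..n. mangoldt d * h d)"
      unfolding sum_mangoldt_harm[symmetric] sum_subtractf[symmetric] sum_negf[symmetric]
      by (intro sum.cong refl) (simp add: h_def exp_defect_def algebra_simps)
    moreover have "\<bar>\<Sum>d=1..n. mangoldt d * (P d - exp (- (harm (n div d) / real d)))\<bar> \<le> 2 * K"
    proof -
      have "\<bar>\<Sum>d=1..n. mangoldt d * (P d - exp (- (harm (n div d) / real d)))\<bar> \<le> (\<Sum>d=1..n. 2 * (mangoldt d / (real d) ^ 2))"
      proof (rule order.trans[OF sum_abs sum_mono])
        fix d assume d: "d \<in> {1..n}"
        show "\<bar>mangoldt d * (P d - exp (- (harm (n div d) / real d)))\<bar> \<le> 2 * (mangoldt d / (real d) ^ 2)"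
        \<comment> \<open>The product estimate requires d >= 2, and
          \<open>mangoldt 1 = 0\<close>.\<close>
        proof (cases "d = 1")
          case False
          hence "\<bar>P d - exp (- (harm (n div d) / real d))\<bar> \<le> 2 / (real d)\<^sup>2"
            unfolding P_def using d by (intro no_multiple_prob_approx) auto
          hence "mangoldt d * \<bar>P d - exp (- (harm (n div d) / real d))\<bar> \<le> mangoldt d * (2 / (real d)\<^sup>2)"
            by (intro mult_left_mono mangoldt_nonneg)
          thus ?thesis by (simp add: abs_mult mult.commute)
        qed auto
      qed
      also have "\<dots> = 2 * (\<Sum>d=1..n. mangoldt d / (real d) ^ 2)" by (simp only: sum_distrib_left)
      also have "(\<Sum>d=1..n. mangoldt d / (real d) ^ 2) = (\<Sum>k<n. mangoldt (Suc k) / (real (Suc k)) ^ 2)"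
        by (rule sum.reindex_bij_witness[of _ Suc "\<lambda>d. d - 1"]) auto
      also have "\<dots> \<le> K" unfolding K_def by (intro sum_le_suminf s2) (auto simp: mangoldt_nonneg)
      finally show ?thesis by simp
    qed
    moreover have "\<bar>(\<Sum>d=1..n. mangoldt d * h d) - mangoldt_exp_sum x\<bar> \<le> C2 * (ln (x + 1))\<^sup>2"
    proof -
      have X: "x + 1 \<ge> exp 1" using x exp_le by linarith
      have bd: "\<bar>mangoldt d * h d - mangoldt d * exp_defect (x / real d)\<bar> \<le> tail_weight (x + 1) d" if d: "d \<ge> 1" for d
      proof -
        have ld: "ln (real d) \<ge> 0" using d by simp
        have "\<bar>h d - exp_defect (x / real d)\<bar> \<le> (ln (real d) + 1) / real d * min 1 ((x + 1) / real d)"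
        proof (cases "d \<le> n")
          case True
          define m where "m = n div d"
          have m: "m \<ge> 1" using True d by (simp add: m_def div_greater_zero_iff Suc_le_eq)
          have mn: "m \<le> n" by (simp add: m_def)
          have up: "harm m \<le> x + 1"
          proof -
            have "ln (real m) \<le> x" unfolding x_def using m mn by simp
            thus ?thesis using harm_le_ln[OF m] by linarith
          qed
          \<comment> \<open>From n < (m + 1) d and \<open>harm m\<close> >= ln (m + 1). The loss ln
            d reappears in \<open>tail_weight\<close>.\<close>
          have lo: "harm m \<ge> x - ln (real d)"
          proof -
            have "n < (m + 1) * d" unfolding m_def using d dividend_less_div_times[of d n] by (simp add: algebra_simps)
            hence "real n \<le> (real m + 1) * real d" by (metis less_imp_le of_nat_1 of_nat_add of_nat_le_iff of_nat_mult)
            hence "x \<le> ln ((real m + 1) * real d)" unfolding x_def using n0 by simp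
            also have "\<dots> = ln (real m + 1) + ln (real d)" using d by (simp add: ln_mult)
            finally show ?thesis using harm_ge_ln[of m] by linarith
          qed
          have "\<bar>harm m / real d - x / real d\<bar> = \<bar>harm m - x\<bar> / real d" by (simp add: diff_divide_distrib[symmetric])
          also have "\<dots> \<le> (ln (real d) + 1) / real d"
          proof (rule divide_right_mono)
            show "\<bar>harm m - x\<bar> \<le> ln (real d) + 1" using up lo ld by linarith
          qed auto
          finally have dif: "\<bar>harm m / real d - x / real d\<bar> \<le> (ln (real d) + 1) / real d" .
          have "\<bar>exp_defect (harm m / real d) - exp_defect (x / real d)\<bar> \<le> \<bar>harm m / real d - x / real d\<bar> * min 1 ((x + 1) / real d)"
            by (rule exp_defect_diff_le) (use up x harm_nonneg[of m, where ?'a = real] in \<open>auto intro: divide_right_mono\<close>)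
          also have "\<dots> \<le> (ln (real d) + 1) / real d * min 1 ((x + 1) / real d)"
            using dif x by (intro mult_right_mono) auto
          finally show ?thesis using True by (simp add: h_def m_def)
        next
          case False
          \<comment> \<open>For d > n the cut-off term is 0 and x <= ln d, so the bounds y and y^2
            for \<open>exp_defect y\<close> already fit under the weight.\<close>
          have y: "x / real d \<ge> 0" using x by simp
          have "exp_defect (x / real d) \<le> x / real d * min 1 (x / real d)"
            using exp_defect_le[OF y] exp_defect_le_square[OF y] by (auto simp: min_def power2_eq_square)
          also have "\<dots> \<le> (ln (real d) + 1) / real d * min 1 ((x + 1) / real d)"
          proof (intro mult_mono)
            have "x \<le> ln (real d)" unfolding x_def using False n0 by simp
            thus "x / real d \<le> (ln (real d) + 1) / real d" by (intro divide_right_mono) auto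
            show "min 1 (x / real d) \<le> min 1 ((x + 1) / real d)"
              by (intro min.mono divide_right_mono) auto
          qed (use x ld in auto)
          finally show ?thesis using False exp_defect_nonneg[of "x / real d"] by (simp add: h_def)
        qed
        hence "mangoldt d * \<bar>h d - exp_defect (x / real d)\<bar> \<le> tail_weight (x + 1) d"
          unfolding tail_weight_def by (intro mult_left_mono mangoldt_nonneg)
        moreover have "mangoldt d * \<bar>h d - exp_defect (x / real d)\<bar> = \<bar>mangoldt d * h d - mangoldt d * exp_defect (x / real d)\<bar>"
          by (simp add: right_diff_distrib[symmetric] abs_mult)
        ultimately show ?thesis by simp
      qed
      have sF: "summable (\<lambda>k. mangoldt (Suc k) * exp_defect (x / real (Suc k)))"
        by (rule mangoldt_exp_sum_expansion) (use x in auto)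
      have hs: "(\<lambda>k. mangoldt (Suc k) * h (Suc k)) sums (\<Sum>k<n. mangoldt (Suc k) * h (Suc k))"
        by (rule sums_finite) (auto simp: h_def)
      have "(\<Sum>d=1..n. mangoldt d * h d) = (\<Sum>k<n. mangoldt (Suc k) * h (Suc k))"
        by (rule sum.reindex_bij_witness[of _ Suc "\<lambda>d. d - 1"]) auto
      hence "(\<Sum>d=1..n. mangoldt d * h d) - mangoldt_exp_sum x =
          (\<Sum>k. mangoldt (Suc k) * h (Suc k) - mangoldt (Suc k) * exp_defect (x / real (Suc k)))"
        unfolding mangoldt_exp_sum_def using suminf_diff[OF sums_summable[OF hs] sF] sums_unique[OF hs] by simp
      also have "norm \<dots> \<le> (\<Sum>k. tail_weight (x + 1) (Suc k))"
        using bd C2(2)[OF X] by (intro norm_suminf_le) (auto simp del: of_nat_Suc)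
      also have "\<dots> \<le> C2 * (ln (x + 1))\<^sup>2" using C2(2)[OF X] by blast
      finally show ?thesis by simp
    qed
    ultimately have "\<bar>(\<Sum>d=1..n. mangoldt d * (1 - P d)) - (x\<^sup>2 / 2 - mangoldt_exp_sum x)\<bar> \<le> C1 + 2 * K + C2 * (ln (x + 1))\<^sup>2"
      using C1[OF n3] unfolding x_def[symmetric] by linarith
    also have "\<dots> \<le> (\<bar>C1\<bar> + 2 * K + C2) * (1 + (ln (x + 1))\<^sup>2)"
    proof -
      have "0 \<le> (\<bar>C1\<bar> + 2 * K) * (ln (x + 1))\<^sup>2" using K by (intro mult_nonneg_nonneg) auto
      moreover have "(\<bar>C1\<bar> + 2 * K + C2) * (1 + (ln (x + 1))\<^sup>2) = \<bar>C1\<bar> + 2 * K + C2 + (\<bar>C1\<bar> + 2 * K) * (ln (x + 1))\<^sup>2 + C2 * (ln (x + 1))\<^sup>2"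
        by (simp add: algebra_simps)
      ultimately show ?thesis using C2(1) by linarith
    qed
    finally show "\<bar>(\<Sum>d=1..n. mangoldt d * (1 - no_multiple_prob d (n div d))) - ((ln (real n))\<^sup>2 / 2 - mangoldt_exp_sum (ln (real n)))\<bar>
      \<le> (\<bar>C1\<bar> + 2 * K + C2) * (1 + (ln (ln (real n) + 1))\<^sup>2)"
      by (simp add: P_def x_def)
  qed (use K C2 in auto)
qed

section \<open>The asymptotic formula\<close>

theorem theorem4:
  shows "(\<forall>n\<ge>2. zero_term (ln (real n)) summable_on nontrivial_zeta_zeros) \<and>
         (\<lambda>n::nat.
            of_real (measure_pmf.expectation (sym_group_pmf n)
                       (\<lambda>\<sigma>. ln (real (O_lcm n (cycle_count n \<sigma>)))))
            - (of_real ((ln (real n))\<^sup>2 / 2 - ln (real n) * (ln (ln (real n)) - 1))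
               + (\<Sum>\<^sub>\<infinity>\<rho>\<in>nontrivial_zeta_zeros. zero_term (ln (real n)) \<rho>)))
         \<in> O(\<lambda>n. of_real ((ln (ln (real n)))\<^sup>2) :: complex)"
proof (intro conjI allI impI)
  fix n :: nat assume n: "n \<ge> 2"
  have "reg_zero_term (ln (real n)) summable_on strip_zeros 0"
    using n by (intro reg_zero_term_summable_on) auto
  moreover have "zero_term (ln (real n)) summable_on strip_zeros 0 \<longleftrightarrow> reg_zero_term (ln (real n)) summable_on strip_zeros 0"
    by (rule summable_on_cong) (rule zero_term_eq)
  ultimately show "zero_term (ln (real n)) summable_on nontrivial_zeta_zeros"
    unfolding nontrivial_zeta_zeros_eq by blast
next
  obtain C1 where C1: "C1 > 0" "\<And>n. ln (real n) \<ge> 2 \<Longrightarrow>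
    \<bar>(\<Sum>d=1..n. mangoldt d * (1 - no_multiple_prob d (n div d))) - ((ln (real n))\<^sup>2 / 2 - mangoldt_exp_sum (ln (real n)))\<bar>
      \<le> C1 * (1 + (ln (ln (real n) + 1))\<^sup>2)"
    using expectation_reduction by blast
  obtain C2 where C2: "\<And>x. x \<ge> 1 \<Longrightarrow> norm (of_real (mangoldt_exp_sum x) -
     (of_real (x * ln x - x) - (\<Sum>\<^sub>\<infinity>p\<in>strip_zeros 0. reg_zero_term x p))) \<le> C2"
    using explicit_formula by blast
  show "(\<lambda>n::nat.
            of_real (measure_pmf.expectation (sym_group_pmf n)
                       (\<lambda>\<sigma>. ln (real (O_lcm n (cycle_count n \<sigma>)))))
            - (of_real ((ln (real n))\<^sup>2 / 2 - ln (real n) * (ln (ln (real n)) - 1))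
               + (\<Sum>\<^sub>\<infinity>\<rho>\<in>nontrivial_zeta_zeros. zero_term (ln (real n)) \<rho>)))
         \<in> O(\<lambda>n. of_real ((ln (ln (real n)))\<^sup>2) :: complex)"
  \<comment> \<open>For x = ln n >= 3 one has ln x >= 1 and ln (x + 1) <= 2 ln x, so 1 + (ln (x +
    1))^2 <= 5 (ln x)^2.\<close>
  proof (rule bigoI[of _ "5 * C1 + \<bar>C2\<bar>"])
    have "eventually (\<lambda>n::nat. ln (real n) \<ge> 3) sequentially" by real_asymp
    thus "eventually (\<lambda>n::nat. norm (of_real (measure_pmf.expectation (sym_group_pmf n)
                       (\<lambda>\<sigma>. ln (real (O_lcm n (cycle_count n \<sigma>)))))
            - (of_real ((ln (real n))\<^sup>2 / 2 - ln (real n) * (ln (ln (real n)) - 1))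
               + (\<Sum>\<^sub>\<infinity>\<rho>\<in>nontrivial_zeta_zeros. zero_term (ln (real n)) \<rho>)) :: complex)
         \<le> (5 * C1 + \<bar>C2\<bar>) * norm (of_real ((ln (ln (real n)))\<^sup>2) :: complex)) sequentially"
    proof eventually_elim
      case (elim n)
      define x where "x = ln (real n)"
      have x: "x \<ge> 3" using elim by (simp add: x_def)
      define E where "E = (\<Sum>d=1..n. mangoldt d * (1 - no_multiple_prob d (n div d)))"
      define F where "F = mangoldt_exp_sum x"
      define S where "S = (\<Sum>\<^sub>\<infinity>p\<in>strip_zeros 0. reg_zero_term x p)"
      have S: "(\<Sum>\<^sub>\<infinity>\<rho>\<in>nontrivial_zeta_zeros. zero_term x \<rho>) = S"
        unfolding S_def nontrivial_zeta_zeros_eq by (rule infsum_cong) (rule zero_term_eq)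
      have "(of_real E :: complex) - (of_real (x\<^sup>2 / 2 - x * (ln x - 1)) + S) =
          of_real (E - (x\<^sup>2 / 2 - F)) - (of_real F - (of_real (x * ln x - x) - S))"
        by (simp add: algebra_simps)
      also have "norm \<dots> \<le> norm (of_real (E - (x\<^sup>2 / 2 - F)) :: complex) + norm (of_real F - (of_real (x * ln x - x) - S))"
        by (rule norm_triangle_ineq4)
      also have "\<dots> \<le> C1 * (1 + (ln (x + 1))\<^sup>2) + \<bar>C2\<bar>"
        using C1(2)[of n] C2[of x] x elim unfolding E_def F_def S_def x_def norm_of_real by linarith
      also have "\<dots> \<le> (5 * C1 + \<bar>C2\<bar>) * (ln x)\<^sup>2"
      proof -
        have "ln x \<ge> ln 3" using x by simp
        moreover have "ln (3::real) \<ge> 1" using exp_le by (simp add: ln_ge_iff)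
        ultimately have l1: "ln x \<ge> 1" by linarith
        hence l2: "1 \<le> (ln x)\<^sup>2" by simp
        have "x + 1 \<le> x * x" using x mult_left_mono[of 3 x x] by linarith
        hence "ln (x + 1) \<le> ln (x * x)" using x by simp
        also have "\<dots> = 2 * ln x" using x by (simp add: ln_mult)
        finally have "(ln (x + 1))\<^sup>2 \<le> (2 * ln x)\<^sup>2" using x by (intro power_mono) auto
        hence "1 + (ln (x + 1))\<^sup>2 \<le> 5 * (ln x)\<^sup>2" using l2 by simp
        hence "C1 * (1 + (ln (x + 1))\<^sup>2) \<le> C1 * (5 * (ln x)\<^sup>2)" using C1(1) by (intro mult_left_mono) auto
        moreover have "\<bar>C2\<bar> * 1 \<le> \<bar>C2\<bar> * (ln x)\<^sup>2" using l2 by (intro mult_left_mono) auto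
        ultimately show ?thesis by (simp add: algebra_simps)
      qed
      finally show ?case
        unfolding expectation_ln_order x_def[symmetric] S E_def[symmetric] by (simp add: norm_power)
    qed
  qed
qed

end
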